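(* Let $n \geq 1$ be an integer and let $p > n$. Put $X(t) = (1 - \log t)^{-1}$ for $t \in (0,1]$. (1) There exist constants $B = B(n,p) \geq 1$ and $C = C(n,p) > 0$, depending only on $n$ and $p$, such that for every bounded domain $\Omega \subset \mathbb{R}^n$ containing the origin and all $u \in C_c^\infty(\Omega \setminus \{0\})$, $$\sup_{\substack{x,y \in \Omega \\ x \neq y}} \left\{ \frac{|u(x) - u(y)|}{|x-y|^{1-n/p}}\, X^{1/p}\!\left( \frac{|x-y|}{D} \right) \right\} \leq C \left[ \int_\Omega |\nabla u|^p\, dx - \left(\frac{p-n}{p}\right)^p \int_\Omega \frac{|u|^p}{|x|^p}\, dx \right]^{1/p},$$ where $D = B\, \operatorname{diam}(\Omega)$. (2) The weight function $X^{1/p}$ is optimal in the sense that the power $1/p$ cannot be decreased: for every bounded domain $\Omega \subset \mathbb{R}^n$ containing the origin and every real $\gamma < 1/p$, there do not exist constants $B \geq 1$ and $C > 0$ such that, with $D = B\,\operatorname{diam}(\Omega)$, the inequality $$\sup_{\substack{x,y \in \Omega \\ x \neq y}} \left\{ \frac{|u(x) - u(y)|}{|x-y|^{1-n/p}}\, X^{\gamma}\!\left( \frac{|x-y|}{D} \right) \right\} \leq C \left[ \int_\Omega |\nabla u|^p\, dx - \left(\frac{p-n}{p}\right)^p \int_\Omega \frac{|u|^p}{|x|^p}\, dx \right]^{1/p}$$ holds for all $u \in C_c^\infty(\Omega \setminus \{0\})$.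
   Context: A domain is an open connected subset of $\mathbb{R}^n$; $\operatorname{diam}(\Omega)$ is its diameter. Functions in $C_c^\infty(\Omega\setminus\{0\})$ are extended by zero outside their support (in particular $u(0)=0$). $X^{a}(t)$ means $(X(t))^a$. *)

theory Defs
  imports "HOL-Analysis.Analysis"
begin

definition partial_deriv :: "'n::finite \<Rightarrow> (real ^ 'n \<Rightarrow> real) \<Rightarrow> real ^ 'n \<Rightarrow> real" where
  "partial_deriv i u x = frechet_derivative u (at x) (axis i 1)"

definition gradient :: "(real ^ 'n::finite \<Rightarrow> real) \<Rightarrow> real ^ 'n \<Rightarrow> real ^ 'n" where
  "gradient u x = (\<chi> i. partial_deriv i u x)"

text \<open>
  \<open>Ck_on k S\<close> is the class \<open>C\<^sup>k(S)\<close>. It is meant for open \<open>S\<close> only: the derivatives are taken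
  with the full neighbourhood filter \<open>at x\<close>.
\<close>

primrec Ck_on :: "nat \<Rightarrow> (real ^ 'n::finite) set \<Rightarrow> (real ^ 'n \<Rightarrow> real) \<Rightarrow> bool" where
  "Ck_on 0 S u \<longleftrightarrow> continuous_on S u"
| "Ck_on (Suc k) S u \<longleftrightarrow>
     (\<forall>x\<in>S. u differentiable (at x)) \<and> (\<forall>i. Ck_on k S (partial_deriv i u))"

text \<open>
  Elements of \<open>C\<^sub>c\<^sup>\<infinity>(S)\<close> are represented by their extension by zero to the whole space;
  the condition on the support forces the value zero outside \<open>S\<close>.
\<close>

definition Cc_infinity :: "(real ^ 'n::finite) set \<Rightarrow> (real ^ 'n \<Rightarrow> real) set" where
  "Cc_infinity S = {u. (\<forall>k. Ck_on k S u) \<and>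
     compact (closure {x. u x \<noteq> 0}) \<and> closure {x. u x \<noteq> 0} \<subseteq> S}"

definition X :: "real \<Rightarrow> real" where
  "X t = inverse (1 - ln t)"

text \<open>
  The supremum is taken in the extended reals, so that no boundedness is presupposed.
\<close>

definition weighted_holder_sup ::
    "real \<Rightarrow> real \<Rightarrow> real \<Rightarrow> (real ^ 'n::finite) set \<Rightarrow> (real ^ 'n \<Rightarrow> real) \<Rightarrow> ereal" where
  "weighted_holder_sup p \<gamma> D \<Omega> u =
     (SUP (x, y) \<in> {(x, y). x \<in> \<Omega> \<and> y \<in> \<Omega> \<and> x \<noteq> y}.
        ereal (\<bar>u x - u y\<bar> / norm (x - y) powr (1 - real CARD('n) / p)
               * X (norm (x - y) / D) powr \<gamma>))"

definition hardy_difference ::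
    "real \<Rightarrow> (real ^ 'n::finite) set \<Rightarrow> (real ^ 'n \<Rightarrow> real) \<Rightarrow> real" where
  "hardy_difference p \<Omega> u =
     (LINT x:\<Omega>|lborel. norm (gradient u x) powr p)
     - ((p - real CARD('n)) / p) powr p
       * (LINT x:\<Omega>|lborel. \<bar>u x\<bar> powr p / norm x powr p)"

end

theory Submission
  imports Defs
begin

text \<open>
  Write \<open>\<alpha> = 1 - n/p\<close> and let \<open>I[u]\<close> be the Hardy difference. For every scale \<open>t > 0\<close> the following local
  estimate holds with a constant depending only on \<open>n\<close> and \<open>p\<close>:
  \<open>\<integral> (|\<nabla>u|\<^sup>p + |u|\<^sup>p/|x|\<^sup>p) \<le> C (1 + ln (1 + diam \<Omega> / t)) I[u]\<close>, the integral being taken over a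
  cube inside the annulus \<open>t/2 \<le> |x| \<le> 3t/2\<close> (\<open>annulus_energy_bound\<close>). Hardy's inequality follows from Young's
  inequality \<open>|\<xi>|\<^sup>p \<ge> p |\<eta>|\<^bsup>p-2\<^esup> \<eta>\<cdot>\<xi> - (p-1) |\<eta>|\<^sup>p\<close> with \<open>\<xi> = \<nabla>u\<close> and \<open>\<eta> = h u x/|x|\<^sup>2\<close>, \<open>h = \<alpha>\<close>,
  after an integration by parts of the mixed term. If the constant \<open>h\<^bsup>p-1\<^esup>\<close> is replaced by a profile \<open>H(|x|)\<close>,
  the coefficient of \<open>|u|\<^sup>p/|x|\<^sup>p\<close> becomes
  \<open>p\<alpha>H - (p-1)H\<^bsup>p/(p-1)\<^esup> - |x|H'\<close>, and a Riccati profile makes it exceed the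
  Hardy constant \<open>\<alpha>\<^sup>p\<close> by a multiple of \<open>1/(1 + ln (1 + diam \<Omega> / t))\<close> at scale \<open>t\<close> without falling below it
  elsewhere (\<open>riccati_profile\<close>). This bounds \<open>|u|\<^sup>p/|x|\<^sup>p\<close>; the deficit in Young's inequality then bounds
  \<open>|\<nabla>u|\<^sup>p\<close>. All \<open>p > n\<close>, also \<open>1 < p < 2\<close>, are treated alike.

  The local estimate gives the first claim by Morrey's inequality on cubes (\<open>morrey_cbox\<close>). If \<open>|x - y|\<close> is small
  compared with \<open>|x|\<close>, apply it on a cube of side comparable to \<open>|x - y|\<close> in the annulus at scale \<open>|x|\<close>. Otherwise
  both points lie within a multiple of \<open>|x - y|\<close> of the origin, and \<open>u(x)\<close> and \<open>u(y)\<close> are bounded separately by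
  means of cubes of side comparable to \<open>|x|\<close> and \<open>|y|\<close>; \<open>log_factor_bound\<close> passes from these scales to
  \<open>|x - y|\<close>.

  For the optimality, \<open>|x|\<^sup>\<alpha>\<close> is the virtual extremal of Hardy's inequality. It is cut off to
  \<open>u\<^sub>L(x) = |x|\<^sup>\<alpha> g(- ln |x| / L)\<close> with a bump function \<open>g\<close> supported in \<open>[1,3]\<close>. In the density of \<open>I[u\<^sub>L]\<close> the terms
  of order \<open>0\<close> in \<open>1/L\<close> cancel, and the term of order \<open>1\<close> integrates to zero; what remains has density at most \<open>C L\<^bsup>-2\<^esup> |x|\<^bsup>-n\<^esup>\<close> on a
  shell of logarithmic width \<open>2L\<close>, so \<open>I[u\<^sub>L] \<le> C/L\<close> (\<open>hardy_test_energy\<close>). On the other hand, at a point with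
  \<open>|x| = exp (-2L)\<close>, compared with the origin, the weighted quotient is of order \<open>L\<^bsup>-\<gamma>\<^esup>\<close>. Hence
  \<open>L\<^bsup>-\<gamma>\<^esup> \<le> C L\<^bsup>-1/p\<^esup>\<close> for large \<open>L\<close>, which forces \<open>\<gamma> \<ge> 1/p\<close>.
\<close>

section \<open>Integration by parts through dilations\<close>

lemma norm_gt_outside_cbox:
  fixes x :: "'a::euclidean_space"
  assumes "x \<notin> cbox (- (N *\<^sub>R One)) (N *\<^sub>R One)"
  shows "norm x > N"
proof -
  obtain i where i: "i \<in> Basis" "\<not> (- N \<le> x \<bullet> i \<and> x \<bullet> i \<le> N)"
    using assms by (auto simp: mem_box)
  then have "\<bar>x \<bullet> i\<bar> > N" by auto
  with Basis_le_norm[OF i(1), of x] show ?thesis by linarith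
qed


lemma continuous_bounded_support_integrable:
  fixes f :: "'a::euclidean_space \<Rightarrow> real"
  assumes "continuous_on UNIV f" and "\<And>x. norm x > r \<Longrightarrow> f x = 0"
  shows "f integrable_on UNIV"
proof -
  let ?Q = "cbox (- (r *\<^sub>R One)) (r *\<^sub>R One) :: 'a set"
  have "f integrable_on ?Q"
    by (intro integrable_continuous continuous_on_subset[OF assms(1)]) auto
  then show ?thesis
    by (rule integrable_on_superset) (use assms(2) norm_gt_outside_cbox in auto)
qed

text \<open>
  The integral of \<open>f(s x)\<close> over \<open>x\<close> equals \<open>s\<^bsup>-n\<^esup> \<integral>f\<close>; the identity is its derivative at \<open>s = 1\<close>.
  It is the divergence theorem for the field \<open>f(x) x\<close>, and it involves \<open>f\<close> only through its radial derivative \<open>D\<close>.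
\<close>

lemma integral_scaling_identity:
  fixes f D :: "'a::euclidean_space \<Rightarrow> real"
  assumes contf: "continuous_on UNIV f" and contD: "continuous_on UNIV D"
    and supp: "\<And>x. norm x > r \<Longrightarrow> f x = 0"
    and der: "\<And>x. ((\<lambda>s. f (s *\<^sub>R x)) has_real_derivative D x) (at 1)"
  shows "D integrable_on UNIV" and "integral UNIV D = - real DIM('a) * integral UNIV f"
proof -
  define N where "N = 2 * \<bar>r\<bar> + 2"
  let ?Q = "cbox (- (N *\<^sub>R One)) (N *\<^sub>R One) :: 'a set"
  have der': "((\<lambda>s. f (s *\<^sub>R x)) has_real_derivative D (s *\<^sub>R x) / s) (at s within U)"
    if "s > 0" for s x U
  proof -
    have "((\<lambda>q. f (q *\<^sub>R (s *\<^sub>R x))) has_real_derivative D (s *\<^sub>R x)) (at (s / s))"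
      using der[of "s *\<^sub>R x"] \<open>s > 0\<close> by (metis divide_self less_irrefl)
    moreover have "((\<lambda>q. q / s) has_real_derivative 1 / s) (at s within U)"
      using that by (auto intro!: derivative_eq_intros)
    ultimately have "((\<lambda>q. f ((q / s) *\<^sub>R (s *\<^sub>R x))) has_real_derivative D (s *\<^sub>R x) * (1 / s))
        (at s within U)"
      by (rule DERIV_chain2[of _ _ "\<lambda>q. q / s" s])
    then show ?thesis using that by simp
  qed
  have suppD: "D x = 0" if "norm x > r" for x
  proof -
    have "\<forall>\<^sub>F s in nhds 1. norm (s *\<^sub>R x) > r"
    proof -
      have "isCont (\<lambda>s. norm (s *\<^sub>R x)) 1" by (intro continuous_intros)
      then have "((\<lambda>s. norm (s *\<^sub>R x)) \<longlongrightarrow> norm x) (nhds 1)"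
        by (simp add: isCont_def tendsto_nhds_iff)
      then show ?thesis using that by (rule order_tendstoD)
    qed
    then have "\<forall>\<^sub>F s in nhds 1. f (s *\<^sub>R x) = 0"
      by eventually_elim (rule supp)
    then have "((\<lambda>s. f (s *\<^sub>R x)) has_real_derivative 0) (at 1)"
      by (subst DERIV_cong_ev[OF refl _ refl, where g = "\<lambda>_. 0"]) auto
    with der show ?thesis by (rule DERIV_unique)
  qed
  show Dint: "D integrable_on UNIV"
    by (rule continuous_bounded_support_integrable[OF contD suppD])
  have in_cbox: "norm x > r" if "x \<notin> ?Q" for x
    using norm_gt_outside_cbox[OF that] by (simp add: N_def)
  have small: "norm x > r" if "x \<notin> cbox (- ((s * N) *\<^sub>R One)) ((s * N) *\<^sub>R One)" "s \<ge> 1/2" for x s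
  proof -
    have "s * N \<ge> 1/2 * N" using that by (intro mult_right_mono) (auto simp: N_def)
    then show ?thesis using norm_gt_outside_cbox[OF that(1)] by (simp add: N_def)
  qed
  define I where "I = integral UNIV f"
  have fI: "(f has_integral I) UNIV"
    unfolding I_def
    by (intro integrable_integral continuous_bounded_support_integrable[OF contf supp])
  have G: "integral ?Q (\<lambda>x. f (s *\<^sub>R x)) = I / s ^ DIM('a)" if "s \<ge> 1/2" for s
  proof -
    let ?P = "cbox (- ((s * N) *\<^sub>R One)) ((s * N) *\<^sub>R One) :: 'a set"
    have "((\<lambda>x. if x \<in> ?P then f x else 0) has_integral I) UNIV"
      using fI by (rule has_integral_eq[rotated]) (use small that supp in auto)
    then have "(f has_integral I) ?P"
      by (simp only: has_integral_restrict_UNIV)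
    moreover have eq: "inverse s * (s * N) = N" and "s > 0" using that by auto
    ultimately have "((\<lambda>x. f (s *\<^sub>R x)) has_integral I /\<^sub>R s ^ DIM('a)) ?Q"
      using has_integral_affinity'[where c = 0 and m = s and f = f and i = I and
          a = "- ((s * N) *\<^sub>R One)" and b = "(s * N) *\<^sub>R One"]
      by (simp add: eq)
    then show ?thesis by (simp add: integral_unique divide_inverse mult.commute)
  qed
  have "((\<lambda>s. integral ?Q (\<lambda>x. f (s *\<^sub>R x))) has_real_derivative
      integral ?Q (\<lambda>x. D (1 *\<^sub>R x) / 1)) (at 1 within {1/2..2})"
  proof (rule leibniz_rule_field_derivative)
    show "((\<lambda>s. f (s *\<^sub>R x)) has_real_derivative D (s *\<^sub>R x) / s) (at s within {1/2..2})"
      if "s \<in> {1/2..2}" for s x using that by (intro der') auto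
    show "(\<lambda>x. f (s *\<^sub>R x)) integrable_on ?Q" for s
      by (intro integrable_continuous continuous_on_compose2[OF contf] continuous_intros) auto
    show "continuous_on ({1/2..2} \<times> ?Q) (\<lambda>(s, x). D (s *\<^sub>R x) / s)"
      unfolding split_beta
      by (intro continuous_intros continuous_on_compose2[OF contD]) auto
  qed auto
  moreover have "((\<lambda>s. integral ?Q (\<lambda>x. f (s *\<^sub>R x))) has_real_derivative - real DIM('a) * I)
      (at 1 within {1/2..2})"
  proof (rule has_field_derivative_transform_within[where f = "\<lambda>s. I / s ^ DIM('a)" and d = 1])
    show "((\<lambda>s. I / s ^ DIM('a)) has_real_derivative - real DIM('a) * I) (at 1 within {1/2..2})"
      by (auto intro!: derivative_eq_intros)
  qed (auto simp: G)
  moreover have "at 1 within {1/2..2} = at (1::real)"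
    by (rule at_within_interior) simp
  ultimately have "integral ?Q D = - real DIM('a) * I"
    using DERIV_unique by auto
  moreover have "integral ?Q D = integral UNIV D"
  proof -
    have "integral ?Q D = integral UNIV (\<lambda>x. if x \<in> ?Q then D x else 0)"
      by (simp only: integral_restrict_UNIV)
    also have "\<dots> = integral UNIV D"
      by (rule integral_cong) (use in_cbox suppD in auto)
    finally show ?thesis .
  qed
  ultimately show "integral UNIV D = - real DIM('a) * integral UNIV f"
    by (simp add: I_def)
qed

section \<open>Scalar inequalities behind the improved Hardy inequality\<close>

text \<open>
  The graph of \<open>N \<mapsto> N\<^sup>p\<close> lies above its tangent at \<open>y\<close>.
\<close>

lemma young_tangent:
  fixes N y p :: real
  assumes "p > 1" "N \<ge> 0" "y \<ge> 0"
  shows "p * N * y powr (p - 1) \<le> N powr p + (p - 1) * y powr p"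
proof -
  have "N * y powr (p - 1) \<le> N powr p / p + (y powr (p - 1)) powr (p / (p - 1)) / (p / (p - 1))"
    using assms by (intro Youngs_inequality) (auto simp: field_simps)
  also have "(y powr (p - 1)) powr (p / (p - 1)) = y powr p"
    using assms by (simp add: powr_powr)
  finally show ?thesis
    using assms by (simp add: field_simps)
qed

text \<open>
  As a function of \<open>H\<close>, the left-hand side is concave, and its maximum \<open>\<alpha>\<^sup>p\<close> is attained at
  \<open>H = \<alpha>\<^bsup>p-1\<^esup>\<close>. Moving away from the maximum therefore costs only a quadratic error.
\<close>

lemma hardy_symbol_quadratic_bound:
  fixes p \<alpha> :: real
  assumes "p > 1" "\<alpha> > 0"
  shows "\<exists>M>0. \<forall>H\<in>{\<alpha> powr (p - 1) / 2 .. \<alpha> powr (p - 1)}.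
     p * \<alpha> * H - (p - 1) * H powr (p / (p - 1)) \<ge> \<alpha> powr p - M * (\<alpha> powr (p - 1) - H)\<^sup>2"
proof -
  define h where "h = \<alpha> powr (p - 1)"
  define q where "q = 1 / (p - 1)"
  define K where "K = q * ((h / 2) powr (q - 1) + h powr (q - 1))"
  have h: "h > 0" and q: "q > 0" and p: "p > 1" using assms by (auto simp: h_def q_def)
  have K: "K > 0" using h q by (auto simp: K_def intro!: mult_pos_pos add_pos_pos)
  have hq: "h powr q = \<alpha>" using assms by (simp add: h_def q_def powr_powr)
  have pq: "p / (p - 1) = 1 + q" using p by (simp add: q_def field_simps)
  have hp: "h powr (1 + q) = \<alpha> powr p"
    using assms unfolding pq[symmetric] h_def by (simp add: powr_powr)
  have lip: "h powr q - z powr q \<le> K * (h - z)" if z: "z \<in> {h/2..h}" for z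
  proof (cases "z = h")
    case False
    then have "z < h" using z by auto
    have "\<exists>y. y > z \<and> y < h \<and> h powr q - z powr q = (h - z) * (q * y powr (q - 1))"
      by (rule MVT2[OF \<open>z < h\<close>]) (use z h in \<open>auto intro!: derivative_eq_intros\<close>)
    then obtain y where y: "z < y" "y < h" "h powr q - z powr q = (h - z) * (q * y powr (q - 1))"
      by blast
    have "y powr (q - 1) \<le> (h / 2) powr (q - 1) + h powr (q - 1)"
    proof (cases "q \<ge> 1")
      case True
      then have "y powr (q - 1) \<le> h powr (q - 1)" using y z h by (intro powr_mono2) auto
      then show ?thesis using powr_ge_zero[of "h / 2" "q - 1"] by linarith
    next
      case False
      then have "y powr (q - 1) \<le> (h / 2) powr (q - 1)" using y z h by (intro powr_mono2') auto
      then show ?thesis using powr_ge_zero[of h "q - 1"] by linarith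
    qed
    then have "q * y powr (q - 1) \<le> K" using q by (simp add: K_def)
    then have "(h - z) * (q * y powr (q - 1)) \<le> (h - z) * K" 
      using \<open>z < h\<close> by (intro mult_left_mono) auto
    then show ?thesis using y by (simp add: mult.commute)
  qed auto
  have "\<alpha> powr p - p * K * (h - H)\<^sup>2 \<le> p * \<alpha> * H - (p - 1) * H powr (p / (p - 1))"
    if H: "H \<in> {h/2..h}" for H
  proof -
    define F where "F = (\<lambda>H. p * \<alpha> * H - (p - 1) * H powr (1 + q))"
    have Fh: "F h = \<alpha> powr p"
    proof -
      have "\<alpha> * h = \<alpha> powr p" 
        using assms by (simp add: h_def powr_diff field_simps)
      then show ?thesis by (simp add: F_def hp algebra_simps)
    qed
    have "F h - F H \<le> p * K * (h - H)\<^sup>2"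
    proof (cases "H = h")
      case False
      then have "H < h" using H by auto
      have p1: "(p - 1) * (1 + q) = p" using p by (simp add: q_def field_simps)
      have "\<exists>y. y > H \<and> y < h \<and> F h - F H = (h - H) * (p * \<alpha> - p * y powr q)"
        unfolding F_def
      proof (rule MVT2[OF \<open>H < h\<close>])
        fix y assume "H \<le> y" "y \<le> h"
        then have "y > 0" using H h by auto
        then have "((\<lambda>H. p * \<alpha> * H - (p - 1) * H powr (1 + q)) has_real_derivative
            p * \<alpha> - (p - 1) * ((1 + q) * y powr (1 + q - 1))) (at y)"
          by (intro derivative_eq_intros) auto
        then show "((\<lambda>H. p * \<alpha> * H - (p - 1) * H powr (1 + q)) has_real_derivative
            p * \<alpha> - p * y powr q) (at y)"
          by (simp add: mult.assoc[symmetric] p1)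
      qed
      then obtain y where y: "H < y" "y < h" "F h - F H = (h - H) * (p * \<alpha> - p * y powr q)"
        by blast
      have "p * \<alpha> - p * y powr q = p * (h powr q - y powr q)" by (simp add: hq algebra_simps)
      also have "\<dots> \<le> p * (K * (h - y))"
        using y H p by (intro mult_left_mono lip) auto
      also have "\<dots> \<le> p * (K * (h - H))"
        using y K p by (intro mult_left_mono) auto
      finally have "(h - H) * (p * \<alpha> - p * y powr q) \<le> (h - H) * (p * (K * (h - H)))"
        using \<open>H < h\<close> by (intro mult_left_mono) auto
      then show ?thesis using y by (simp add: power2_eq_square algebra_simps)
    qed auto
    then show ?thesis using Fh by (simp add: F_def pq)
  qed
  then show ?thesis
    using p K by (intro exI[of _ "p * K"]) (auto simp: h_def)
qed

text \<open>
  Let \<open>s = ln \<rho>\<close> and \<open>h = \<alpha>\<^bsup>p-1\<^esup>\<close>. By the quadratic bound it suffices to solve the Riccati inequality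
  \<open>- dH/ds \<ge> M (h - H)\<^sup>2 + gain\<close>. For a positive concave \<open>f(s)\<close> and small \<open>\<tau>\<close>,
  \<open>H = h + \<tau> f'/f\<close> does so with gain \<open>- \<tau> f''/f\<close>. The choice
  \<open>f = A - ln (1 + \<rho>/t)\<close>, \<open>A = 1 + ln (1 + R/t)\<close>, satisfies \<open>1 \<le> f \<le> A\<close> up to the radius \<open>R\<close>, and its
  curvature \<open>\<rho> t/(\<rho> + t)\<^sup>2\<close> is of order one exactly at scale \<open>t\<close>.
\<close>

lemma riccati_profile:
  fixes p \<alpha> :: real
  assumes p: "p > 1" and \<alpha>: "\<alpha> > 0"
  shows "\<exists>\<tau>>0. \<forall>R>0. \<forall>t>0. \<exists>H H'. continuous_on {0<..R} H' \<and>
    (\<forall>\<rho>\<in>{0<..R}. (H has_real_derivative H' \<rho>) (at \<rho>) \<and> 0 \<le> H \<rho> \<and> H \<rho> \<le> \<alpha> powr (p - 1) \<and>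
       p * \<alpha> * H \<rho> - (p - 1) * H \<rho> powr (p / (p - 1)) - \<rho> * H' \<rho>
         \<ge> \<alpha> powr p + \<tau> * (\<rho> * t / (\<rho> + t)\<^sup>2) / (1 + ln (1 + R / t)))"
proof -
  define h where "h = \<alpha> powr (p - 1)"
  have h: "h > 0" using \<alpha> by (simp add: h_def)
  obtain M where M: "M > 0" and quad: "\<And>H. H \<in> {h / 2..h} \<Longrightarrow>
      p * \<alpha> * H - (p - 1) * H powr (p / (p - 1)) \<ge> \<alpha> powr p - M * (h - H)\<^sup>2"
    using hardy_symbol_quadratic_bound[OF p \<alpha>] by (auto simp: h_def)
  \<comment> \<open>The bound \<open>h/2\<close> keeps \<open>H\<close> where the quadratic estimate applies; the bound \<open>1/M\<close> lets the
    square of \<open>f'/f\<close> that appears in the derivative of \<open>H\<close> absorb the quadratic error.\<close>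
  define \<tau> where "\<tau> = min (h / 2) (1 / M)"
  have \<tau>: "\<tau> > 0" "\<tau> \<le> h / 2" "\<tau> * M \<le> 1"
    using M h by (auto simp: \<tau>_def min_def field_simps)
  have "\<exists>H H'. continuous_on {0<..R} H' \<and>
    (\<forall>\<rho>\<in>{0<..R}. (H has_real_derivative H' \<rho>) (at \<rho>) \<and> 0 \<le> H \<rho> \<and> H \<rho> \<le> h \<and>
       p * \<alpha> * H \<rho> - (p - 1) * H \<rho> powr (p / (p - 1)) - \<rho> * H' \<rho>
         \<ge> \<alpha> powr p + \<tau> * (\<rho> * t / (\<rho> + t)\<^sup>2) / (1 + ln (1 + R / t)))"
    if R: "R > 0" and t: "t > 0" for R t :: real
  proof -
    define A where "A = 1 + ln (1 + R / t)"
    define f where "f = (\<lambda>\<rho>. A - ln (1 + \<rho> / t))"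
    define H where "H = (\<lambda>\<rho>. h - \<tau> * (\<rho> / (\<rho> + t) / f \<rho>))"
    define H' where "H' = (\<lambda>\<rho>. - \<tau> * (t / (\<rho> + t)\<^sup>2 / f \<rho> + \<rho> / (\<rho> + t)\<^sup>2 / (f \<rho>)\<^sup>2))"
    have f1: "1 \<le> f \<rho> \<and> f \<rho> \<le> A" if "\<rho> \<in> {0<..R}" for \<rho>
    proof -
      have "1 + \<rho> / t \<le> 1 + R / t" "1 + \<rho> / t \<ge> 1" using that t by (auto simp: divide_right_mono)
      then show ?thesis by (auto simp: f_def A_def intro!: ln_mono)
    qed
    have der: "(H has_real_derivative H' \<rho>) (at \<rho>)" if \<rho>: "\<rho> \<in> {0<..R}" for \<rho>
    proof -
      have f0: "f \<rho> \<noteq> 0" using f1[OF \<rho>] by auto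
      have pos: "1 + \<rho> / t > 0" "\<rho> + t > 0" using \<rho> t by (auto intro: add_pos_nonneg)
      have e: "1 / t / (1 + \<rho> / t) = 1 / (\<rho> + t)" using t \<rho> by (simp add: field_simps)
      have df: "(f has_real_derivative - (1 / (\<rho> + t))) (at \<rho>)"
        unfolding f_def using pos t
        by (auto intro!: derivative_eq_intros simp: e[symmetric])
      have ds: "((\<lambda>\<rho>. \<rho> / (\<rho> + t)) has_real_derivative t / (\<rho> + t)\<^sup>2) (at \<rho>)"
        using pos by (auto intro!: derivative_eq_intros simp: power2_eq_square)
      have alg: "(a / r\<^sup>2 * F - b / r * - (1 / r)) / (F * F) = a / r\<^sup>2 / F + b / r\<^sup>2 / F\<^sup>2"
        if "F \<noteq> 0" for a b r F :: real
        using that by (simp add: power2_eq_square add_divide_distrib)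
      show ?thesis
        unfolding H_def H'_def
        by (rule DERIV_cong[OF DERIV_diff[OF DERIV_const DERIV_cmult[OF DERIV_divide[OF ds df f0]]]])
          (simp only: alg[OF f0] diff_0 mult_minus_left)
    qed
    have main: "0 \<le> H \<rho> \<and> H \<rho> \<le> h \<and>
       p * \<alpha> * H \<rho> - (p - 1) * H \<rho> powr (p / (p - 1)) - \<rho> * H' \<rho>
         \<ge> \<alpha> powr p + \<tau> * (\<rho> * t / (\<rho> + t)\<^sup>2) / A" if \<rho>: "\<rho> \<in> {0<..R}" for \<rho>
    proof -
      define q where "q = \<rho> / (\<rho> + t) / f \<rho>"
      note f = f1[OF \<rho>]
      have s: "0 \<le> \<rho> / (\<rho> + t)" "\<rho> / (\<rho> + t) \<le> 1" using \<rho> t by (auto simp: field_simps)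
      have q: "0 \<le> q" "q \<le> 1"
        using s f divide_nonneg_pos[of "\<rho> / (\<rho> + t)" "f \<rho>"]
          divide_le_eq_1_pos[of "f \<rho>" "\<rho> / (\<rho> + t)"] by (auto simp only: q_def)
      have Hq: "H \<rho> = h - \<tau> * q" by (simp add: H_def q_def)
      have "\<tau> * q \<le> \<tau> * 1" using \<tau>(1) q by (intro mult_left_mono) auto
      then have tq: "0 \<le> \<tau> * q" "\<tau> * q \<le> h / 2"
        using \<tau>(1,2) q(1) by (simp, linarith)
      have F: "p * \<alpha> * H \<rho> - (p - 1) * H \<rho> powr (p / (p - 1)) \<ge> \<alpha> powr p - M * (\<tau> * q)\<^sup>2"
        using quad[of "H \<rho>"] Hq tq by auto
      have "\<tau> * M * (\<tau> * q\<^sup>2) \<le> 1 * (\<tau> * q\<^sup>2)" using \<tau> by (intro mult_right_mono) auto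
      then have b: "M * (\<tau> * q)\<^sup>2 \<le> \<tau> * q\<^sup>2" by (simp add: power2_eq_square algebra_simps)
      have "- \<rho> * H' \<rho> = \<tau> * (\<rho> * t / (\<rho> + t)\<^sup>2) / f \<rho> + \<tau> * q\<^sup>2"
        by (simp add: H'_def q_def power2_eq_square algebra_simps)
      moreover have "\<tau> * (\<rho> * t / (\<rho> + t)\<^sup>2) / f \<rho> \<ge> \<tau> * (\<rho> * t / (\<rho> + t)\<^sup>2) / A"
        using f \<tau> \<rho> t by (intro divide_left_mono) auto
      ultimately show ?thesis
        using F b tq Hq h by auto
    qed
    have "continuous_on {0<..R} H'"
      unfolding H'_def f_def
    proof (intro continuous_intros; (rule ballI)?)
      fix \<rho> assume \<rho>: "\<rho> \<in> {0<..R}"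
      have *: "1 + \<rho> / t > 0" using \<rho> t by (auto intro: add_pos_nonneg)
      show "(\<rho> + t)\<^sup>2 \<noteq> 0" "1 + \<rho> / t \<noteq> 0" using \<rho> t * by auto
      show "A - ln (1 + \<rho> / t) \<noteq> 0" "(A - ln (1 + \<rho> / t))\<^sup>2 \<noteq> 0"
        using f1[OF \<rho>] by (auto simp: f_def)
    qed (use t in \<open>auto simp: field_simps\<close>)
    with der main show ?thesis unfolding A_def by blast
  qed
  with \<tau>(1) show ?thesis unfolding h_def by blast
qed

text \<open>
  Here \<open>N\<close> stands for \<open>|\<nabla>u|\<close>, \<open>b\<close> for \<open>|u|/|x|\<close>, \<open>S\<close> for the radial derivative of \<open>|u|\<close>, \<open>H\<close> and \<open>G\<close> for
  the profile and for the coefficient of \<open>|u|\<^sup>p/|x|\<^sup>p\<close> that it produces. The subtracted bracket is the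
  divergence that integrates to zero. The proof splits the left-hand side into the deficit \<open>E\<close> of Young's
  inequality and the gain \<open>(G - \<alpha>\<^sup>p) b\<^sup>p\<close>. The deficit is nonnegative and is also at least \<open>N\<^sup>p/2 - C b\<^sup>p\<close>, so a
  fraction \<open>k/A\<close> of it yields \<open>N\<^sup>p\<close> at the expense of half of the gain.
\<close>

lemma hardy_pointwise_gain:
  fixes p \<alpha> \<theta> :: real
  assumes p: "p > 1" and \<alpha>: "\<alpha> > 0" and \<theta>: "\<theta> > 0"
  shows "\<exists>c>0. \<forall>N b H S G A. N \<ge> 0 \<longrightarrow> b \<ge> 0 \<longrightarrow> 0 \<le> H \<longrightarrow> H \<le> \<alpha> powr (p - 1) \<longrightarrow> \<bar>S\<bar> \<le> N \<longrightarrow> A \<ge> 1 \<longrightarrow>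
      G \<ge> \<alpha> powr p + \<theta> / A \<longrightarrow>
      N powr p - \<alpha> powr p * b powr p
        - (p * H * b powr (p - 1) * S - (G + (p - 1) * H powr (p / (p - 1))) * b powr p)
      \<ge> c / A * (N powr p + b powr p)"
proof -
  define C where "C = (p - 1) * 2 powr (1 / (p - 1)) * \<alpha> powr p"
  define k where "k = min 1 (\<theta> / (2 * C))"
  have C: "C > 0" using p \<alpha> by (simp add: C_def)
  have k: "k > 0" "k \<le> 1" "k * C \<le> \<theta> / 2"
    using C \<theta> by (auto simp: k_def min_def field_simps)
  define c where "c = min (k / 2) (\<theta> / 2)"
  have c: "c > 0" "c \<le> k / 2" "c \<le> \<theta> / 2" using k \<theta> by (auto simp: c_def)
  show ?thesis
  proof (rule exI[of _ c], intro conjI allI impI)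
    fix N b H S G A :: real
    assume N: "N \<ge> 0" and b: "b \<ge> 0" and H: "0 \<le> H" "H \<le> \<alpha> powr (p - 1)" and S: "\<bar>S\<bar> \<le> N"
      and A: "A \<ge> 1" and G: "G \<ge> \<alpha> powr p + \<theta> / A"
    define y where "y = H powr (1 / (p - 1)) * b"
    define w where "w = b powr p"
    define V where "V = N powr p"
    define E where "E = V - p * H * b powr (p - 1) * S + (p - 1) * H powr (p / (p - 1)) * w"
    have w: "w \<ge> 0" and V: "V \<ge> 0" by (auto simp: w_def V_def)
    have y: "y \<ge> 0" using b by (simp add: y_def)
    have y1: "y powr (p - 1) = H * b powr (p - 1)"
      using H b p by (simp add: y_def powr_mult powr_powr)
    have yp: "y powr p = H powr (p / (p - 1)) * w"
      using H b p by (simp add: y_def powr_mult powr_powr w_def)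
    have yw: "y powr p \<le> \<alpha> powr p * w"
    proof -
      have "H powr (p / (p - 1)) \<le> (\<alpha> powr (p - 1)) powr (p / (p - 1))"
        using H p by (intro powr_mono2) auto
      also have "\<dots> = \<alpha> powr p" using p by (simp add: powr_powr)
      finally show ?thesis unfolding yp using w by (intro mult_right_mono)
    qed
    have S': "p * H * b powr (p - 1) * S \<le> p * N * y powr (p - 1)"
    proof -
      have "p * H * b powr (p - 1) * S \<le> p * H * b powr (p - 1) * N"
        using S H p by (intro mult_left_mono) auto
      then show ?thesis by (simp add: y1 algebra_simps)
    qed
    have E1: "E \<ge> 0"
      using young_tangent[OF p N y] S' by (simp add: E_def yp V_def algebra_simps)
    have E2: "E \<ge> V / 2 - C * w"
    proof -
      \<comment> \<open>Young's inequality for \<open>N/l\<close> and \<open>m y\<close>; the weights satisfy \<open>l\<^sup>p = 2\<close> and \<open>m\<^bsup>p-1\<^esup> = l\<close>.\<close>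
      define l :: real where "l = 2 powr (1 / p)"
      define m :: real where "m = 2 powr (1 / (p * (p - 1)))"
      have "p * (N / l) * (m * y) powr (p - 1) \<le> (N / l) powr p + (p - 1) * (m * y) powr p"
        using N y by (intro young_tangent[OF p]) (auto simp: l_def m_def)
      moreover have "(N / l) powr p = V / 2"
        using N p by (simp add: powr_divide l_def powr_powr V_def)
      moreover have "(m * y) powr (p - 1) = l * y powr (p - 1)"
        using y p by (simp add: powr_mult m_def l_def powr_powr)
      moreover have "(m * y) powr p = 2 powr (1 / (p - 1)) * y powr p"
        using y p by (simp add: powr_mult m_def powr_powr)
      moreover have "l > 0" by (simp add: l_def)
      ultimately have "p * N * y powr (p - 1) \<le> V / 2 + (p - 1) * (2 powr (1 / (p - 1)) * y powr p)"
        by simp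
      also have "(p - 1) * (2 powr (1 / (p - 1)) * y powr p)
          \<le> (p - 1) * (2 powr (1 / (p - 1)) * (\<alpha> powr p * w))"
        using p yw by (intro mult_left_mono) auto
      finally have "p * N * y powr (p - 1) \<le> V / 2 + C * w" by (simp add: C_def algebra_simps)
      moreover have "0 \<le> (p - 1) * H powr (p / (p - 1)) * w" using p w by simp
      ultimately show ?thesis using S' by (simp add: E_def)
    qed
    have kA: "0 \<le> k / A" "k / A \<le> 1" using k A by (auto simp: divide_le_eq)
    have "k / A * (V / 2 - C * w) \<le> k / A * E" using kA E2 by (intro mult_left_mono) auto
    also have "\<dots> \<le> 1 * E" using kA E1 by (intro mult_right_mono)
    finally have "E \<ge> k / A * (V / 2 - C * w)" by simp
    moreover have "(G - \<alpha> powr p) * w \<ge> \<theta> / A * w" using G w by (intro mult_right_mono) auto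
    moreover have "c / A * (V + w) \<le> k / A * (V / 2 - C * w) + \<theta> / A * w"
    proof -
      have "c * V \<le> k / 2 * V" using c V by (intro mult_right_mono) auto
      moreover have "c * w + k * C * w \<le> \<theta> / 2 * w + \<theta> / 2 * w"
        using c k w by (intro add_mono mult_right_mono) auto
      ultimately have "c * (V + w) \<le> k * (V / 2 - C * w) + \<theta> * w" by (simp add: algebra_simps)
      then have "c * (V + w) / A \<le> (k * (V / 2 - C * w) + \<theta> * w) / A"
        using A by (intro divide_right_mono) auto
      then show ?thesis by (simp add: add_divide_distrib)
    qed
    ultimately show "c / A * (N powr p + b powr p) \<le> N powr p - \<alpha> powr p * b powr p
        - (p * H * b powr (p - 1) * S - (G + (p - 1) * H powr (p / (p - 1))) * b powr p)"
      by (simp add: E_def V_def w_def algebra_simps)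
  qed (use c in auto)
qed

section \<open>The energy estimate on annuli\<close>

lemma continuous_on_zero_extension:
  fixes f :: "'a::topological_space \<Rightarrow> 'b::real_normed_vector"
  assumes "open S" "closed K" "K \<subseteq> S" "continuous_on S f" "\<And>x. x \<notin> K \<Longrightarrow> f x = 0"
  shows "continuous_on UNIV f"
proof -
  have "continuous_on (- K) f"
    using assms(5) by (subst continuous_on_cong[OF refl, of _ _ "\<lambda>_. 0"]) auto
  then have "continuous_on (S \<union> - K) f"
    using assms by (intro continuous_on_open_Un) auto
  moreover have "S \<union> - K = UNIV" using assms(3) by auto
  ultimately show ?thesis by simp
qed

lemma has_derivative_gradient:
  fixes u :: "real ^ 'n::finite \<Rightarrow> real"
  assumes "u differentiable (at x)"
  shows "(u has_derivative (\<lambda>v. gradient u x \<bullet> v)) (at x)"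
proof -
  let ?d = "frechet_derivative u (at x)"
  have d: "(u has_derivative ?d) (at x)"
    using assms by (simp add: frechet_derivative_works)
  then have lin: "linear ?d" by (rule has_derivative_linear)
  have "?d v = gradient u x \<bullet> v" for v
  proof -
    have "?d v = ?d (\<Sum>i\<in>UNIV. v $ i *\<^sub>R axis i 1)"
      by (simp add: basis_expansion scalar_mult_eq_scaleR[symmetric])
    also have "\<dots> = (\<Sum>i\<in>UNIV. v $ i * ?d (axis i 1))"
      by (simp add: linear_sum[OF lin] linear_cmul[OF lin])
    finally show ?thesis
      by (simp add: inner_vec_def gradient_def partial_deriv_def mult.commute)
  qed
  then have "?d = (\<lambda>v. gradient u x \<bullet> v)" by auto
  with d show ?thesis by simp
qed

lemma gradient_eq:
  fixes u :: "real ^ 'n::finite \<Rightarrow> real"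
  assumes "(u has_derivative (\<lambda>v. g \<bullet> v)) (at x)"
  shows "gradient u x = g"
proof -
  have "frechet_derivative u (at x) = (\<lambda>v. g \<bullet> v)"
    using frechet_derivative_at[OF assms] by simp
  then show ?thesis
    by (simp add: vec_eq_iff gradient_def partial_deriv_def inner_axis)
qed

text \<open>
  The definition controls derivatives only inside \<open>S\<close>; since the function vanishes off a compact subset \<open>K\<close>
  of \<open>S\<close>, it is continuously differentiable on the whole space.
\<close>

lemma Cc_infinity_props:
  fixes u :: "real ^ 'n::finite \<Rightarrow> real"
  assumes S: "open S" and u: "u \<in> Cc_infinity S"
  obtains K where "compact K" "K \<subseteq> S" "\<And>x. x \<notin> K \<Longrightarrow> u x = 0"
    "\<And>x. x \<notin> K \<Longrightarrow> gradient u x = 0"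
    "\<And>x. (u has_derivative (\<lambda>v. gradient u x \<bullet> v)) (at x)"
    "continuous_on UNIV (gradient u)"
proof -
  define K where "K = closure {x. u x \<noteq> 0}"
  have K: "compact K" "K \<subseteq> S" using u by (auto simp: Cc_infinity_def K_def)
  have C1: "Ck_on 1 S u" using u by (simp add: Cc_infinity_def)
  have u0: "u x = 0" if "x \<notin> K" for x
    using that closure_subset[of "{x. u x \<noteq> 0}"] by (auto simp: K_def)
  have der0: "(u has_derivative (\<lambda>v. 0 \<bullet> v)) (at x)" if "x \<notin> K" for x
  proof -
    have "((\<lambda>_. 0) has_derivative (\<lambda>v. 0 \<bullet> v)) (at x)" by simp
    then show ?thesis
      by (rule has_derivative_transform_within_open[where s = "- K"])
        (use that u0 K compact_imp_closed in auto)
  qed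
  have grad0: "gradient u x = 0" if "x \<notin> K" for x
    using der0[OF that] by (rule gradient_eq)
  have der: "(u has_derivative (\<lambda>v. gradient u x \<bullet> v)) (at x)" for x
  proof (cases "x \<in> K")
    case True
    then show ?thesis using C1 K by (intro has_derivative_gradient) auto
  next
    case False
    then show ?thesis using der0 grad0 by simp
  qed
  have "continuous_on UNIV (gradient u)"
  proof (rule continuous_on_zero_extension[OF S _ K(2)])
    show "continuous_on S (gradient u)"
      using C1 unfolding gradient_def by (auto intro!: continuous_on_vec_lambda)
  qed (use K grad0 compact_imp_closed in auto)
  with that K u0 grad0 der show thesis by blast
qed

lemma continuous_sgn_powr:
  fixes q :: real
  assumes "q > 0"
  shows "continuous_on UNIV (\<lambda>y::real. sgn y * \<bar>y\<bar> powr q)"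
proof -
  have eq: "(\<lambda>y::real. sgn y * \<bar>y\<bar> powr q) = (\<lambda>y. (max y 0) powr q - (max (- y) 0) powr q)"
    using assms by (auto simp: fun_eq_iff sgn_if max_def)
  show ?thesis unfolding eq
    using assms by (intro continuous_intros continuous_on_powr') auto
qed

lemma has_real_derivative_abs_powr:
  fixes p y :: real
  assumes "p > 1"
  shows "((\<lambda>y. \<bar>y\<bar> powr p) has_real_derivative p * (sgn y * \<bar>y\<bar> powr (p - 1))) (at y)"
proof -
  consider "y > 0" | "y < 0" | "y = 0" by linarith
  then show ?thesis
  proof cases
    case 1
    have "((\<lambda>y. y powr p) has_real_derivative p * (sgn y * \<bar>y\<bar> powr (p - 1))) (at y)"
      using 1 by (auto intro!: derivative_eq_intros)
    then show ?thesis
      by (rule has_field_derivative_transform_within_open[where S = "{0<..}"]) (use 1 in auto)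
  next
    case 2
    have "((\<lambda>y. (- y) powr p) has_real_derivative p * (sgn y * \<bar>y\<bar> powr (p - 1))) (at y)"
      using 2 by (auto intro!: derivative_eq_intros)
    then show ?thesis
      by (rule has_field_derivative_transform_within_open[where S = "{..<0}"]) (use 2 in auto)
  next
    case 3
    have "((\<lambda>h::real. \<bar>h\<bar> powr (p - 1)) \<longlongrightarrow> \<bar>0\<bar> powr (p - 1)) (at 0)"
      using assms by (intro tendsto_powr' tendsto_intros) auto
    then have "((\<lambda>h::real. \<bar>h\<bar> powr (p - 1)) \<longlongrightarrow> 0) (at 0)" by simp
    then have "((\<lambda>h::real. \<bar>h\<bar> powr p / h) \<longlongrightarrow> 0) (at 0)"
    proof (rule Lim_null_comparison[rotated])
      show "\<forall>\<^sub>F h::real in at 0. norm (\<bar>h\<bar> powr p / h) \<le> \<bar>h\<bar> powr (p - 1)"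
        by (rule eventually_mono[OF eventually_True]) (auto simp: powr_diff)
    qed
    then show ?thesis using 3 by (simp add: DERIV_def)
  qed
qed

lemma set_lebesgue_integral_compact_support:
  fixes f :: "'a::euclidean_space \<Rightarrow> real"
  assumes "compact K" "K \<subseteq> \<Omega>" "continuous_on UNIV f" "\<And>x. x \<notin> K \<Longrightarrow> f x = 0"
  shows "f integrable_on UNIV" and "(LINT x:\<Omega>|lborel. f x) = integral UNIV f"
proof -
  have restr: "(\<lambda>x. indicator A x *\<^sub>R f x) = (\<lambda>x. indicator K x *\<^sub>R f x)" if "K \<subseteq> A" for A
    using assms(4) that by (auto simp: fun_eq_iff indicator_def)
  have int: "set_integrable lborel A f" if "K \<subseteq> A" for A
    unfolding set_integrable_def restr[OF that]
    using assms(1,3) by (intro borel_integrable_compact) (auto intro: continuous_on_subset)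
  show "f integrable_on UNIV"
    using int[of UNIV] by (intro set_borel_integral_eq_integral(1)) auto
  have "(LINT x:\<Omega>|lborel. f x) = (LINT x:UNIV|lborel. f x)"
    unfolding set_lebesgue_integral_def
    by (simp only: trans[OF restr[OF assms(2)] restr[OF subset_UNIV, symmetric]])
  also have "\<dots> = integral UNIV f"
    using int[of UNIV] by (intro set_borel_integral_eq_integral(2)) auto
  finally show "(LINT x:\<Omega>|lborel. f x) = integral UNIV f" .
qed

text \<open>
  Both integrands extend continuously by zero, so the set integrals over \<open>\<Omega>\<close> become integrals over the whole space.
\<close>

lemma hardy_difference_eq_integral:
  fixes u :: "real ^ 'n::finite \<Rightarrow> real"
  assumes \<Omega>: "open \<Omega>" and u: "u \<in> Cc_infinity (\<Omega> - {0})" and p: "p > 0"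
  shows "continuous_on UNIV (\<lambda>x. norm (gradient u x) powr p)"
    and "continuous_on UNIV (\<lambda>x. (\<bar>u x\<bar> / norm x) powr p)"
    and "(\<lambda>x. norm (gradient u x) powr p) integrable_on UNIV"
    and "(\<lambda>x. (\<bar>u x\<bar> / norm x) powr p) integrable_on UNIV"
    and "hardy_difference p \<Omega> u = integral UNIV (\<lambda>x. norm (gradient u x) powr p)
      - ((p - real CARD('n)) / p) powr p * integral UNIV (\<lambda>x. (\<bar>u x\<bar> / norm x) powr p)"
proof -
  have S: "open (\<Omega> - {0})" using \<Omega> by auto
  obtain K where K: "compact K" "K \<subseteq> \<Omega> - {0}" "\<And>x. x \<notin> K \<Longrightarrow> u x = 0"
    "\<And>x. x \<notin> K \<Longrightarrow> gradient u x = 0"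
    "\<And>x. (u has_derivative (\<lambda>v. gradient u x \<bullet> v)) (at x)"
    "continuous_on UNIV (gradient u)"
    using Cc_infinity_props[OF S u] by metis
  have contu: "continuous_on A u" for A
    using K(5) by (meson has_derivative_continuous continuous_at_imp_continuous_on)
  show 1: "continuous_on UNIV (\<lambda>x. norm (gradient u x) powr p)"
    using p by (intro continuous_on_powr' continuous_intros K) auto
  show 2: "continuous_on UNIV (\<lambda>x. (\<bar>u x\<bar> / norm x) powr p)"
  proof (rule continuous_on_zero_extension[OF S _ K(2)])
    show "continuous_on (\<Omega> - {0}) (\<lambda>x. (\<bar>u x\<bar> / norm x) powr p)"
      using p by (intro continuous_on_powr' continuous_intros contu) auto
  qed (use K compact_imp_closed in auto)
  have K': "K \<subseteq> \<Omega>" using K by auto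
  note a = set_lebesgue_integral_compact_support[OF K(1) K' 1]
  note b = set_lebesgue_integral_compact_support[OF K(1) K' 2]
  show "(\<lambda>x. norm (gradient u x) powr p) integrable_on UNIV"
    by (rule a(1)) (use K in auto)
  show "(\<lambda>x. (\<bar>u x\<bar> / norm x) powr p) integrable_on UNIV"
    by (rule b(1)) (use K in auto)
  have "(LINT x:\<Omega>|lborel. norm (gradient u x) powr p) = integral UNIV (\<lambda>x. norm (gradient u x) powr p)"
    by (rule a(2)) (use K in auto)
  moreover have "(LINT x:\<Omega>|lborel. (\<bar>u x\<bar> / norm x) powr p) = integral UNIV (\<lambda>x. (\<bar>u x\<bar> / norm x) powr p)"
    by (rule b(2)) (use K in auto)
  ultimately show "hardy_difference p \<Omega> u = integral UNIV (\<lambda>x. norm (gradient u x) powr p)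
      - ((p - real CARD('n)) / p) powr p * integral UNIV (\<lambda>x. (\<bar>u x\<bar> / norm x) powr p)"
    unfolding hardy_difference_def by (simp add: powr_divide)
qed

text \<open>
  The pointwise inequality \<open>hardy_pointwise_gain\<close> with the profile \<open>H(|x|)\<close> of \<open>riccati_profile\<close> is integrated. The
  mixed term of Young's inequality is handled by the scaling identity for \<open>F = |u|\<^sup>p |x|\<^bsup>-p\<^esup> H(|x|)\<close>, whose radial
  derivative \<open>D\<close> satisfies \<open>\<integral> (D + n F) = 0\<close>. The remaining integrand \<open>Z\<close> is nonnegative everywhere and dominates the
  energy density on the annulus. For an empty cube the estimate is the Hardy inequality itself.
\<close>

lemma annulus_energy_bound:
  fixes p :: real
  assumes p: "p > real CARD('n::finite)"
  obtains c where "c > 0" and "\<And>(\<Omega> :: (real ^ 'n) set) u t a b.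
    u \<in> Cc_infinity (\<Omega> - {0}) \<Longrightarrow> open \<Omega> \<Longrightarrow> bounded \<Omega> \<Longrightarrow> 0 \<in> \<Omega> \<Longrightarrow> t > 0 \<Longrightarrow>
    (\<And>z. z \<in> cbox a b \<Longrightarrow> t / 2 \<le> norm z \<and> norm z \<le> 3 * t / 2) \<Longrightarrow>
    c * integral (cbox a b) (\<lambda>z. norm (gradient u z) powr p + (\<bar>u z\<bar> / norm z) powr p)
      \<le> (1 + ln (1 + diameter \<Omega> / t)) * hardy_difference p \<Omega> u"
proof -
  define n where "n = real CARD('n)"
  define \<alpha> where "\<alpha> = (p - n) / p"
  have n: "n \<ge> 1" by (simp add: n_def Suc_leI)
  have p1: "p > 1" using p n unfolding n_def by linarith
  have \<alpha>: "\<alpha> > 0" using p p1 by (simp add: \<alpha>_def n_def)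
  obtain \<tau> where \<tau>: "\<tau> > 0" and profile: "\<And>R t. R > 0 \<Longrightarrow> t > 0 \<Longrightarrow> \<exists>H H'. continuous_on {0<..R} H' \<and>
    (\<forall>\<rho>\<in>{0<..R}. (H has_real_derivative H' \<rho>) (at \<rho>) \<and> 0 \<le> H \<rho> \<and> H \<rho> \<le> \<alpha> powr (p - 1) \<and>
       p * \<alpha> * H \<rho> - (p - 1) * H \<rho> powr (p / (p - 1)) - \<rho> * H' \<rho>
         \<ge> \<alpha> powr p + \<tau> * (\<rho> * t / (\<rho> + t)\<^sup>2) / (1 + ln (1 + R / t)))"
    using riccati_profile[OF p1 \<alpha>] by blast
  \<comment> \<open>The number \<open>2/25\<close> is a lower bound of \<open>\<rho> t/(\<rho> + t)\<^sup>2\<close> for \<open>t/2 \<le> \<rho> \<le> 3t/2\<close>.\<close>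
  have "\<tau> * (2 / 25) > 0" using \<tau> by simp
  from hardy_pointwise_gain[OF p1 \<alpha> this] obtain c where c: "c > 0" and
    gain: "\<And>N b H S G A. N \<ge> 0 \<Longrightarrow> b \<ge> 0 \<Longrightarrow> 0 \<le> H \<Longrightarrow> H \<le> \<alpha> powr (p - 1) \<Longrightarrow> \<bar>S\<bar> \<le> N \<Longrightarrow> A \<ge> 1 \<Longrightarrow>
      G \<ge> \<alpha> powr p + (\<tau> * (2 / 25)) / A \<Longrightarrow>
      N powr p - \<alpha> powr p * b powr p
        - (p * H * b powr (p - 1) * S - (G + (p - 1) * H powr (p / (p - 1))) * b powr p)
      \<ge> c / A * (N powr p + b powr p)"
    by blast
  \<comment> \<open>Off the annulus the gain is only known to be positive; this still gives nonnegativity.\<close>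
  have gain0: "N powr p - \<alpha> powr p * b powr p
        - (p * H * b powr (p - 1) * S - (G + (p - 1) * H powr (p / (p - 1))) * b powr p) \<ge> 0"
    if a: "N \<ge> 0" "b \<ge> 0" "0 \<le> H" "H \<le> \<alpha> powr (p - 1)" "\<bar>S\<bar> \<le> N" "A \<ge> 1"
      "\<theta> > 0" "G \<ge> \<alpha> powr p + \<theta> / A" for N b H S G A \<theta>
  proof -
    obtain c' where c': "c' > 0" "N powr p - \<alpha> powr p * b powr p
        - (p * H * b powr (p - 1) * S - (G + (p - 1) * H powr (p / (p - 1))) * b powr p)
      \<ge> c' / A * (N powr p + b powr p)"
      using hardy_pointwise_gain[OF p1 \<alpha> a(7)] a by blast
    moreover have "c' / A * (N powr p + b powr p) \<ge> 0" using c' a by auto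
    ultimately show ?thesis by linarith
  qed
  have main: "c * integral (cbox a b) (\<lambda>z. norm (gradient u z) powr p + (\<bar>u z\<bar> / norm z) powr p)
      \<le> (1 + ln (1 + diameter \<Omega> / t)) * hardy_difference p \<Omega> u"
    if u: "u \<in> Cc_infinity (\<Omega> - {0})" and \<Omega>: "open \<Omega>" "bounded \<Omega>" "0 \<in> \<Omega>" and t: "t > 0"
      and Q: "\<And>z. z \<in> cbox a b \<Longrightarrow> t / 2 \<le> norm z \<and> norm z \<le> 3 * t / 2"
    for \<Omega> :: "(real ^ 'n) set" and u t a b
  proof -
    define R where "R = diameter \<Omega>"
    define A where "A = 1 + ln (1 + R / t)"
    define V where "V = (\<lambda>x. norm (gradient u x) powr p)"
    define W where "W = (\<lambda>x. (\<bar>u x\<bar> / norm x) powr p)"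
    have S: "open (\<Omega> - {0})" using \<Omega> by auto
    have normR: "norm x \<le> R" if "x \<in> \<Omega>" for x
      using diameter_bounded_bound[OF \<Omega>(2) that \<Omega>(3)] by (simp add: R_def)
    have R: "R > 0"
    proof -
      obtain e where e: "e > 0" "cball 0 e \<subseteq> \<Omega>" using \<Omega> open_contains_cball by blast
      have "e *\<^sub>R axis undefined 1 \<in> \<Omega>" using e by auto
      then have "norm (e *\<^sub>R axis undefined 1 :: real ^ 'n) \<le> R" by (rule normR)
      then show ?thesis using e by simp
    qed
    have A: "A \<ge> 1" using R t by (simp add: A_def)
    obtain H H' where contH': "continuous_on {0<..R} H'" and
      derH: "\<And>\<rho>. \<rho> \<in> {0<..R} \<Longrightarrow> (H has_real_derivative H' \<rho>) (at \<rho>)" and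
      H: "\<And>\<rho>. \<rho> \<in> {0<..R} \<Longrightarrow> 0 \<le> H \<rho> \<and> H \<rho> \<le> \<alpha> powr (p - 1)" and
      G: "\<And>\<rho>. \<rho> \<in> {0<..R} \<Longrightarrow> p * \<alpha> * H \<rho> - (p - 1) * H \<rho> powr (p / (p - 1)) - \<rho> * H' \<rho>
         \<ge> \<alpha> powr p + \<tau> * (\<rho> * t / (\<rho> + t)\<^sup>2) / A"
      using profile[OF R t] unfolding A_def by blast
    have contH: "continuous_on {0<..R} H"
      using derH by (meson DERIV_isCont continuous_at_imp_continuous_on)
    obtain K where K: "compact K" "K \<subseteq> \<Omega> - {0}" "\<And>x. x \<notin> K \<Longrightarrow> u x = 0"
      "\<And>x. x \<notin> K \<Longrightarrow> gradient u x = 0"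
      "\<And>x. (u has_derivative (\<lambda>v. gradient u x \<bullet> v)) (at x)"
      "continuous_on UNIV (gradient u)"
      using Cc_infinity_props[OF S u] by metis
    have Kcl: "closed K" using K compact_imp_closed by auto
    have contu: "continuous_on B u" for B
      using K(5) by (meson has_derivative_continuous continuous_at_imp_continuous_on)
    have contg: "continuous_on B (gradient u)" for B
      using K(6) continuous_on_subset by blast
    have norm_in: "norm x \<in> {0<..R}" if "x \<in> \<Omega> - {0}" for x using normR that by auto
    define F where "F = (\<lambda>x. \<bar>u x\<bar> powr p * (norm x powr (- p) * H (norm x)))"
    define D where "D = (\<lambda>x. p * (sgn (u x) * \<bar>u x\<bar> powr (p - 1)) * (gradient u x \<bullet> x)
        * (norm x powr (- p) * H (norm x))
        + \<bar>u x\<bar> powr p * (norm x powr (- p) * (norm x * H' (norm x) - p * H (norm x))))"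
    have p10: "p - 1 > 0" using p1 by simp
    have c1: "continuous_on (\<Omega> - {0}) (\<lambda>x. sgn (u x) * \<bar>u x\<bar> powr (p - 1))"
      by (rule continuous_on_compose2[OF continuous_sgn_powr[OF p10] contu]) auto
    have c2: "continuous_on (\<Omega> - {0}) (\<lambda>x. H (norm x))"
      by (rule continuous_on_compose2[OF contH continuous_on_norm_id]) (use normR in auto)
    have c3: "continuous_on (\<Omega> - {0}) (\<lambda>x. H' (norm x))"
      by (rule continuous_on_compose2[OF contH' continuous_on_norm_id]) (use normR in auto)
    have c4: "continuous_on (\<Omega> - {0}) (\<lambda>x. norm x powr (- p))"
      by (intro continuous_intros) auto
    have c5: "continuous_on (\<Omega> - {0}) (\<lambda>x. \<bar>u x\<bar> powr p)"
      using p1 by (intro continuous_on_powr' continuous_intros contu) auto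
    have contF: "continuous_on UNIV F"
    proof (rule continuous_on_zero_extension[OF S Kcl K(2)])
      show "continuous_on (\<Omega> - {0}) F" unfolding F_def
        by (intro continuous_on_mult c2 c4 c5)
    qed (use K p1 in \<open>auto simp: F_def\<close>)
    have contD: "continuous_on UNIV D"
    proof (rule continuous_on_zero_extension[OF S Kcl K(2)])
      show "continuous_on (\<Omega> - {0}) D" unfolding D_def
        by (intro continuous_on_add continuous_on_mult continuous_on_diff continuous_on_inner
            continuous_on_const continuous_on_id continuous_on_norm_id contg c1 c2 c3 c4 c5)
    qed (use K p1 in \<open>auto simp: D_def\<close>)
    have suppF: "F x = 0" if "norm x > R" for x
      using that K normR[of x] p1 by (cases "x \<in> K") (auto simp: F_def)
    have derF: "((\<lambda>s. F (s *\<^sub>R x)) has_real_derivative D x) (at 1)" for x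
    proof (cases "x \<in> K")
      case True
      then have x: "x \<in> \<Omega> - {0}" using K by auto
      have d1: "((\<lambda>s. u (s *\<^sub>R x)) has_real_derivative gradient u x \<bullet> x) (at 1)"
      proof -
        have "((\<lambda>s. s *\<^sub>R x) has_derivative (\<lambda>h. h *\<^sub>R x)) (at 1)"
          by (auto intro!: derivative_eq_intros)
        moreover have "(u has_derivative (\<lambda>v. gradient u x \<bullet> v)) (at (1 *\<^sub>R x))"
          using K(5) by simp
        ultimately have "((\<lambda>s. u (s *\<^sub>R x)) has_derivative (\<lambda>h. gradient u x \<bullet> (h *\<^sub>R x))) (at 1)"
          by (rule has_derivative_compose)
        moreover have "(\<lambda>h. gradient u x \<bullet> (h *\<^sub>R x)) = (*) (gradient u x \<bullet> x)"
          by (simp add: fun_eq_iff)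
        ultimately show ?thesis by (simp add: has_field_derivative_def)
      qed
      have d2: "((\<lambda>s. \<bar>u (s *\<^sub>R x)\<bar> powr p) has_real_derivative
          p * (sgn (u x) * \<bar>u x\<bar> powr (p - 1)) * (gradient u x \<bullet> x)) (at 1)"
      proof (rule DERIV_chain2[of "\<lambda>y. \<bar>y\<bar> powr p" _ "\<lambda>s. u (s *\<^sub>R x)" 1, OF _ d1])
        show "((\<lambda>y. \<bar>y\<bar> powr p) has_real_derivative p * (sgn (u x) * \<bar>u x\<bar> powr (p - 1)))
            (at (u (1 *\<^sub>R x)))"
          unfolding scaleR_one by (rule has_real_derivative_abs_powr[OF p1])
      qed
      have d3: "((\<lambda>s. H (s * norm x)) has_real_derivative H' (norm x) * norm x) (at 1)"
      proof -
        have "(H has_real_derivative H' (norm x)) (at (1 * norm x))"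
          using derH[OF norm_in[OF x]] by simp
        moreover have "((\<lambda>s. s * norm x) has_real_derivative norm x) (at 1)"
          by (auto intro!: derivative_eq_intros)
        ultimately show ?thesis by (rule DERIV_chain2[of H _ "\<lambda>s. s * norm x"])
      qed
      have d4: "((\<lambda>s. (s * norm x) powr (- p)) has_real_derivative - p * norm x powr (- p)) (at 1)"
        using x by (auto intro!: derivative_eq_intros simp: powr_diff)
      have "((\<lambda>s. \<bar>u (s *\<^sub>R x)\<bar> powr p * ((s * norm x) powr (- p) * H (s * norm x)))
          has_real_derivative D x) (at 1)"
        by (rule DERIV_cong[OF DERIV_mult[OF d2 DERIV_mult[OF d4 d3]]])
          (simp add: D_def algebra_simps)
      then show ?thesis
        by (rule has_field_derivative_transform_within_open[where S = "{0<..}"])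
          (auto simp: F_def)
    next
      case False
      then have "D x = 0" using K p1 by (simp add: D_def)
      have "isCont (\<lambda>s. s *\<^sub>R x) 1" by (intro continuous_intros)
      then have "((\<lambda>s. s *\<^sub>R x) \<longlongrightarrow> x) (nhds 1)"
        by (simp add: isCont_def tendsto_nhds_iff)
      then have "\<forall>\<^sub>F s in nhds 1. s *\<^sub>R x \<in> - K"
        by (rule topological_tendstoD) (use False Kcl in auto)
      then have "\<forall>\<^sub>F s in nhds 1. F (s *\<^sub>R x) = 0"
        by eventually_elim (use K p1 in \<open>auto simp: F_def\<close>)
      then have "((\<lambda>s. F (s *\<^sub>R x)) has_real_derivative 0) (at 1)"
        by (subst DERIV_cong_ev[OF refl _ refl, where g = "\<lambda>_. 0"]) auto
      then show ?thesis using \<open>D x = 0\<close> by simp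
    qed
    have intF: "F integrable_on UNIV"
      by (rule continuous_bounded_support_integrable[OF contF suppF])
    note scaling = integral_scaling_identity[OF contF contD suppF derF]
    note hd = hardy_difference_eq_integral[OF \<Omega>(1) u, of p, folded V_def W_def n_def, folded \<alpha>_def]
    have p0: "p > 0" using p1 by simp
    define Z where "Z = (\<lambda>x. V x - \<alpha> powr p * W x - (D x + n * F x))"
    have intZ: "Z integrable_on UNIV" "integral UNIV Z = hardy_difference p \<Omega> u"
    proof -
      have i1: "(\<lambda>x. V x - \<alpha> powr p * W x) integrable_on UNIV"
        using hd(3,4)[OF p0] by (intro integrable_diff integrable_on_mult_right)
      have i2: "(\<lambda>x. D x + n * F x) integrable_on UNIV"
        using scaling(1) intF by (intro integrable_add integrable_on_mult_right)
      show "Z integrable_on UNIV" unfolding Z_def using i1 i2 by (rule integrable_diff)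
      have "integral UNIV Z = (integral UNIV V - \<alpha> powr p * integral UNIV W)
          - (integral UNIV D + n * integral UNIV F)"
        unfolding Z_def
        using hd(3,4)[OF p0] scaling(1) intF i1 i2
        by (simp add: integral_diff integral_add integrable_on_mult_right)
      then show "integral UNIV Z = hardy_difference p \<Omega> u"
        using hd(5)[OF p0] scaling(2) by (simp add: n_def)
    qed
    have Zform: "Z x = norm (gradient u x) powr p - \<alpha> powr p * (\<bar>u x\<bar> / norm x) powr p
        - (p * H (norm x) * (\<bar>u x\<bar> / norm x) powr (p - 1) * (sgn (u x) * (gradient u x \<bullet> x) / norm x)
         - ((p * \<alpha> * H (norm x) - (p - 1) * H (norm x) powr (p / (p - 1)) - norm x * H' (norm x))
            + (p - 1) * H (norm x) powr (p / (p - 1))) * (\<bar>u x\<bar> / norm x) powr p)"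
      if "x \<in> \<Omega> - {0}" for x
    proof -
      have x: "norm x > 0" using that by simp
      have pa: "p * \<alpha> = p - n" using p0 by (simp add: \<alpha>_def)
      have e: "norm x powr (- p) = 1 / norm x powr p" by (simp add: powr_minus_divide)
      have e1: "norm x powr p = norm x powr (p - 1) * norm x"
        using x by (simp add: powr_diff)
      have e2: "p * (sgn (u x) * \<bar>u x\<bar> powr (p - 1)) * (gradient u x \<bullet> x) * (norm x powr (- p) * H (norm x))
        = p * H (norm x) * (\<bar>u x\<bar> / norm x) powr (p - 1) * (sgn (u x) * (gradient u x \<bullet> x) / norm x)"
        unfolding e e1 using x by (simp add: powr_divide)
      have e3: "\<bar>u x\<bar> powr p * (norm x powr (- p) * y) = y * (\<bar>u x\<bar> / norm x) powr p" for y
        unfolding e using x by (simp add: powr_divide)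
      show ?thesis
        unfolding Z_def V_def W_def D_def F_def e2 e3 pa by (simp add: algebra_simps)
    qed
    have Sb: "\<bar>sgn (u x) * (gradient u x \<bullet> x) / norm x\<bar> \<le> norm (gradient u x)" if "x \<noteq> 0" for x
    proof -
      have "\<bar>sgn (u x) * (gradient u x \<bullet> x)\<bar> \<le> 1 * (norm (gradient u x) * norm x)"
        unfolding abs_mult using Cauchy_Schwarz_ineq2[of "gradient u x" x]
        by (intro mult_mono) (auto simp: abs_sgn_eq)
      then show ?thesis using that by (simp add: divide_le_eq)
    qed
    have Zpos: "Z x \<ge> 0" for x
    proof (cases "x \<in> \<Omega> - {0}")
      case True
      then have x: "norm x > 0" by simp
      have "\<tau> * (norm x * t / (norm x + t)\<^sup>2) > 0"
        using x t \<tau> by (intro mult_pos_pos divide_pos_pos zero_less_power add_pos_pos) auto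
      then show ?thesis unfolding Zform[OF True]
        by (intro gain0[where A = A and \<theta> = "\<tau> * (norm x * t / (norm x + t)\<^sup>2)"])
          (use H G norm_in[OF True] Sb A x in auto)
    next
      case False
      then have "x \<notin> K" using K by auto
      then show ?thesis using K p0 by (simp add: Z_def V_def W_def D_def F_def)
    qed
    have Zgain: "c / A * (V x + W x) \<le> Z x" if "x \<in> cbox a b" for x
    proof (cases "x \<in> \<Omega> - {0}")
      case True
      then have x: "norm x > 0" by simp
      have nx: "t \<le> 2 * norm x" "2 * norm x \<le> 3 * t" using Q[OF that] by auto
      have "(norm x + t)\<^sup>2 \<le> (5 * t / 2)\<^sup>2"
        using nx t by (intro power_mono) auto
      then have "2 / 25 * (norm x + t)\<^sup>2 \<le> t * t / 2" by (simp add: power2_eq_square)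
      also have "\<dots> \<le> norm x * t" using nx t by simp
      finally have "2 / 25 \<le> norm x * t / (norm x + t)\<^sup>2"
        using x t zero_less_power[OF add_pos_pos[OF x t], of 2]
        by (simp only: pos_le_divide_eq)
      then have "\<tau> * (2 / 25) / A \<le> \<tau> * (norm x * t / (norm x + t)\<^sup>2) / A"
        using \<tau> A by (intro divide_right_mono mult_left_mono) auto
      then show ?thesis unfolding Zform[OF True] V_def W_def
        by (intro gain) (use H G[of "norm x"] norm_in[OF True] Sb A x in auto)
    next
      case False
      then have "x \<notin> K" using K by auto
      then show ?thesis using K p0 by (simp add: Z_def V_def W_def D_def F_def)
    qed
    have intVW: "(\<lambda>x. c / A * (V x + W x)) integrable_on cbox a b"
      using hd(1,2)[OF p0]
      by (intro integrable_continuous continuous_intros) (auto intro: continuous_on_subset)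
    have "integral (cbox a b) (\<lambda>x. c / A * (V x + W x)) \<le> integral (cbox a b) Z"
      using intVW intZ(1) Zgain
      by (intro integral_le) (auto intro: integrable_on_subcbox)
    also have "\<dots> \<le> integral UNIV Z"
      using intZ(1) Zpos by (intro integral_subset_le) (auto intro: integrable_on_subcbox)
    finally have "c / A * integral (cbox a b) (\<lambda>x. V x + W x) \<le> hardy_difference p \<Omega> u"
      by (simp add: intZ(2))
    then show ?thesis
      using A unfolding V_def W_def R_def[symmetric] A_def[symmetric]
      by (simp add: field_simps)
  qed
  show thesis by (rule that[OF c main])
qed

section \<open>Morrey inequality on cubes\<close>

text \<open>
  Jensen's inequality, obtained by integrating the tangent inequality at the mean value \<open>m\<close> of \<open>\<phi>\<close>.
\<close>

lemma integral_le_power_mean: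
  fixes \<phi> :: "'a::euclidean_space \<Rightarrow> real"
  assumes p: "p > 1" and cont: "continuous_on (cbox a b) \<phi>"
    and nn: "\<And>y. y \<in> cbox a b \<Longrightarrow> 0 \<le> \<phi> y" and v: "measure lborel (cbox a b) > 0"
  shows "integral (cbox a b) \<phi>
    \<le> measure lborel (cbox a b) * (integral (cbox a b) (\<lambda>y. \<phi> y powr p) / measure lborel (cbox a b)) powr (1 / p)"
proof -
  define v where "v = measure lborel (cbox a b)"
  define m where "m = integral (cbox a b) \<phi> / v"
  define J where "J = integral (cbox a b) (\<lambda>y. \<phi> y powr p)"
  have v0: "v > 0" using v by (simp add: v_def)
  have i1: "\<phi> integrable_on cbox a b" using cont by (rule integrable_continuous)
  have i2: "(\<lambda>y. \<phi> y powr p) integrable_on cbox a b"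
    using p nn by (intro integrable_continuous continuous_on_powr' cont continuous_intros) auto
  have m0: "m \<ge> 0" using v0 nn by (auto simp: m_def intro!: divide_nonneg_pos integral_nonneg i1)
  have mm: "m powr (p - 1) * m = m powr p"
    using m0 by (cases "m = 0") (auto simp: powr_diff)
  have "p * (m powr p * v) = p * m powr (p - 1) * integral (cbox a b) \<phi>"
    using v0 by (simp add: m_def[symmetric] mm[symmetric]) (simp add: m_def)
  also have "\<dots> = integral (cbox a b) (\<lambda>y. p * m powr (p - 1) * \<phi> y)"
    by (rule integral_mult_right[symmetric])
  also have "\<dots> \<le> integral (cbox a b) (\<lambda>y. \<phi> y powr p + (p - 1) * m powr p)"
  proof (rule integral_le)
    show "p * m powr (p - 1) * \<phi> y \<le> \<phi> y powr p + (p - 1) * m powr p" if "y \<in> cbox a b" for y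
      using young_tangent[OF p nn[OF that] m0] by (simp add: mult_ac)
  qed (intro integrable_on_mult_right integrable_add i1 i2 integrable_const)+
  also have "\<dots> = J + v * ((p - 1) * m powr p)"
    by (subst integral_add[OF i2 integrable_const]) (simp add: J_def v_def)
  finally have "m powr p * v \<le> J" by (simp add: algebra_simps)
  then have le: "m powr p \<le> J / v" using v0 by (simp add: field_simps)
  have "m = (m powr p) powr (1 / p)" using m0 p by (simp add: powr_powr)
  also have "\<dots> \<le> (J / v) powr (1 / p)" using le p by (intro powr_mono2) auto
  finally have "v * m \<le> v * (J / v) powr (1 / p)" using v0 by (intro mult_left_mono) auto
  then show ?thesis using v0 by (simp add: m_def J_def v_def)
qed

text \<open>
  The integrals \<open>M(s)\<close> of \<open>u\<close> over the box contracted towards \<open>x\<close> by the factor \<open>s\<close> (after rescaling) interpolate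
  between \<open>vol \<cdot> u(x)\<close> at \<open>s = 0\<close> and \<open>\<integral> u\<close> at \<open>s = 1\<close>. By Jensen's inequality and a change of variables
  \<open>|M'(s)| \<le> K s\<^bsup>-n/p\<^esup>\<close>, because the contracted box stays inside the box; this is integrable on \<open>(0,1)\<close> for \<open>p > n\<close>.
\<close>

lemma morrey_cbox:
  fixes u :: "'a::euclidean_space \<Rightarrow> real" and g :: "'a \<Rightarrow> 'a"
  assumes p: "p > real DIM('a)"
    and der: "\<And>x. (u has_derivative (\<lambda>v. g x \<bullet> v)) (at x)" and contg: "continuous_on UNIV g"
    and x: "x \<in> cbox a b" and d: "\<And>y. y \<in> cbox a b \<Longrightarrow> norm (y - x) \<le> d"
    and v: "measure lborel (cbox a b) > 0"
  shows "\<bar>u x - integral (cbox a b) u / measure lborel (cbox a b)\<bar>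
    \<le> d / (1 - real DIM('a) / p) *
      (integral (cbox a b) (\<lambda>z. norm (g z) powr p) / measure lborel (cbox a b)) powr (1 / p)"
proof -
  let ?Q = "cbox a b"
  define n where "n = real DIM('a)"
  define vol where "vol = measure lborel ?Q"
  define I where "I = integral ?Q (\<lambda>z. norm (g z) powr p)"
  define \<beta> where "\<beta> = 1 - n / p"
  define K where "K = d * vol * (I / vol) powr (1 / p)"
  define M where "M = (\<lambda>s. integral ?Q (\<lambda>y. u (x + s *\<^sub>R (y - x))))"
  define M' where "M' = (\<lambda>s. integral ?Q (\<lambda>y. g (x + s *\<^sub>R (y - x)) \<bullet> (y - x)))"
  have n1: "n \<ge> 1" using DIM_positive[where 'a = 'a] by (simp add: n_def Suc_le_eq del: DIM_positive)
  have p1: "p > 1" using p n1 unfolding n_def by linarith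
  have \<beta>: "\<beta> > 0" using p p1 by (simp add: \<beta>_def n_def)
  have v0: "vol > 0" using v by (simp add: vol_def)
  have d0: "d \<ge> 0" using d[OF x] by simp
  have contu: "continuous_on B u" for B
    using der by (meson has_derivative_continuous continuous_at_imp_continuous_on)
  have contng: "continuous_on UNIV (\<lambda>z. norm (g z) powr p)"
    using p1 by (intro continuous_on_powr' continuous_intros contg) auto
  have derM: "(M has_vector_derivative M' s) (at s within {0..1})" if "s \<in> {0..1}" for s
    unfolding M_def M'_def
  proof (rule leibniz_rule_vector_derivative[where U = "{0..1}" and
        fx = "\<lambda>s y. g (x + s *\<^sub>R (y - x)) \<bullet> (y - x)"])
    show "((\<lambda>s. u (x + s *\<^sub>R (y - x))) has_vector_derivative g (x + s *\<^sub>R (y - x)) \<bullet> (y - x))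
        (at s within {0..1})" for s y
    proof -
      have "((\<lambda>s. x + s *\<^sub>R (y - x)) has_derivative (\<lambda>h. h *\<^sub>R (y - x))) (at s within {0..1})"
        by (auto intro!: derivative_eq_intros)
      then have "((\<lambda>s. u (x + s *\<^sub>R (y - x))) has_derivative
          (\<lambda>h. g (x + s *\<^sub>R (y - x)) \<bullet> (h *\<^sub>R (y - x)))) (at s within {0..1})"
        by (rule has_derivative_compose[OF _ der])
      then show ?thesis by (simp add: has_vector_derivative_def)
    qed
    show "(\<lambda>y. u (x + s *\<^sub>R (y - x))) integrable_on ?Q" for s
      by (intro integrable_continuous continuous_on_compose2[OF contu[of UNIV]] continuous_intros) auto
    show "continuous_on ({0..1} \<times> ?Q) (\<lambda>(s, y). g (x + s *\<^sub>R (y - x)) \<bullet> (y - x))"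
      unfolding split_beta
      by (intro continuous_intros continuous_on_compose2[OF contg]) auto
  qed (use that in auto)
  have bound: "\<bar>M' s\<bar> \<le> K * s powr (\<beta> - 1)" if s: "0 < s" "s < 1" for s
  proof -
    let ?P = "cbox (x + s *\<^sub>R (a - x)) (x + s *\<^sub>R (b - x))"
    have contgs: "continuous_on ?Q (\<lambda>y. g (x + s *\<^sub>R (y - x)))"
      by (intro continuous_on_compose2[OF contg] continuous_intros) auto
    have PQ: "?P \<subseteq> ?Q"
    proof
      fix z assume z: "z \<in> ?P"
      have "a \<bullet> i \<le> z \<bullet> i \<and> z \<bullet> i \<le> b \<bullet> i" if i: "i \<in> Basis" for i
      proof -
        have xi: "a \<bullet> i \<le> x \<bullet> i" "x \<bullet> i \<le> b \<bullet> i" using x i by (auto simp: mem_box)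
        have zi: "x \<bullet> i + s * (a \<bullet> i - x \<bullet> i) \<le> z \<bullet> i" "z \<bullet> i \<le> x \<bullet> i + s * (b \<bullet> i - x \<bullet> i)"
          using z i by (auto simp: mem_box inner_add_left inner_diff_left)
        have "s * (x \<bullet> i - a \<bullet> i) \<le> 1 * (x \<bullet> i - a \<bullet> i)" "s * (b \<bullet> i - x \<bullet> i) \<le> 1 * (b \<bullet> i - x \<bullet> i)"
          using s xi by (intro mult_right_mono; simp)+
        with zi show ?thesis by (simp add: algebra_simps)
      qed
      then show "z \<in> ?Q" by (simp add: mem_box)
    qed
    have scal: "integral ?Q (\<lambda>y. norm (g (x + s *\<^sub>R (y - x))) powr p) \<le> I / s powr n"
    proof -
      have iP: "(\<lambda>z. norm (g z) powr p) integrable_on ?P"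
        using contng by (intro integrable_continuous) (auto intro: continuous_on_subset)
      have e1: "(x + s *\<^sub>R (a - x) - (x - s *\<^sub>R x)) /\<^sub>R s = a" "(x + s *\<^sub>R (b - x) - (x - s *\<^sub>R x)) /\<^sub>R s = b"
        using s by (simp_all add: algebra_simps)
      have e2: "s *\<^sub>R y + (x - s *\<^sub>R x) = x + s *\<^sub>R (y - x)" for y by (simp add: algebra_simps)
      have "integral ?Q (\<lambda>y. norm (g (x + s *\<^sub>R (y - x))) powr p)
          = integral ?P (\<lambda>z. norm (g z) powr p) /\<^sub>R s ^ DIM('a)"
        using has_integral_affinity'[OF integrable_integral[OF iP] s(1), of "x - s *\<^sub>R x", unfolded e1 e2]
        by (rule integral_unique)
      also have "\<dots> \<le> I /\<^sub>R s ^ DIM('a)"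
        unfolding I_def using PQ iP contng s
        by (intro scaleR_left_mono integral_subset_le)
          (auto intro!: integrable_continuous intro: continuous_on_subset)
      finally show ?thesis using s by (simp add: n_def powr_realpow divide_inverse mult.commute)
    qed
    have "\<bar>M' s\<bar> \<le> integral ?Q (\<lambda>y. d * norm (g (x + s *\<^sub>R (y - x))))"
      unfolding M'_def real_norm_def[symmetric]
    proof (rule integral_norm_bound_integral)
      show "norm (g (x + s *\<^sub>R (y - x)) \<bullet> (y - x)) \<le> d * norm (g (x + s *\<^sub>R (y - x)))"
        if "y \<in> ?Q" for y
      proof -
        have "norm (g (x + s *\<^sub>R (y - x)) \<bullet> (y - x)) \<le> norm (g (x + s *\<^sub>R (y - x))) * norm (y - x)"
          by (simp add: Cauchy_Schwarz_ineq2)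
        also have "\<dots> \<le> norm (g (x + s *\<^sub>R (y - x))) * d"
          using d[OF that] by (intro mult_left_mono) auto
        finally show ?thesis by (simp add: mult.commute)
      qed
    qed (intro integrable_continuous continuous_intros contgs)+
    also have "\<dots> = d * integral ?Q (\<lambda>y. norm (g (x + s *\<^sub>R (y - x))))" by simp
    also have "\<dots> \<le> d * (vol * (integral ?Q (\<lambda>y. norm (g (x + s *\<^sub>R (y - x))) powr p) / vol) powr (1 / p))"
      unfolding vol_def using d0 v p1 contgs
      by (intro mult_left_mono integral_le_power_mean continuous_intros) auto
    also have "\<dots> \<le> d * (vol * (I / s powr n / vol) powr (1 / p))"
      using d0 v0 p1 scal
      by (intro mult_left_mono powr_mono2 divide_right_mono)
        (auto intro!: divide_nonneg_pos integral_nonneg integrable_continuous continuous_intros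
          continuous_on_powr' contgs)
    also have "(I / s powr n / vol) powr (1 / p) = (I / vol) powr (1 / p) * s powr (\<beta> - 1)"
    proof -
      have "I \<ge> 0" unfolding I_def
        by (intro integral_nonneg integrable_continuous continuous_on_subset[OF contng]) auto
      moreover have "I / s powr n / vol = (I / vol) * s powr (- n)"
        by (simp add: powr_minus_divide)
      moreover have "(s powr (- n)) powr (1 / p) = s powr (\<beta> - 1)" by (simp add: powr_powr \<beta>_def)
      ultimately show ?thesis using powr_mult[of "I / vol" "s powr (- n)" "1 / p"] by presburger
    qed
    finally show ?thesis by (simp add: K_def mult_ac)
  qed
  have "norm (M 1 - M 0) \<le> K / \<beta> * 1 powr \<beta> - K / \<beta> * 0 powr \<beta>"
  proof (rule differentiable_bound_general[where f' = M' and \<phi>' = "\<lambda>s. K * s powr (\<beta> - 1)"])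
    show "continuous_on {0..1} M"
      using derM by (meson continuous_on_eq_continuous_within has_vector_derivative_continuous)
    show "continuous_on {0..1} (\<lambda>s. K / \<beta> * s powr \<beta>)"
      using \<beta> by (intro continuous_intros continuous_on_powr') auto
    fix s :: real assume s: "0 < s" "s < 1"
    then have "at s within {0..1} = at s" by (intro at_within_interior) auto
    then show "(M has_vector_derivative M' s) (at s)" using derM[of s] s by auto
    have "((\<lambda>s. K / \<beta> * s powr \<beta>) has_real_derivative K / \<beta> * (\<beta> * s powr (\<beta> - 1))) (at s)"
      using s by (intro DERIV_cmult has_real_derivative_powr)
    then show "((\<lambda>s. K / \<beta> * s powr \<beta>) has_vector_derivative K * s powr (\<beta> - 1)) (at s)"
      using \<beta> by (simp add: has_real_derivative_iff_has_vector_derivative)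
    show "norm (M' s) \<le> K * s powr (\<beta> - 1)" using bound[OF s] by simp
  qed simp
  then have "\<bar>M 1 - M 0\<bar> \<le> K / \<beta>" by simp
  moreover have "M 1 = integral ?Q u" by (simp add: M_def)
  moreover have "M 0 = vol * u x" by (simp add: M_def vol_def)
  ultimately have "\<bar>vol * u x - integral ?Q u\<bar> \<le> K / \<beta>"
    by (simp add: abs_minus_commute)
  then have "\<bar>vol * u x - integral ?Q u\<bar> / vol \<le> K / \<beta> / vol"
    by (rule divide_right_mono) (use v0 in simp)
  moreover have "u x - integral ?Q u / vol = (vol * u x - integral ?Q u) / vol"
    using v0 by (simp add: field_simps)
  ultimately have "\<bar>u x - integral ?Q u / vol\<bar> \<le> K / \<beta> / vol"
    using v0 by (simp only: abs_divide abs_of_pos)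
  also have "\<dots> = d / \<beta> * (I / vol) powr (1 / p)" using v0 by (simp add: K_def)
  finally show ?thesis by (simp add: \<beta>_def n_def vol_def I_def)
qed

lemma cube_properties:
  fixes x :: "real ^ 'n::finite"
  assumes r: "r > 0"
  shows "measure lborel (cbox (x - r *\<^sub>R One) (x + r *\<^sub>R One)) = (2 * r) powr real CARD('n)"
    and "y \<in> cbox (x - r *\<^sub>R One) (x + r *\<^sub>R One) \<Longrightarrow> norm (y - x) \<le> real CARD('n) * r"
    and "norm (y - x) \<le> r \<Longrightarrow> y \<in> cbox (x - r *\<^sub>R One) (x + r *\<^sub>R One)"
proof -
  have "measure lborel (cbox (x - r *\<^sub>R One) (x + r *\<^sub>R One)) = (\<Prod>i\<in>(Basis :: (real^'n) set). 2 * r)"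
    by (subst content_cbox) (use r in \<open>auto simp: inner_add_left inner_diff_left intro!: prod.cong\<close>)
  then show "measure lborel (cbox (x - r *\<^sub>R One) (x + r *\<^sub>R One)) = (2 * r) powr real CARD('n)"
    using r by (simp add: powr_realpow)
  show "norm (y - x) \<le> real CARD('n) * r" if "y \<in> cbox (x - r *\<^sub>R One) (x + r *\<^sub>R One)"
  proof -
    have "norm (y - x) \<le> (\<Sum>b\<in>Basis. \<bar>(y - x) \<bullet> b\<bar>)" by (rule norm_le_l1)
    also have "\<dots> \<le> (\<Sum>b\<in>(Basis :: (real^'n) set). r)"
      using that by (intro sum_mono) (auto simp: mem_box inner_add_left inner_diff_left abs_le_iff algebra_simps)
    finally show ?thesis by simp
  qed
  show "y \<in> cbox (x - r *\<^sub>R One) (x + r *\<^sub>R One)" if "norm (y - x) \<le> r"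
  proof -
    have "\<bar>(y - x) \<bullet> b\<bar> \<le> r" if "b \<in> Basis" for b
      using Basis_le_norm[OF that, of "y - x"] \<open>norm (y - x) \<le> r\<close> by linarith
    then have "\<bar>y \<bullet> b - x \<bullet> b\<bar> \<le> r" if "b \<in> Basis" for b
      using that by (simp add: inner_diff_left)
    then show ?thesis
      by (force simp: mem_box inner_add_left inner_diff_left abs_le_iff)
  qed
qed

text \<open>
  The function \<open>t \<mapsto> t\<^sup>q (1 + ln (1 + R/t))\<close> is increasing up to a constant factor: the logarithm of \<open>1 + R/t\<close> exceeds
  that of \<open>1 + R/r\<close> by at most \<open>ln (1 + r/t)\<close>, and this is absorbed by the power \<open>t\<^sup>q\<close>.
\<close>

lemma log_factor_bound:
  fixes q :: real
  assumes q: "q > 0" and k: "k > 0" and t: "t > 0" and r: "r > 0" and tr: "t \<le> k * r" and R: "R \<ge> r"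
  shows "t powr q * (1 + ln (1 + R / t))
    \<le> (k powr q + (1 + k) powr q / q) * (r powr q * (1 + ln (2 * R / r)))"
proof -
  define T where "T = 1 + ln (2 * R / r)"
  have T: "T \<ge> 1" using r R by (simp add: T_def le_divide_eq)
  have le1: "1 + ln (1 + R / r) \<le> T"
  proof -
    have "1 + R / r \<le> 2 * R / r" using r R by (simp add: field_simps)
    moreover have "0 < 1 + R / r" using r R by (intro add_pos_nonneg) auto
    ultimately show ?thesis by (simp add: T_def)
  qed
  have "ln (1 + R / t) \<le> ln ((1 + R / r) * (1 + r / t))"
  proof (rule ln_mono)
    show "0 < 1 + R / t" using t r R by (intro add_pos_nonneg) auto
    have "(1 + R / r) * (1 + r / t) = 1 + R / t + (r / t + R / r)"
      using t r by (simp add: field_simps)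
    moreover have "r / t + R / r \<ge> 0" using t r R by simp
    ultimately show "1 + R / t \<le> (1 + R / r) * (1 + r / t)" by linarith
  qed
  also have "\<dots> = ln (1 + R / r) + ln (1 + r / t)"
    using t r R by (intro ln_mult_pos add_pos_nonneg) auto
  finally have "t powr q * (1 + ln (1 + R / t)) \<le> t powr q * (T + ln (1 + r / t))"
    using le1 by (intro mult_left_mono) auto
  also have "\<dots> = t powr q * T + t powr q * ln (1 + r / t)" by (simp add: algebra_simps)
  also have "t powr q * T \<le> (k * r) powr q * T"
    using T t tr q by (intro mult_right_mono powr_mono2) auto
  also have "t powr q * ln (1 + r / t) \<le> ((1 + k) powr q / q) * r powr q * T"
  proof -
    have "t powr q * ln (1 + r / t) \<le> t powr q * ((1 + r / t) powr q / q)"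
      using t r q by (intro mult_left_mono ln_powr_bound) auto
    also have "\<dots> = (t + r) powr q / q"
    proof -
      have "t * (1 + r / t) = t + r" using t by (simp add: field_simps)
      then have "t powr q * (1 + r / t) powr q = (t + r) powr q"
        using t r by (simp add: powr_mult[symmetric])
      then show ?thesis by simp
    qed
    also have "\<dots> \<le> ((1 + k) * r) powr q / q"
      using t r tr q by (intro divide_right_mono powr_mono2) (auto simp: algebra_simps)
    also have "\<dots> = ((1 + k) powr q / q) * r powr q * 1"
      using k r by (simp add: powr_mult)
    also have "\<dots> \<le> ((1 + k) powr q / q) * r powr q * T"
      using T q by (intro mult_left_mono) auto
    finally show ?thesis .
  qed
  finally have "t powr q * (1 + ln (1 + R / t)) \<le> (k * r) powr q * T + (1 + k) powr q / q * r powr q * T"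
    by simp
  also have "\<dots> = (k powr q + (1 + k) powr q / q) * (r powr q * T)"
    using k r by (simp only: powr_mult distrib_right mult.assoc)
  finally show ?thesis by (simp only: T_def)
qed

section \<open>The Hardy-Morrey inequality\<close>

text \<open>
  Morrey's inequality on the cube with centre \<open>x\<close> and half side \<open>r\<close>, combined with the energy estimate at scale
  \<open>|x|\<close>. The size bound uses the largest admissible cube and estimates the mean value of \<open>u\<close> by the mean of
  \<open>|u|\<^sup>p/|x|\<^sup>p\<close>. Points of the cube have distance at most \<open>n r\<close> from \<open>x\<close>, whence the restriction
  \<open>r \<le> |x|/(2n)\<close>, which keeps the cube in the annulus.
\<close>

lemma local_holder_and_size_bound:
  fixes p :: real
  assumes p: "p > real CARD('n::finite)"
  defines "n \<equiv> real CARD('n)"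
  obtains C where "C > 0"
    and "\<And>(\<Omega> :: (real ^ 'n) set) u. u \<in> Cc_infinity (\<Omega> - {0}) \<Longrightarrow>
      open \<Omega> \<Longrightarrow> bounded \<Omega> \<Longrightarrow> 0 \<in> \<Omega> \<Longrightarrow> 0 \<le> hardy_difference p \<Omega> u"
    and "\<And>(\<Omega> :: (real ^ 'n) set) u x r y. u \<in> Cc_infinity (\<Omega> - {0}) \<Longrightarrow>
      open \<Omega> \<Longrightarrow> bounded \<Omega> \<Longrightarrow> 0 \<in> \<Omega> \<Longrightarrow> x \<noteq> 0 \<Longrightarrow>
      0 < r \<Longrightarrow> r \<le> norm x / (2 * n) \<Longrightarrow> norm (y - x) \<le> r \<Longrightarrow>
      \<bar>u x - u y\<bar> \<le> C * r powr (1 - n / p)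
        * ((1 + ln (1 + diameter \<Omega> / norm x)) * hardy_difference p \<Omega> u) powr (1 / p)"
    and "\<And>(\<Omega> :: (real ^ 'n) set) u x. u \<in> Cc_infinity (\<Omega> - {0}) \<Longrightarrow>
      open \<Omega> \<Longrightarrow> bounded \<Omega> \<Longrightarrow> 0 \<in> \<Omega> \<Longrightarrow> x \<noteq> 0 \<Longrightarrow>
      \<bar>u x\<bar> \<le> C * norm x powr (1 - n / p)
        * ((1 + ln (1 + diameter \<Omega> / norm x)) * hardy_difference p \<Omega> u) powr (1 / p)"
proof -
  define \<beta> where "\<beta> = 1 - n / p"
  have n1: "n \<ge> 1" by (simp add: n_def Suc_leI)
  have p1: "p > 1" using p n1 unfolding n_def by linarith
  have pn: "p > n" using p by (simp add: n_def)
  have \<beta>: "\<beta> > 0" using pn p1 by (simp add: \<beta>_def)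
  obtain c where c: "c > 0" and energy: "\<And>(\<Omega> :: (real ^ 'n) set) u t a b.
    u \<in> Cc_infinity (\<Omega> - {0}) \<Longrightarrow> open \<Omega> \<Longrightarrow> bounded \<Omega> \<Longrightarrow> 0 \<in> \<Omega> \<Longrightarrow> t > 0 \<Longrightarrow>
    (\<And>z. z \<in> cbox a b \<Longrightarrow> t / 2 \<le> norm z \<and> norm z \<le> 3 * t / 2) \<Longrightarrow>
    c * integral (cbox a b) (\<lambda>z. norm (gradient u z) powr p + (\<bar>u z\<bar> / norm z) powr p)
      \<le> (1 + ln (1 + diameter \<Omega> / t)) * hardy_difference p \<Omega> u"
    by (fact annulus_energy_bound[OF p])
  define k where "k = c powr (- (1 / p))"
  have k: "k > 0" using c by (simp add: k_def)
  define C where "C = k * (4 * n / \<beta> + 3 / 2 * n)"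
  have C: "C > 0" using k n1 \<beta> by (auto simp: C_def intro!: mult_pos_pos add_pos_pos)
  have main: "0 \<le> hardy_difference p \<Omega> u \<and>
    (\<forall>r y. 0 < r \<longrightarrow> r \<le> norm x / (2 * n) \<longrightarrow> norm (y - x) \<le> r \<longrightarrow>
      \<bar>u x - u y\<bar> \<le> C * r powr \<beta>
        * ((1 + ln (1 + diameter \<Omega> / norm x)) * hardy_difference p \<Omega> u) powr (1 / p)) \<and>
    \<bar>u x\<bar> \<le> C * norm x powr \<beta>
        * ((1 + ln (1 + diameter \<Omega> / norm x)) * hardy_difference p \<Omega> u) powr (1 / p)"
    if u: "u \<in> Cc_infinity (\<Omega> - {0})" and \<Omega>: "open \<Omega>" "bounded \<Omega>" "0 \<in> \<Omega>" and x0: "x \<noteq> 0"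
    for \<Omega> :: "(real ^ 'n) set" and u x
  proof (intro conjI allI impI)
    define t where "t = norm x"
    define E where "E = (1 + ln (1 + diameter \<Omega> / t)) * hardy_difference p \<Omega> u"
    have t: "t > 0" using x0 by (simp add: t_def)
    have D0: "diameter \<Omega> \<ge> 0" using diameter_ge_0[OF \<Omega>(2)] .
    have A1: "1 + ln (1 + diameter \<Omega> / t) \<ge> 1" using D0 t by simp
    have empty: "cbox (1 :: real ^ 'n) 0 = {}"
      by (force simp: set_eq_iff mem_box_cart dest: spec[of _ undefined])
    have "c * integral (cbox 1 0) (\<lambda>z. norm (gradient u z) powr p + (\<bar>u z\<bar> / norm z) powr p)
        \<le> (1 + ln (1 + diameter \<Omega> / t)) * hardy_difference p \<Omega> u"
      by (rule energy[OF u \<Omega> t]) (simp add: empty)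
    then have E0: "0 \<le> E" by (simp add: E_def empty)
    then show hd0: "0 \<le> hardy_difference p \<Omega> u"
      using A1 by (auto simp: E_def zero_le_mult_iff)
    have "open (\<Omega> - {0})" using \<Omega> by auto
    then obtain K where K: "\<And>x. (u has_derivative (\<lambda>v. gradient u x \<bullet> v)) (at x)"
      "continuous_on UNIV (gradient u)"
      using Cc_infinity_props[OF _ u] by metis
    have contu: "continuous_on B u" for B
      using K(1) by (meson has_derivative_continuous continuous_at_imp_continuous_on)
    have p0: "p > 0" using p1 by simp
    note hd = hardy_difference_eq_integral[OF \<Omega>(1) u p0]
    have core: "norm (y - x) \<le> r \<Longrightarrow> \<bar>u x - u y\<bar> \<le> C * r powr \<beta> * E powr (1 / p)"
      "\<bar>u x\<bar> \<le> 2 * n / \<beta> * k * r powr \<beta> * E powr (1 / p)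
        + 3 * t / 2 * k * (2 * r) powr (- (n / p)) * E powr (1 / p)"
      if r: "0 < r" "r \<le> t / (2 * n)" for r y
    proof -
      let ?Q = "cbox (x - r *\<^sub>R One) (x + r *\<^sub>R One)"
      let ?v = "measure lborel ?Q"
      note cube = cube_properties[OF r(1), where x = x, folded n_def]
      have v0: "?v > 0" using r unfolding cube(1) by simp
      have nr: "n * r \<le> t / 2" using r n1 by (simp add: field_simps)
      have ann: "t / 2 \<le> norm z \<and> norm z \<le> 3 * t / 2" if "z \<in> ?Q" for z
      proof -
        have "norm (z - x) \<le> t / 2" using cube(2)[OF that] nr by linarith
        moreover have "norm z \<le> norm x + norm (z - x)" by norm
        moreover have "norm x \<le> norm z + norm (z - x)" by norm
        ultimately show ?thesis by (simp add: t_def)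
      qed
      have intV: "(\<lambda>z. norm (gradient u z) powr p) integrable_on ?Q"
        and intW: "(\<lambda>z. (\<bar>u z\<bar> / norm z) powr p) integrable_on ?Q"
        using hd(3,4) by (auto intro: integrable_on_subcbox)
      define IV where "IV = integral ?Q (\<lambda>z. norm (gradient u z) powr p)"
      define IW where "IW = integral ?Q (\<lambda>z. (\<bar>u z\<bar> / norm z) powr p)"
      have IV0: "IV \<ge> 0" and IW0: "IW \<ge> 0"
        unfolding IV_def IW_def using intV intW by (auto intro!: integral_nonneg)
      have "c * (IV + IW) \<le> E"
        unfolding E_def IV_def IW_def integral_add[OF intV intW, symmetric]
        by (rule energy[OF u \<Omega> t ann])
      moreover have "c * IV \<ge> 0" "c * IW \<ge> 0" using c IV0 IW0 by simp_all
      ultimately have "c * IV \<le> E" "c * IW \<le> E" by (simp_all add: distrib_left)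
      then have IVE: "IV \<le> E / c" and IWE: "IW \<le> E / c" using c by (simp_all add: field_simps)
      have avg: "(J / ?v) powr (1 / p) \<le> k * (2 * r) powr (- (n / p)) * E powr (1 / p)"
        if "0 \<le> J" "J \<le> E / c" for J
      proof -
        have "(J / ?v) powr (1 / p) \<le> (E / c / ?v) powr (1 / p)"
          using that v0 p1 by (intro powr_mono2 divide_right_mono) auto
        also have "\<dots> = E powr (1 / p) * c powr (- (1 / p)) * (2 * r) powr (- (n / p))"
          unfolding cube(1) using c r
          by (simp add: powr_divide powr_mult powr_powr powr_minus_divide)
        finally show ?thesis by (simp add: k_def mult_ac)
      qed
      define avgu where "avgu = integral ?Q u / ?v"
      have dev: "\<bar>u z - avgu\<bar> \<le> 2 * n / \<beta> * k * r powr \<beta> * E powr (1 / p)" if z: "z \<in> ?Q" for z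
      proof -
        have "norm (y - z) \<le> 2 * (n * r)" if "y \<in> ?Q" for y
        proof -
          have "norm (y - z) \<le> norm (y - x) + norm (z - x)" by norm
          then show ?thesis using cube(2)[OF that] cube(2)[OF z] by linarith
        qed
        then have "\<bar>u z - avgu\<bar> \<le> 2 * (n * r) / \<beta> * (IV / ?v) powr (1 / p)"
          unfolding avgu_def IV_def \<beta>_def n_def
          using morrey_cbox[where p = p and u = u and g = "gradient u", OF _ K z, of "2 * (n * r)"] v0 p
          by (simp add: n_def)
        also have "\<dots> \<le> 2 * (n * r) / \<beta> * (k * (2 * r) powr (- (n / p)) * E powr (1 / p))"
          using avg[OF IV0 IVE] n1 r \<beta> by (intro mult_left_mono) auto
        also have "\<dots> \<le> 2 * (n * r) / \<beta> * (k * r powr (- (n / p)) * E powr (1 / p))"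
          using n1 r \<beta> k p1 by (intro mult_left_mono mult_right_mono powr_mono2') auto
        also have "\<dots> = 2 * n / \<beta> * k * (r powr 1 * r powr (- (n / p))) * E powr (1 / p)"
          using r by simp
        also have "r powr 1 * r powr (- (n / p)) = r powr \<beta>"
          by (simp only: powr_add[symmetric] \<beta>_def) simp
        finally show ?thesis .
      qed
      have xQ: "x \<in> ?Q" using r by (intro cube(3)) simp
      show "\<bar>u x - u y\<bar> \<le> C * r powr \<beta> * E powr (1 / p)" if "norm (y - x) \<le> r"
      proof -
        have "\<bar>u x - u y\<bar> \<le> 4 * n / \<beta> * k * r powr \<beta> * E powr (1 / p)"
        proof -
          define S where "S = 2 * n / \<beta> * k * r powr \<beta> * E powr (1 / p)"
          have "\<bar>u x - u y\<bar> \<le> 2 * S"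
            using dev[OF xQ, folded S_def] dev[OF cube(3)[OF that], folded S_def] by linarith
          then show ?thesis by (simp add: S_def)
        qed
        also have "\<dots> \<le> C * r powr \<beta> * E powr (1 / p)"
        proof (intro mult_right_mono)
          have "0 \<le> k * (3 / 2 * n)" using k n1 by simp
          then show "4 * n / \<beta> * k \<le> C" by (simp add: C_def algebra_simps)
        qed auto
        finally show ?thesis .
      qed
      have "\<bar>avgu\<bar> \<le> 3 * t / 2 * k * (2 * r) powr (- (n / p)) * E powr (1 / p)"
      proof -
        have contuz: "continuous_on ?Q (\<lambda>z. \<bar>u z\<bar>)" by (intro continuous_intros contu)
        have "\<bar>avgu\<bar> \<le> integral ?Q (\<lambda>z. \<bar>u z\<bar>) / ?v"
          unfolding avgu_def abs_divide using v0 contuz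
          by (intro frac_le)
            (auto intro!: integral_norm_bound_integral[where f = u, unfolded real_norm_def]
              integral_nonneg integrable_continuous contu)
        also have "integral ?Q (\<lambda>z. \<bar>u z\<bar>) \<le> integral ?Q (\<lambda>z. 3 * t / 2 * (\<bar>u z\<bar> / norm z))"
        proof (rule integral_le)
          have "continuous_on ?Q (\<lambda>z. \<bar>u z\<bar> / norm z)"
            using ann t by (intro continuous_intros contu) force
          then show "(\<lambda>z. 3 * t / 2 * (\<bar>u z\<bar> / norm z)) integrable_on ?Q"
            by (intro integrable_on_mult_right integrable_continuous)
          show "\<bar>u z\<bar> \<le> 3 * t / 2 * (\<bar>u z\<bar> / norm z)" if "z \<in> ?Q" for z
          proof -
            have nz: "norm z > 0" using ann[OF that] t by linarith
            have "\<bar>u z\<bar> * norm z \<le> \<bar>u z\<bar> * (3 * t / 2)"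
              using ann[OF that] by (intro mult_left_mono) auto
            then show ?thesis using nz by (simp add: field_simps)
          qed
        qed (intro integrable_continuous contuz)
        also have "integral ?Q (\<lambda>z. 3 * t / 2 * (\<bar>u z\<bar> / norm z))
            = 3 * t / 2 * integral ?Q (\<lambda>z. \<bar>u z\<bar> / norm z)"
          by (rule integral_mult_right)
        also have "integral ?Q (\<lambda>z. \<bar>u z\<bar> / norm z) \<le> ?v * (IW / ?v) powr (1 / p)"
          unfolding IW_def using ann t p1 v0
          by (intro integral_le_power_mean continuous_intros contu) force+
        also have "3 * t / 2 * (?v * (IW / ?v) powr (1 / p)) / ?v = 3 * t / 2 * (IW / ?v) powr (1 / p)"
          using v0 by simp
        also have "\<dots> \<le> 3 * t / 2 * (k * (2 * r) powr (- (n / p)) * E powr (1 / p))"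
          using avg[OF IW0 IWE] t by (intro mult_left_mono) auto
        finally show ?thesis using t v0 by (simp add: mult_ac divide_right_mono)
      qed
      then show "\<bar>u x\<bar> \<le> 2 * n / \<beta> * k * r powr \<beta> * E powr (1 / p)
          + 3 * t / 2 * k * (2 * r) powr (- (n / p)) * E powr (1 / p)"
        using dev[OF xQ] by linarith
    qed
    show "\<bar>u x - u y\<bar> \<le> C * r powr \<beta>
        * ((1 + ln (1 + diameter \<Omega> / norm x)) * hardy_difference p \<Omega> u) powr (1 / p)"
      if "0 < r" "r \<le> norm x / (2 * n)" "norm (y - x) \<le> r" for r y
      using core(1)[of r y] that by (simp add: t_def E_def)
    have "\<bar>u x\<bar> \<le> C * t powr \<beta> * E powr (1 / p)"
    proof -
      define r where "r = t / (2 * n)"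
      have r: "0 < r" "r \<le> t / (2 * n)" using t n1 by (auto simp: r_def)
      have "r \<le> t" using t n1 by (simp add: r_def field_simps)
      then have "r powr \<beta> \<le> t powr \<beta>" using r \<beta> by (intro powr_mono2) auto
      then have "2 * n / \<beta> * k * r powr \<beta> \<le> 4 * n / \<beta> * k * t powr \<beta>"
        using n1 k \<beta> by (intro mult_mono) (auto simp: divide_right_mono)
      moreover have "3 * t / 2 * k * (2 * r) powr (- (n / p)) \<le> 3 / 2 * n * k * t powr \<beta>"
      proof -
        have "(2 * r) powr (- (n / p)) = t powr (- (n / p)) * n powr (n / p)"
          using t n1 by (simp add: r_def powr_divide powr_minus_divide)
        also have "\<dots> \<le> t powr (- (n / p)) * n powr 1"
          using n1 pn p1 by (intro mult_left_mono powr_mono) auto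
        finally have "3 * t / 2 * k * (2 * r) powr (- (n / p))
            \<le> 3 * t / 2 * k * (t powr (- (n / p)) * n powr 1)"
          using t k by (intro mult_left_mono) auto
        also have "\<dots> = 3 / 2 * n * k * (t powr 1 * t powr (- (n / p)))"
          using t n1 by simp
        also have "t powr 1 * t powr (- (n / p)) = t powr \<beta>"
          by (simp only: powr_add[symmetric] \<beta>_def) simp
        finally show ?thesis .
      qed
      ultimately have "2 * n / \<beta> * k * r powr \<beta> + 3 * t / 2 * k * (2 * r) powr (- (n / p)) \<le> C * t powr \<beta>"
        by (simp add: C_def algebra_simps)
      then have "(2 * n / \<beta> * k * r powr \<beta> + 3 * t / 2 * k * (2 * r) powr (- (n / p))) * E powr (1 / p)
          \<le> C * t powr \<beta> * E powr (1 / p)"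
        by (rule mult_right_mono) simp
      with core(2)[OF r] show ?thesis by (simp add: distrib_right)
    qed
    then show "\<bar>u x\<bar> \<le> C * norm x powr \<beta>
        * ((1 + ln (1 + diameter \<Omega> / norm x)) * hardy_difference p \<Omega> u) powr (1 / p)"
      by (simp add: t_def E_def)
  qed
  show thesis
  proof (rule that[OF C])
    fix \<Omega> :: "(real ^ 'n) set" and u
    assume a: "u \<in> Cc_infinity (\<Omega> - {0})" "open \<Omega>" "bounded \<Omega>" "0 \<in> \<Omega>"
    show "0 \<le> hardy_difference p \<Omega> u"
      using main[OF a, of "axis undefined 1"] by (simp add: axis_eq_0_iff)
    fix x :: "real ^ 'n" assume "x \<noteq> 0"
    note m = main[OF a this]
    from m show "\<bar>u x\<bar> \<le> C * norm x powr (1 - n / p)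
        * ((1 + ln (1 + diameter \<Omega> / norm x)) * hardy_difference p \<Omega> u) powr (1 / p)"
      unfolding \<beta>_def by (elim conjE)
    fix r y assume "0 < r" "r \<le> norm x / (2 * n)" "norm (y - x) \<le> r"
    with m show "\<bar>u x - u y\<bar> \<le> C * r powr (1 - n / p)
        * ((1 + ln (1 + diameter \<Omega> / norm x)) * hardy_difference p \<Omega> u) powr (1 / p)"
      unfolding \<beta>_def by (elim conjE) simp
  qed
qed

text \<open>
  With \<open>D = 2 diam \<Omega>\<close> the weight is \<open>X(r/D) = 1/T\<close>, where \<open>T = 1 + ln (2 diam \<Omega> / r)\<close>. If one of the points
  has norm above \<open>2 n r\<close>, \<open>r = |x - y|\<close>, the local Hoelder bound applies; otherwise both values are estimated by
  the size bound, and \<open>log_factor_bound\<close> turns the scales \<open>|x|\<close> and \<open>|y|\<close> into \<open>r\<close>.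
\<close>

lemma hardy_morrey_inequality:
  fixes p :: real
  assumes p: "p > real CARD('n::finite)"
  shows "\<exists>C>0. \<forall>\<Omega> :: (real ^ 'n) set. \<forall>u \<in> Cc_infinity (\<Omega> - {0}).
    open \<Omega> \<longrightarrow> bounded \<Omega> \<longrightarrow> 0 \<in> \<Omega> \<longrightarrow>
    weighted_holder_sup p (1 / p) (2 * diameter \<Omega>) \<Omega> u
      \<le> ereal (C * hardy_difference p \<Omega> u powr (1 / p))"
proof -
  define n where "n = real CARD('n)"
  define \<beta> where "\<beta> = 1 - n / p"
  have n1: "n \<ge> 1" by (simp add: n_def Suc_leI)
  have p1: "p > 1" using p n1 unfolding n_def by linarith
  have pn: "p > n" using p by (simp add: n_def)
  have \<beta>: "\<beta> > 0" using pn p1 by (simp add: \<beta>_def)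
  obtain C where C: "C > 0"
    and hd0: "\<And>(\<Omega> :: (real ^ 'n) set) u. u \<in> Cc_infinity (\<Omega> - {0}) \<Longrightarrow>
      open \<Omega> \<Longrightarrow> bounded \<Omega> \<Longrightarrow> 0 \<in> \<Omega> \<Longrightarrow> 0 \<le> hardy_difference p \<Omega> u"
    and local: "\<And>(\<Omega> :: (real ^ 'n) set) u x r y. u \<in> Cc_infinity (\<Omega> - {0}) \<Longrightarrow>
      open \<Omega> \<Longrightarrow> bounded \<Omega> \<Longrightarrow> 0 \<in> \<Omega> \<Longrightarrow> x \<noteq> 0 \<Longrightarrow>
      0 < r \<Longrightarrow> r \<le> norm x / (2 * n) \<Longrightarrow> norm (y - x) \<le> r \<Longrightarrow>
      \<bar>u x - u y\<bar> \<le> C * r powr \<beta>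
        * ((1 + ln (1 + diameter \<Omega> / norm x)) * hardy_difference p \<Omega> u) powr (1 / p)"
    and size: "\<And>(\<Omega> :: (real ^ 'n) set) u x. u \<in> Cc_infinity (\<Omega> - {0}) \<Longrightarrow>
      open \<Omega> \<Longrightarrow> bounded \<Omega> \<Longrightarrow> 0 \<in> \<Omega> \<Longrightarrow> x \<noteq> 0 \<Longrightarrow>
      \<bar>u x\<bar> \<le> C * norm x powr \<beta>
        * ((1 + ln (1 + diameter \<Omega> / norm x)) * hardy_difference p \<Omega> u) powr (1 / p)"
    by (fact local_holder_and_size_bound[OF p, folded n_def, folded \<beta>_def])
  define q where "q = p - n"
  define M where "M = (2 * n) powr q + (1 + 2 * n) powr q / q"
  have q: "q > 0" using pn by (simp add: q_def)
  have M: "M > 0" using n1 q by (auto simp: M_def intro!: add_pos_pos)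
  define L where "L = C * (1 + 2 * M powr (1 / p))"
  have L: "L > 0" using C by (auto simp: L_def intro!: mult_pos_pos add_pos_nonneg)
  have "\<bar>u x - u y\<bar> / norm (x - y) powr \<beta> * X (norm (x - y) / (2 * diameter \<Omega>)) powr (1 / p)
      \<le> L * hardy_difference p \<Omega> u powr (1 / p)"
    if u: "u \<in> Cc_infinity (\<Omega> - {0})" and \<Omega>: "open \<Omega>" "bounded \<Omega>" "0 \<in> \<Omega>"
      and xy: "x \<in> \<Omega>" "y \<in> \<Omega>" "x \<noteq> y" for \<Omega> :: "(real ^ 'n) set" and u x y
  proof -
    define R where "R = diameter \<Omega>"
    define r where "r = norm (x - y)"
    define T where "T = 1 + ln (2 * R / r)"
    define I where "I = hardy_difference p \<Omega> u"
    have r: "r > 0" using xy by (simp add: r_def)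
    have rR: "r \<le> R" using diameter_bounded_bound[OF \<Omega>(2) xy(1,2)] by (simp add: r_def R_def dist_norm)
    have T: "T \<ge> 1" using r rR by (simp add: T_def le_divide_eq)
    have I: "I \<ge> 0" using hd0[OF u \<Omega>] by (simp add: I_def)
    have XT: "X (r / (2 * R)) = 1 / T"
    proof -
      have "2 * R / r = inverse (r / (2 * R))" by simp
      then have "ln (2 * R / r) = - ln (r / (2 * R))" by (simp only: ln_inverse)
      then show ?thesis by (simp only: X_def T_def inverse_eq_divide diff_conv_add_uminus)
    qed
    have u0: "u 0 = 0"
      using u closure_subset[of "{x. u x \<noteq> 0}"] by (auto simp: Cc_infinity_def)
    have size_r: "\<bar>u z\<bar> \<le> C * M powr (1 / p) * (r powr \<beta> * (T * I) powr (1 / p))"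
      if z: "norm z \<le> 2 * n * r" for z
    proof (cases "z = 0")
      case True
      then show ?thesis using u0 C by simp
    next
      case False
      define t where "t = norm z"
      have t: "t > 0" using False by (simp add: t_def)
      have "t powr q * (1 + ln (1 + R / t)) \<le> M * (r powr q * T)"
        unfolding M_def T_def using q n1 t r rR z
        by (intro log_factor_bound) (auto simp: t_def)
      then have "t powr q * (1 + ln (1 + R / t)) * I \<le> M * (r powr q * T) * I"
        using I by (rule mult_right_mono)
      then have "(t powr q * ((1 + ln (1 + R / t)) * I)) powr (1 / p) \<le> (M * (r powr q * (T * I))) powr (1 / p)"
        using t I p1 r rR by (intro powr_mono2) (auto simp: mult_ac)
      moreover have qp: "(s powr q) powr (1 / p) = s powr \<beta>" for s
        using p1 by (simp add: powr_powr q_def \<beta>_def diff_divide_distrib)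
      ultimately have "t powr \<beta> * ((1 + ln (1 + R / t)) * I) powr (1 / p)
          \<le> M powr (1 / p) * (r powr \<beta> * (T * I) powr (1 / p))"
        by (simp only: powr_mult)
      then have "C * (t powr \<beta> * ((1 + ln (1 + R / t)) * I) powr (1 / p))
          \<le> C * (M powr (1 / p) * (r powr \<beta> * (T * I) powr (1 / p)))"
        using C by (intro mult_left_mono) auto
      moreover have "\<bar>u z\<bar> \<le> C * t powr \<beta> * ((1 + ln (1 + R / t)) * I) powr (1 / p)"
        using size[OF u \<Omega> False] by (simp add: t_def R_def I_def)
      ultimately show ?thesis by (simp add: mult.assoc)
    qed
    have far: "\<bar>u z - u w\<bar> \<le> C * (r powr \<beta> * (T * I) powr (1 / p))"
      if zw: "norm z > 2 * n * r" "norm (w - z) = r" for z w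
    proof -
      have nr: "2 * n * r \<ge> r" using r n1 by (simp add: mult_le_cancel_right1)
      have z: "norm z > 0" "r \<le> norm z" using zw nr r by linarith+
      have "\<bar>u z - u w\<bar> \<le> C * r powr \<beta> * ((1 + ln (1 + R / norm z)) * I) powr (1 / p)"
        unfolding R_def I_def using zw z r n1
        by (intro local[OF u \<Omega>]) (auto simp: field_simps)
      also have "\<dots> \<le> C * r powr \<beta> * (T * I) powr (1 / p)"
      proof (intro mult_left_mono powr_mono2 mult_right_mono)
        have "1 + R / norm z \<le> R / r + R / r"
          using z r rR by (intro add_mono divide_left_mono) auto
        then show "1 + ln (1 + R / norm z) \<le> T"
          using z r rR by (simp add: T_def add_pos_nonneg)
      qed (use I C p1 z r rR in auto)
      finally show ?thesis by (simp add: mult.assoc)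
    qed
    have main: "\<bar>u x - u y\<bar> \<le> L * (r powr \<beta> * (T * I) powr (1 / p))"
    proof -
      define B where "B = r powr \<beta> * (T * I) powr (1 / p)"
      have B: "B \<ge> 0" by (simp add: B_def)
      have LB: "L * B = C * B + 2 * (C * M powr (1 / p) * B)" by (simp add: L_def algebra_simps)
      have pos: "C * B \<ge> 0" "C * M powr (1 / p) * B \<ge> 0" using C B by simp_all
      consider "norm x > 2 * n * r" | "norm y > 2 * n * r" | "norm x \<le> 2 * n * r" "norm y \<le> 2 * n * r"
        by linarith
      then have "\<bar>u x - u y\<bar> \<le> L * B"
      proof cases
        case 1
        have "norm (y - x) = r" by (simp add: r_def norm_minus_commute)
        from far[OF 1 this, folded B_def] show ?thesis using pos LB by linarith
      next
        case 2
        have "norm (x - y) = r" by (simp add: r_def)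
        from far[OF 2 this, folded B_def] show ?thesis using pos LB by linarith
      next
        case 3
        have "\<bar>u x - u y\<bar> \<le> \<bar>u x\<bar> + \<bar>u y\<bar>" by linarith
        then show ?thesis
          using size_r[OF 3(1), folded B_def] size_r[OF 3(2), folded B_def] pos LB by linarith
      qed
      then show ?thesis by (simp add: B_def)
    qed
    have "\<bar>u x - u y\<bar> / r powr \<beta> * (1 / T) powr (1 / p)
        \<le> L * (r powr \<beta> * (T * I) powr (1 / p)) / r powr \<beta> * (1 / T) powr (1 / p)"
      using main by (intro mult_right_mono divide_right_mono) auto
    also have "\<dots> = L * I powr (1 / p) * (T powr (1 / p) * (1 / T) powr (1 / p))"
      using r by (simp add: powr_mult)
    also have "T powr (1 / p) * (1 / T) powr (1 / p) = 1"
      using T by (simp add: powr_mult[symmetric])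
    finally show ?thesis using XT by (simp add: r_def R_def I_def)
  qed
  then show ?thesis
    using L unfolding weighted_holder_sup_def \<beta>_def n_def
    by (intro exI[of _ L]) (auto intro!: SUP_least)
qed

lemma hardy_difference_nonneg:
  fixes p :: real and \<Omega> :: "(real ^ 'n::finite) set"
  assumes "p > real CARD('n)" "u \<in> Cc_infinity (\<Omega> - {0})" "open \<Omega>" "bounded \<Omega>" "0 \<in> \<Omega>"
  shows "0 \<le> hardy_difference p \<Omega> u"
  using local_holder_and_size_bound[OF assms(1)] assms by metis

section \<open>Smooth functions and flat functions\<close>

lemma partial_deriv_eq:
  assumes "(f has_derivative f') (at x)"
  shows "partial_deriv i f x = f' (axis i 1)"
  using frechet_derivative_at[OF assms] by (simp add: partial_deriv_def)

lemma Ck_on_cong: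
  assumes "open S" "\<And>x. x \<in> S \<Longrightarrow> f x = g x"
  shows "Ck_on k S f \<longleftrightarrow> Ck_on k S g"
  using assms(2)
proof (induction k arbitrary: f g)
  case 0
  then show ?case by (simp cong: continuous_on_cong)
next
  case (Suc k)
  have transfer: "(h has_derivative h') (at x)"
    if "x \<in> S" "(f has_derivative h') (at x)" "\<And>x. x \<in> S \<Longrightarrow> f x = h x" for f h h' x
    using that assms(1) by (auto intro: has_derivative_transform_within_open)
  have diff: "h differentiable (at x)"
    if a: "x \<in> S" "f differentiable (at x)" "\<And>x. x \<in> S \<Longrightarrow> f x = h x" for f h :: "real ^ 'a \<Rightarrow> real" and x
  proof -
    from a(2) obtain D where D: "(f has_derivative D) (at x)" unfolding differentiable_def by blast
    have "(h has_derivative D) (at x)" by (rule transfer[OF a(1) D a(3)])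
    then show ?thesis by (auto simp: differentiable_def)
  qed
  have "(\<forall>x\<in>S. f differentiable (at x)) \<longleftrightarrow> (\<forall>x\<in>S. g differentiable (at x))"
    using diff[of _ f g] diff[of _ g f] Suc.prems by auto
  moreover have "Ck_on k S (partial_deriv i f) \<longleftrightarrow> Ck_on k S (partial_deriv i g)"
    if "\<forall>x\<in>S. f differentiable (at x)" for i
  proof (rule Suc.IH)
    fix x assume x: "x \<in> S"
    then have "(f has_derivative frechet_derivative f (at x)) (at x)"
      using that by (simp add: frechet_derivative_works)
    with transfer[OF x this Suc.prems] show "partial_deriv i f x = partial_deriv i g x"
      by (simp add: partial_deriv_eq)
  qed
  ultimately show ?case by auto
qed

lemma Ck_on_Suc_imp: "Ck_on (Suc k) S f \<Longrightarrow> Ck_on k S f"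
proof (induction k arbitrary: f)
  case 0
  then show ?case
    by (auto intro!: continuous_at_imp_continuous_on differentiable_imp_continuous_within)
next
  case (Suc k)
  from Suc.prems have "\<forall>x\<in>S. f differentiable (at x)" and "Ck_on (Suc k) S (partial_deriv i f)" for i
    by auto
  then show ?case using Suc.IH by auto
qed

lemma Ck_on_SucI:
  assumes "open S" and "\<And>x. x \<in> S \<Longrightarrow> (f has_derivative f' x) (at x)"
    and "\<And>i. Ck_on k S (\<lambda>x. f' x (axis i 1))"
  shows "Ck_on (Suc k) S f"
proof -
  have "Ck_on k S (partial_deriv i f)" for i
    using assms(3)[of i] Ck_on_cong[OF assms(1), of "partial_deriv i f" "\<lambda>x. f' x (axis i 1)"]
      partial_deriv_eq[OF assms(2)] by blast
  then show ?thesis using assms(2) by (auto simp: differentiable_def)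
qed

lemma Ck_on_SucD:
  assumes "Ck_on (Suc k) S f" "x \<in> S"
  shows "(f has_derivative frechet_derivative f (at x)) (at x)"
  using assms by (simp add: frechet_derivative_works)

lemma Ck_on_const: "open S \<Longrightarrow> Ck_on k S (\<lambda>_. c)"
proof (induction k arbitrary: c)
  case (Suc k)
  show ?case
    by (rule Ck_on_SucI[where f' = "\<lambda>_ _. 0"]) (use Suc in \<open>auto intro: derivative_eq_intros\<close>)
qed auto

lemma Ck_on_add:
  assumes "open S"
  shows "Ck_on k S f \<Longrightarrow> Ck_on k S g \<Longrightarrow> Ck_on k S (\<lambda>x. f x + g x)"
proof (induction k arbitrary: f g)
  case (Suc k)
  show ?case
  proof (rule Ck_on_SucI[OF assms has_derivative_add])
    show "Ck_on k S (\<lambda>x. frechet_derivative f (at x) (axis i 1) + frechet_derivative g (at x) (axis i 1))" for i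
      using Suc by (auto simp flip: partial_deriv_def)
  qed (use Ck_on_SucD Suc.prems in blast)+
qed (auto intro: continuous_intros)

lemma Ck_on_mult:
  assumes "open S"
  shows "Ck_on k S f \<Longrightarrow> Ck_on k S g \<Longrightarrow> Ck_on k S (\<lambda>x. f x * g x)"
proof (induction k arbitrary: f g)
  case (Suc k)
  show ?case
  proof (rule Ck_on_SucI[OF assms has_derivative_mult])
    have "Ck_on k S f" "Ck_on k S g" using Suc.prems by (blast intro: Ck_on_Suc_imp)+
    then show "Ck_on k S (\<lambda>x. f x * frechet_derivative g (at x) (axis i 1) + frechet_derivative f (at x) (axis i 1) * g x)" for i
      using Suc by (auto simp flip: partial_deriv_def intro!: Ck_on_add[OF assms])
  qed (use Ck_on_SucD Suc.prems in blast)+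
qed (auto intro: continuous_intros)

text \<open>
  A smooth function \<open>\<Phi> 0\<close> of one variable is carried together with all its derivatives, so that composition with it
  can be treated by induction on the order for all derivatives simultaneously.
\<close>

definition all_derivs :: "real set \<Rightarrow> (nat \<Rightarrow> real \<Rightarrow> real) \<Rightarrow> bool" where
  "all_derivs T \<Phi> \<longleftrightarrow> (\<forall>m. \<forall>y\<in>T. (\<Phi> m has_real_derivative \<Phi> (Suc m) y) (at y))"

lemma Ck_on_compose:
  assumes "open S" "all_derivs T \<Phi>" "\<And>x. x \<in> S \<Longrightarrow> f x \<in> T"
  shows "Ck_on k S f \<Longrightarrow> Ck_on k S (\<lambda>x. \<Phi> m (f x))"
proof (induction k arbitrary: m)
  case 0
  have "continuous_on T (\<Phi> m)"
    using assms(2) unfolding all_derivs_def by (meson DERIV_isCont continuous_at_imp_continuous_on)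
  then show ?case using 0 assms(3) by (auto intro: continuous_on_compose2)
next
  case (Suc k)
  show ?case
  proof (rule Ck_on_SucI[OF assms(1)])
    fix x assume x: "x \<in> S"
    have "(\<Phi> m has_derivative (*) (\<Phi> (Suc m) (f x))) (at (f x))"
      using assms(2,3) x by (auto simp: all_derivs_def has_field_derivative_def)
    then show "((\<lambda>x. \<Phi> m (f x)) has_derivative
        (\<lambda>v. \<Phi> (Suc m) (f x) * frechet_derivative f (at x) v)) (at x)"
      by (rule has_derivative_compose[OF Ck_on_SucD[OF Suc.prems x]])
  next
    have "Ck_on k S f" using Suc.prems by (rule Ck_on_Suc_imp)
    then show "Ck_on k S (\<lambda>x. \<Phi> (Suc m) (f x) * frechet_derivative f (at x) (axis i 1))" for i
      using Suc by (auto simp flip: partial_deriv_def intro!: Ck_on_mult[OF assms(1)])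
  qed
qed

lemma Ck_on_component: "open S \<Longrightarrow> Ck_on k S (\<lambda>x. x $ j)"
proof (cases k)
  case (Suc l)
  assume S: "open S"
  show ?thesis unfolding Suc
  proof (rule Ck_on_SucI[OF S])
    show "((\<lambda>x. x $ j) has_derivative (\<lambda>v. v $ j)) (at x)" for x
      by (rule bounded_linear_imp_has_derivative) (rule bounded_linear_vec_nth)
  qed (rule Ck_on_const[OF S])
qed (auto intro!: continuous_intros)

lemma Ck_on_inner_self:
  assumes "open (S :: (real ^ 'n::finite) set)"
  shows "Ck_on k S (\<lambda>x. x \<bullet> x)"
proof -
  have "Ck_on k S (\<lambda>x. \<Sum>i\<in>I. x $ i * x $ i)" if "finite I" for I :: "'n set"
    using that by induction
      (auto intro!: Ck_on_const Ck_on_add Ck_on_mult Ck_on_component assms)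
  then show ?thesis by (simp add: inner_vec_def)
qed

lemma all_derivs_exp: "all_derivs UNIV (\<lambda>_. exp)"
  by (auto simp: all_derivs_def intro!: derivative_eq_intros)

lemma all_derivs_ln:
  "all_derivs {0<..} (\<lambda>m y. if m = 0 then ln y else (- 1) ^ (m - 1) * fact (m - 1) / y ^ m)"
  unfolding all_derivs_def
proof (intro allI ballI)
  fix m and y :: real assume "y \<in> {0<..}"
  then have y: "y > 0" by simp
  show "((\<lambda>y. if m = 0 then ln y else (- 1) ^ (m - 1) * fact (m - 1) / y ^ m) has_real_derivative
      (if Suc m = 0 then ln y else (- 1) ^ (Suc m - 1) * fact (Suc m - 1) / y ^ Suc m)) (at y)"
  proof (cases m)
    case 0
    then show ?thesis using y by (auto intro!: derivative_eq_intros)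
  next
    case (Suc l)
    have "((\<lambda>y. ((- 1) ^ l * fact l) / y ^ Suc l) has_real_derivative
        (0 * y ^ Suc l - ((- 1) ^ l * fact l) * (real (Suc l) * y ^ l)) / (y ^ Suc l * y ^ Suc l)) (at y)"
      using y DERIV_pow[of "Suc l" y] by (intro DERIV_divide DERIV_const) auto
    also have "(0 * y ^ Suc l - ((- 1) ^ l * fact l) * (real (Suc l) * y ^ l)) / (y ^ Suc l * y ^ Suc l)
        = (- 1) ^ Suc l * fact (Suc l) / y ^ Suc (Suc l)"
      using y by (simp add: field_simps)
    finally show ?thesis using Suc by simp
  qed
qed

lemma poly_div_exp_tendsto_0: "((\<lambda>z::real. poly q z / exp z) \<longlongrightarrow> 0) at_top"
proof -
  have "((\<lambda>z::real. \<Sum>i\<le>degree q. coeff q i * (z ^ i / exp z)) \<longlongrightarrow> (\<Sum>i\<le>degree q. coeff q i * 0)) at_top"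
    by (intro tendsto_intros tendsto_power_div_exp_0)
  then show ?thesis by (simp add: poly_altdef sum_divide_distrib)
qed

text \<open>
  The functions \<open>q(1/y) exp (-1/y)\<close> with a polynomial \<open>q\<close>, extended by zero: a class that contains the standard
  flat function and is closed under differentiation.
\<close>

definition flat :: "real poly \<Rightarrow> real \<Rightarrow> real" where
  "flat q y = (if y > 0 then poly q (1 / y) * exp (- (1 / y)) else 0)"

lemma has_real_derivative_flat:
  "(flat q has_real_derivative flat ([:0, 0, 1:] * (q - pderiv q)) y) (at y)"
proof -
  consider "y > 0" | "y < 0" | "y = 0" by linarith
  then show ?thesis
  proof cases
    case 1
    have "((\<lambda>y. poly q (1 / y) * exp (- (1 / y))) has_real_derivative
        poly (pderiv q) (1 / y) * (- (1 / y\<^sup>2)) * exp (- (1 / y))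
          + exp (- (1 / y)) * (1 / y\<^sup>2) * poly q (1 / y)) (at y)"
      using 1 by (auto intro!: derivative_eq_intros DERIV_chain2[OF poly_DERIV] simp: power2_eq_square)
    also have "poly (pderiv q) (1 / y) * (- (1 / y\<^sup>2)) * exp (- (1 / y))
          + exp (- (1 / y)) * (1 / y\<^sup>2) * poly q (1 / y) = flat ([:0, 0, 1:] * (q - pderiv q)) y"
      using 1 by (simp add: flat_def power2_eq_square field_simps)
    finally show ?thesis
      by (rule has_field_derivative_transform_within_open[where S = "{0<..}"])
        (use 1 in \<open>auto simp: flat_def\<close>)
  next
    case 2
    have "((\<lambda>_. 0) has_real_derivative flat ([:0, 0, 1:] * (q - pderiv q)) y) (at y)"
      using 2 by (simp add: flat_def)
    then show ?thesis
      by (rule has_field_derivative_transform_within_open[where S = "{..<0}"])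
        (use 2 in \<open>auto simp: flat_def\<close>)
  next
    case 3
    have "((\<lambda>h. flat q h / h) \<longlongrightarrow> 0) (at_right 0)"
      unfolding filterlim_at_right_to_top
    proof (rule Lim_transform_eventually[OF poly_div_exp_tendsto_0[of "pCons 0 q"]])
      show "\<forall>\<^sub>F z in at_top. poly (pCons 0 q) z / exp z = flat q (inverse z) / inverse z"
        using eventually_gt_at_top[of 0]
        by eventually_elim (simp add: flat_def exp_minus field_simps)
    qed
    moreover have "((\<lambda>h. flat q h / h) \<longlongrightarrow> 0) (at_left 0)"
    proof (rule Lim_transform_eventually[OF tendsto_const])
      show "\<forall>\<^sub>F h in at_left 0. 0 = flat q h / h"
        by (auto simp: eventually_at_filter flat_def)
    qed
    ultimately have "((\<lambda>h. flat q h / h) \<longlongrightarrow> 0) (at 0)"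
      by (rule filterlim_split_at[rotated])
    then show ?thesis using 3 by (simp add: DERIV_def flat_def)
  qed
qed

lemma all_derivs_flat:
  "all_derivs UNIV (\<lambda>m. flat (((\<lambda>q. [:0, 0, 1:] * (q - pderiv q)) ^^ m) q))"
  unfolding all_derivs_def using has_real_derivative_flat by simp

section \<open>The logarithmic bump profile\<close>

text \<open>
  For \<open>\<theta> \<ge> -1/2\<close> this is Taylor's theorem with the second derivative bounded through
  \<open>(1+t)\<^bsup>p-2\<^esup> \<le> 4 (1+t)\<^sup>p\<close>; for \<open>\<theta> < -1/2\<close> the factor \<open>\<theta>\<^sup>2\<close> is bounded below. The polynomial growth on the
  right makes the bound valid for all exponents \<open>p > 1\<close> at once.
\<close>

lemma abs_powr_second_order_remainder:
  fixes p :: real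
  assumes p: "p > 1"
  obtains C where "C > 0"
    and "\<And>\<theta>::real. \<bar>1 + \<theta>\<bar> powr p - 1 - p * \<theta> \<le> C * \<theta>\<^sup>2 * (1 + \<bar>\<theta>\<bar>) powr p"
proof -
  define C where "C = 2 * p * (p - 1) + 4 * (1 + p)"
  have C: "C > 0" using p by (simp add: C_def add_pos_pos)
  have "\<bar>1 + \<theta>\<bar> powr p - 1 - p * \<theta> \<le> C * \<theta>\<^sup>2 * (1 + \<bar>\<theta>\<bar>) powr p" for \<theta> :: real
  proof -
    define Y where "Y = (1 + \<bar>\<theta>\<bar>) powr p"
    have Y1: "1 + \<bar>\<theta>\<bar> \<le> Y" using powr_mono[of 1 p "1 + \<bar>\<theta>\<bar>"] p by (simp add: Y_def)
    consider "\<theta> = 0" | "\<theta> \<noteq> 0" "\<theta> \<ge> - 1 / 2" | "\<theta> < - 1 / 2" by linarith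
    then have "\<bar>1 + \<theta>\<bar> powr p - 1 - p * \<theta> \<le> C * \<theta>\<^sup>2 * Y"
    proof cases
      case 1
      then show ?thesis by simp
    next
      case 2
      define diff where "diff = (\<lambda>m::nat. \<lambda>t::real. if m = 0 then (1 + t) powr p
        else if m = 1 then p * (1 + t) powr (p - 1) else p * ((p - 1) * (1 + t) powr (p - 2)))"
      have "\<exists>t. (if \<theta> < 0 then \<theta> < t \<and> t < 0 else 0 < t \<and> t < \<theta>) \<and>
          diff 0 \<theta> = (\<Sum>m<2. diff m 0 / fact m * (\<theta> - 0) ^ m) + diff 2 t / fact 2 * (\<theta> - 0) ^ 2"
      proof (rule Taylor[where a = "- 1 / 2" and b = "\<bar>\<theta>\<bar>"])
        show "\<forall>m t. m < 2 \<and> - 1 / 2 \<le> t \<and> t \<le> \<bar>\<theta>\<bar> \<longrightarrow> (diff m has_real_derivative diff (Suc m) t) (at t)"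
        proof (intro allI impI)
          fix m :: nat and t :: real assume a: "m < 2 \<and> - 1 / 2 \<le> t \<and> t \<le> \<bar>\<theta>\<bar>"
          then have t: "1 + t > 0" by linarith
          have d: "((\<lambda>t. (1 + t) powr q) has_real_derivative q * (1 + t) powr (q - 1)) (at t)" for q
            using t by (auto intro!: derivative_eq_intros)
          from a consider "m = 0" | "m = 1" by linarith
          then show "(diff m has_real_derivative diff (Suc m) t) (at t)"
          proof cases
            case 1
            then show ?thesis using d[of p] by (simp add: diff_def)
          next
            case 2
            then show ?thesis using DERIV_cmult[OF d[of "p - 1"], of p] by (simp add: diff_def)
          qed
        qed
      qed (use 2 in auto)
      then obtain t where t: "if \<theta> < 0 then \<theta> < t \<and> t < 0 else 0 < t \<and> t < \<theta>"
        and eq: "(1 + \<theta>) powr p = 1 + p * \<theta> + p * ((p - 1) * (1 + t) powr (p - 2)) / 2 * \<theta>\<^sup>2"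
        by (auto simp: diff_def numeral_2_eq_2)
      have t2: "1 / 2 \<le> 1 + t" "1 + t \<le> 1 + \<bar>\<theta>\<bar>" using t 2 by (auto split: if_splits)
      have "(1 + t) powr (p - 2) \<le> 4 * Y"
      proof -
        have "(1 / 2)\<^sup>2 \<le> (1 + t)\<^sup>2" using t2 by (intro power_mono) auto
        then have q: "1 \<le> 4 * (1 + t)\<^sup>2" by (simp add: power2_eq_square)
        have "(1 + t) powr (p - 2) * 1 \<le> (1 + t) powr (p - 2) * (4 * (1 + t)\<^sup>2)"
          using q by (intro mult_left_mono) auto
        also have "\<dots> = 4 * (1 + t) powr p"
        proof -
          have "(1 + t) powr (p - 2) * (1 + t) powr 2 = (1 + t) powr p"
            by (simp only: powr_add[symmetric]) simp
          then show ?thesis using t2 by (simp add: powr_numeral)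
        qed
        also have "\<dots> \<le> 4 * Y" unfolding Y_def using t2 p by (intro mult_left_mono powr_mono2) auto
        finally show ?thesis by simp
      qed
      then have "p * ((p - 1) * (1 + t) powr (p - 2)) / 2 * \<theta>\<^sup>2 \<le> p * ((p - 1) * (4 * Y)) / 2 * \<theta>\<^sup>2"
        using p by (intro mult_right_mono divide_right_mono mult_left_mono) auto
      also have "\<dots> \<le> C * \<theta>\<^sup>2 * Y"
      proof -
        have "0 \<le> 4 * (1 + p) * \<theta>\<^sup>2 * Y" using p by (simp add: Y_def)
        then show ?thesis by (simp add: C_def algebra_simps)
      qed
      finally show ?thesis using 2 eq by simp
    next
      case 3
      have "\<bar>1 + \<theta>\<bar> powr p \<le> Y" unfolding Y_def using p by (intro powr_mono2) auto
      moreover have "- (p * \<theta>) \<le> p * Y"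
      proof -
        have "p * (- \<theta>) \<le> p * Y" using 3 Y1 p by (intro mult_left_mono) auto
        then show ?thesis by simp
      qed
      ultimately have "\<bar>1 + \<theta>\<bar> powr p - 1 - p * \<theta> \<le> 1 * ((1 + p) * Y)" by (simp add: algebra_simps)
      also have "\<dots> \<le> (4 * \<theta>\<^sup>2) * ((1 + p) * Y)"
      proof (rule mult_right_mono)
        have "(1 / 2)\<^sup>2 \<le> (- \<theta>)\<^sup>2" using 3 by (intro power_mono) auto
        then show "1 \<le> 4 * \<theta>\<^sup>2" by (simp add: power2_eq_square)
      qed (use p in \<open>simp add: Y_def\<close>)
      also have "\<dots> \<le> C * \<theta>\<^sup>2 * Y"
      proof -
        have "0 \<le> 2 * p * (p - 1) * \<theta>\<^sup>2 * Y" using p by (simp add: Y_def)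
        then show ?thesis by (simp add: C_def algebra_simps)
      qed
      finally show ?thesis .
    qed
    then show ?thesis by (simp add: Y_def)
  qed
  then show thesis using that[OF C] by blast
qed

text \<open>
  The exponent \<open>\<epsilon> = p/(2+p)\<close> is chosen such that the bounds \<open>w\<^sup>2 \<le> c exp (\<epsilon> w)\<close> for the \<open>2 + p\<close> factors of the
  order of \<open>w\<^sup>2\<close> exactly use up \<open>exp (- p w)\<close>.
\<close>

lemma exp_dominates_polynomial:
  fixes p \<alpha> :: real
  assumes p: "p > 1" and \<alpha>: "\<alpha> > 0"
  obtains C where "C > 0" and "\<And>w::real. w \<ge> 0 \<Longrightarrow> exp (- p * w) * w ^ 4 * (1 + w\<^sup>2 / \<alpha>) powr p \<le> C"
proof -
  define \<epsilon> where "\<epsilon> = p / (2 + p)"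
  define c where "c = 2 / \<epsilon>\<^sup>2"
  have \<epsilon>: "\<epsilon> > 0" using p by (simp add: \<epsilon>_def)
  have c: "c > 0" using \<epsilon> by (simp add: c_def)
  have "exp (- p * w) * w ^ 4 * (1 + w\<^sup>2 / \<alpha>) powr p \<le> c\<^sup>2 * (1 + c / \<alpha>) powr p" if w: "w \<ge> 0" for w
  proof -
    have "(\<epsilon> * w)\<^sup>2 / 2 \<le> exp (\<epsilon> * w)"
      using exp_lower_Taylor_quadratic[of "\<epsilon> * w"] w \<epsilon> by (smt (verit) mult_nonneg_nonneg)
    then have w2: "w\<^sup>2 \<le> c * exp (\<epsilon> * w)"
      using \<epsilon> by (simp add: c_def power_mult_distrib field_simps)
    have "w ^ 4 = (w\<^sup>2)\<^sup>2" by simp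
    also have "\<dots> \<le> (c * exp (\<epsilon> * w))\<^sup>2" using w2 by (intro power_mono) auto
    also have "\<dots> = c\<^sup>2 * exp (2 * \<epsilon> * w)" by (simp add: power_mult_distrib exp_double[symmetric] mult.assoc)
    finally have w4: "w ^ 4 \<le> c\<^sup>2 * exp (2 * \<epsilon> * w)" .
    have "1 + w\<^sup>2 / \<alpha> \<le> exp (\<epsilon> * w) + c * exp (\<epsilon> * w) / \<alpha>"
      using w2 \<alpha> w \<epsilon> by (intro add_mono divide_right_mono) auto
    also have "\<dots> = (1 + c / \<alpha>) * exp (\<epsilon> * w)" by (simp add: algebra_simps)
    finally have "(1 + w\<^sup>2 / \<alpha>) powr p \<le> ((1 + c / \<alpha>) * exp (\<epsilon> * w)) powr p"
      using p \<alpha> by (intro powr_mono2) auto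
    also have "\<dots> = (1 + c / \<alpha>) powr p * exp (p * \<epsilon> * w)"
      by (simp add: powr_mult exp_powr_real mult_ac)
    finally have "exp (- p * w) * w ^ 4 * (1 + w\<^sup>2 / \<alpha>) powr p
        \<le> exp (- p * w) * (c\<^sup>2 * exp (2 * \<epsilon> * w)) * ((1 + c / \<alpha>) powr p * exp (p * \<epsilon> * w))"
      using w4 by (intro mult_mono) auto
    also have "\<dots> = c\<^sup>2 * (1 + c / \<alpha>) powr p * (exp (- p * w) * exp (2 * \<epsilon> * w) * exp (p * \<epsilon> * w))"
      by simp
    also have "exp (- p * w) * exp (2 * \<epsilon> * w) * exp (p * \<epsilon> * w) = exp (((2 + p) * \<epsilon> - p) * w)"
      by (simp add: exp_add[symmetric] algebra_simps)
    also have "(2 + p) * \<epsilon> - p = 0" using p by (simp add: \<epsilon>_def)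
    finally show ?thesis by simp
  qed
  moreover have "c\<^sup>2 * (1 + c / \<alpha>) powr p > 0"
  proof -
    have "1 + c / \<alpha> > 0" using c \<alpha> by (intro add_pos_pos divide_pos_pos) auto
    then show ?thesis using c by simp
  qed
  ultimately show thesis using that by blast
qed

definition bump :: "real \<Rightarrow> real" where
  "bump \<tau> = flat 1 (\<tau> - 1) * flat 1 (3 - \<tau>)"

definition bump_deriv :: "real \<Rightarrow> real" where
  "bump_deriv \<tau> = flat [:0, 0, 1:] (\<tau> - 1) * flat 1 (3 - \<tau>) - flat 1 (\<tau> - 1) * flat [:0, 0, 1:] (3 - \<tau>)"

lemma has_real_derivative_bump: "(bump has_real_derivative bump_deriv \<tau>) (at \<tau>)"
proof -
  have fl: "(flat 1 has_real_derivative flat [:0, 0, 1:] y) (at y)" for y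
    using has_real_derivative_flat[of 1 y] by simp
  have "((\<lambda>\<tau>. flat 1 (\<tau> - 1)) has_real_derivative flat [:0, 0, 1:] (\<tau> - 1) * 1) (at \<tau>)"
    by (rule DERIV_chain2[OF fl]) (auto intro!: derivative_eq_intros)
  moreover have "((\<lambda>\<tau>. flat 1 (3 - \<tau>)) has_real_derivative flat [:0, 0, 1:] (3 - \<tau>) * (- 1)) (at \<tau>)"
    by (rule DERIV_chain2[OF fl]) (auto intro!: derivative_eq_intros)
  ultimately show ?thesis
    unfolding bump_def bump_deriv_def
    by (rule DERIV_cong[OF DERIV_mult]) simp
qed

lemma continuous_on_bump: "continuous_on A bump"
  using has_real_derivative_bump by (meson DERIV_isCont continuous_at_imp_continuous_on)

lemma continuous_on_bump_deriv: "continuous_on A bump_deriv"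
proof -
  have fl: "continuous_on UNIV (flat q)" for q
    using has_real_derivative_flat by (meson DERIV_isCont continuous_at_imp_continuous_on)
  have "continuous_on A (\<lambda>\<tau>. flat q (\<tau> - 1))" "continuous_on A (\<lambda>\<tau>. flat q (3 - \<tau>))" for q
    by (rule continuous_on_compose2[OF fl]; auto intro!: continuous_intros)+
  then show ?thesis unfolding bump_deriv_def
    by (intro continuous_on_diff continuous_on_mult)
qed

lemma bump_nonneg: "bump \<tau> \<ge> 0"
  by (simp add: bump_def flat_def)

lemma bump_outside: "\<not> (1 < \<tau> \<and> \<tau> < 3) \<Longrightarrow> bump \<tau> = 0 \<and> bump_deriv \<tau> = 0"
  by (auto simp: bump_def bump_deriv_def flat_def)

text \<open>
  The logarithmic derivative of the bump is at most \<open>w\<^sup>2\<close>, so near the ends of its support, where \<open>w\<close> is large, every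
  polynomial in it is compensated by the value \<open>exp (- w)\<close>.
\<close>

lemma bump_log_derivative:
  assumes "1 < \<tau>" "\<tau> < 3"
  defines "w \<equiv> 1 / (\<tau> - 1) + 1 / (3 - \<tau>)"
  shows "w > 0" "bump \<tau> = exp (- w)" "\<bar>bump_deriv \<tau>\<bar> \<le> bump \<tau> * w\<^sup>2"
proof -
  define a where "a = 1 / (\<tau> - 1)"
  define b where "b = 1 / (3 - \<tau>)"
  have ab: "a > 0" "b > 0" "w = a + b" using assms by (auto simp: a_def b_def)
  show "w > 0" using ab by simp
  show g: "bump \<tau> = exp (- w)"
    using assms(1,2) by (simp add: bump_def flat_def ab(3) a_def b_def exp_add[symmetric])
  have fl: "flat [:0, 0, 1:] y = (1 / y)\<^sup>2 * exp (- (1 / y))" "flat 1 y = exp (- (1 / y))"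
    if "y > 0" for y
    using that by (simp_all add: flat_def power2_eq_square)
  have "bump_deriv \<tau> = a\<^sup>2 * exp (- a) * exp (- b) - exp (- a) * (b\<^sup>2 * exp (- b))"
    using assms(1,2) by (simp only: bump_deriv_def fl diff_gt_0_iff_gt a_def b_def)
  also have "\<dots> = (a\<^sup>2 - b\<^sup>2) * exp (- a + - b)"
    unfolding exp_add by (simp add: algebra_simps)
  finally have "bump_deriv \<tau> = (a\<^sup>2 - b\<^sup>2) * exp (- w)" by (simp add: ab(3))
  moreover have "\<bar>a\<^sup>2 - b\<^sup>2\<bar> \<le> w\<^sup>2"
    using ab by (auto simp: abs_le_iff power2_eq_square algebra_simps)
  ultimately show "\<bar>bump_deriv \<tau>\<bar> \<le> bump \<tau> * w\<^sup>2"
    unfolding g by (simp add: abs_mult mult.commute)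
qed

text \<open>
  With \<open>a = \<alpha> g\<close> and \<open>\<theta> = - e g'/a\<close> the left-hand side is \<open>a\<^sup>p (|1+\<theta>|\<^sup>p - 1 - p\<theta>)\<close>, which is of second order in
  \<open>\<theta>\<close>. Although \<open>\<theta>\<close> is unbounded near the ends of the support, its product with \<open>a\<^sup>p\<close> is bounded, and so are the products
  of \<open>a\<^sup>p\<close> with higher powers of \<open>\<theta>\<close>.
\<close>

lemma bump_energy_density_bound:
  fixes p \<alpha> :: real
  assumes p: "p > 1" and \<alpha>: "\<alpha> > 0"
  obtains C where "C > 0" and "\<And>\<tau> e. 0 < e \<Longrightarrow> e \<le> 1 \<Longrightarrow>
    \<bar>\<alpha> * bump \<tau> - e * bump_deriv \<tau>\<bar> powr p - \<alpha> powr p * bump \<tau> powr p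
      + p * \<alpha> powr (p - 1) * e * (bump \<tau> powr (p - 1) * bump_deriv \<tau>) \<le> C * e\<^sup>2"
proof -
  obtain C1 where C1: "C1 > 0" and rem: "\<And>\<theta>::real. \<bar>1 + \<theta>\<bar> powr p - 1 - p * \<theta> \<le> C1 * \<theta>\<^sup>2 * (1 + \<bar>\<theta>\<bar>) powr p"
    by (fact abs_powr_second_order_remainder[OF p])
  obtain C2 where C2: "C2 > 0" and dom: "\<And>w::real. w \<ge> 0 \<Longrightarrow> exp (- p * w) * w ^ 4 * (1 + w\<^sup>2 / \<alpha>) powr p \<le> C2"
    by (fact exp_dominates_polynomial[OF p \<alpha>])
  define C where "C = \<alpha> powr p * C1 / \<alpha>\<^sup>2 * C2"
  have C: "C > 0" using C1 C2 \<alpha> by (simp add: C_def)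
  have "\<bar>\<alpha> * bump \<tau> - e * bump_deriv \<tau>\<bar> powr p - \<alpha> powr p * bump \<tau> powr p
      + p * \<alpha> powr (p - 1) * e * (bump \<tau> powr (p - 1) * bump_deriv \<tau>) \<le> C * e\<^sup>2"
    if e: "0 < e" "e \<le> 1" for \<tau> e
  proof (cases "1 < \<tau> \<and> \<tau> < 3")
    case False
    then show ?thesis using bump_outside[OF False] C p by simp
  next
    case True
    define w where "w = 1 / (\<tau> - 1) + 1 / (3 - \<tau>)"
    define g where "g = bump \<tau>"
    define a where "a = \<alpha> * g"
    define \<theta> where "\<theta> = - (e * bump_deriv \<tau>) / a"
    note w = bump_log_derivative[of \<tau>, folded w_def g_def]
    have g: "g > 0" using w(2) True by simp
    have a: "a > 0" using g \<alpha> by (simp add: a_def)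
    have \<theta>: "\<bar>\<theta>\<bar> \<le> e * (w\<^sup>2 / \<alpha>)"
    proof -
      have "\<bar>\<theta>\<bar> = e * \<bar>bump_deriv \<tau>\<bar> / a" using e a by (simp add: \<theta>_def abs_mult)
      also have "\<dots> \<le> e * (g * w\<^sup>2) / a"
        using e a w(3) True by (intro divide_right_mono mult_left_mono) auto
      also have "\<dots> = e * (w\<^sup>2 / \<alpha>)" using g \<alpha> by (simp add: a_def)
      finally show ?thesis .
    qed
    have e1: "\<alpha> * g - e * bump_deriv \<tau> = a * (1 + \<theta>)"
    proof -
      have "a * \<theta> = - (e * bump_deriv \<tau>)" using a by (simp add: \<theta>_def)
      then show ?thesis by (simp add: distrib_left) (simp add: a_def)
    qed
    have e2: "p * \<alpha> powr (p - 1) * e * (g powr (p - 1) * bump_deriv \<tau>) = - (a powr p * (p * \<theta>))"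
    proof -
      have "a powr p = a powr (p - 1) * a" using a by (simp add: powr_diff)
      then have "a powr p * (p * \<theta>) = - (p * a powr (p - 1) * e * bump_deriv \<tau>)"
        using a by (simp add: \<theta>_def)
      then show ?thesis by (simp add: a_def powr_mult mult_ac)
    qed
    have "\<bar>\<alpha> * g - e * bump_deriv \<tau>\<bar> powr p - \<alpha> powr p * g powr p
      + p * \<alpha> powr (p - 1) * e * (g powr (p - 1) * bump_deriv \<tau>)
      = a powr p * (\<bar>1 + \<theta>\<bar> powr p - 1 - p * \<theta>)"
    proof -
      have "\<bar>a * (1 + \<theta>)\<bar> powr p = a powr p * \<bar>1 + \<theta>\<bar> powr p"
        using a by (simp add: abs_mult powr_mult)
      moreover have "\<alpha> powr p * g powr p = a powr p" by (simp add: a_def powr_mult)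
      ultimately show ?thesis unfolding e1 e2 by (simp only: right_diff_distrib)
    qed
    also have "\<dots> \<le> a powr p * (C1 * \<theta>\<^sup>2 * (1 + \<bar>\<theta>\<bar>) powr p)"
      using rem by (intro mult_left_mono) auto
    also have "\<dots> \<le> a powr p * (C1 * (e * (w\<^sup>2 / \<alpha>))\<^sup>2 * (1 + w\<^sup>2 / \<alpha>) powr p)"
    proof (intro mult_left_mono mult_mono powr_mono2)
      show "\<theta>\<^sup>2 \<le> (e * (w\<^sup>2 / \<alpha>))\<^sup>2" using \<theta> by (metis abs_ge_zero power2_abs power_mono)
      have "e * (w\<^sup>2 / \<alpha>) \<le> 1 * (w\<^sup>2 / \<alpha>)" using e \<alpha> by (intro mult_right_mono) auto
      then show "1 + \<bar>\<theta>\<bar> \<le> 1 + w\<^sup>2 / \<alpha>" using \<theta> by linarith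
    qed (use C1 p in auto)
    also have "\<dots> = \<alpha> powr p * C1 / \<alpha>\<^sup>2 * e\<^sup>2 * (exp (- p * w) * w ^ 4 * (1 + w\<^sup>2 / \<alpha>) powr p)"
    proof -
      have "g powr p = exp (- p * w)" using w(2) True by (simp add: exp_powr_real)
      then show ?thesis by (simp add: a_def powr_mult power_mult_distrib power_divide)
    qed
    also have "\<alpha> powr p * C1 / \<alpha>\<^sup>2 * e\<^sup>2 * (exp (- p * w) * w ^ 4 * (1 + w\<^sup>2 / \<alpha>) powr p)
        \<le> \<alpha> powr p * C1 / \<alpha>\<^sup>2 * e\<^sup>2 * C2"
      using w(1) True C1 \<alpha> by (intro mult_left_mono dom) auto
    also have "\<dots> = C * e\<^sup>2" by (simp add: C_def)
    finally show ?thesis by (simp only: g_def)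
  qed
  then show thesis using that[OF C] by blast
qed

section \<open>Optimality of the exponent\<close>

text \<open>
  The solution \<open>|x|\<^sup>\<alpha>\<close> of the Euler equation of Hardy's inequality, cut off on the logarithmic scale to the shell
  \<open>exp (- 3L) \<le> |x| \<le> exp (- L)\<close>.
\<close>

definition hardy_test :: "real \<Rightarrow> nat \<Rightarrow> real ^ 'n::finite \<Rightarrow> real" where
  "hardy_test \<alpha> L x = norm x powr \<alpha> * bump (- ln (norm x) / real L)"

lemma bump_shell:
  assumes L: "L > 0" and r: "r > 0" and out: "\<not> (exp (- 3 * real L) \<le> r \<and> r \<le> exp (- real L))"
  shows "bump (- ln r / real L) = 0 \<and> bump_deriv (- ln r / real L) = 0"
proof (rule bump_outside, rule notI)
  assume "1 < - ln r / real L \<and> - ln r / real L < 3"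
  then have "ln r < - real L" "- 3 * real L < ln r" using L by (auto simp: field_simps)
  then have "exp (ln r) < exp (- real L)" "exp (- 3 * real L) < exp (ln r)"
    by (simp_all only: exp_less_mono)
  then show False using out r by simp
qed

lemma compact_shell: "compact {x :: 'a::euclidean_space. a \<le> norm x \<and> norm x \<le> b}"
proof -
  have "closed {x :: 'a. a \<le> norm x \<and> norm x \<le> b}"
    by (intro closed_Collect_conj closed_Collect_le continuous_intros)
  moreover have "bounded {x :: 'a. a \<le> norm x \<and> norm x \<le> b}"
    by (rule bounded_subset[OF bounded_cball[of 0 b]]) auto
  ultimately show ?thesis by (simp add: compact_eq_bounded_closed)
qed

text \<open>
  Away from the origin, \<open>ln |x| = ln (x \<cdot> x) / 2\<close> exhibits the test function as a product of functions of one
  variable composed with a smooth function of \<open>x\<close>.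
\<close>

lemma hardy_test_smooth:
  assumes L: "L > 0" and S: "open S" "0 \<notin> S"
  shows "Ck_on k S (hardy_test \<alpha> L :: real ^ 'n::finite \<Rightarrow> real)"
proof -
  define l where "l = (\<lambda>x :: real ^ 'n. ln (x \<bullet> x))"
  have l: "Ck_on k S l"
    using Ck_on_compose[OF S(1) all_derivs_ln _ Ck_on_inner_self[OF S(1)], of k 0] S(2)
    by (auto simp: l_def)
  have lin: "Ck_on k S (\<lambda>x. c * l x + d)" for c d
    by (intro Ck_on_add Ck_on_mult Ck_on_const l S)
  have e: "Ck_on k S (\<lambda>x. exp (\<alpha> / 2 * l x + 0))"
    by (rule Ck_on_compose[OF S(1) all_derivs_exp _ lin]) auto
  have f: "Ck_on k S (\<lambda>x. flat 1 (c * l x + d))" for c d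
    using Ck_on_compose[OF S(1) all_derivs_flat[of 1] _ lin[of c d], where m = 0] by simp
  have smooth: "Ck_on k S (\<lambda>x. exp (\<alpha> / 2 * l x + 0) *
      (flat 1 (- 1 / (2 * real L) * l x + - 1) * flat 1 (1 / (2 * real L) * l x + 3)))"
    by (intro Ck_on_mult e f S)
  have eq: "exp (\<alpha> / 2 * l x + 0) *
      (flat 1 (- 1 / (2 * real L) * l x + - 1) * flat 1 (1 / (2 * real L) * l x + 3)) = hardy_test \<alpha> L x"
    if "x \<in> S" for x
  proof -
    have x: "x \<noteq> 0" using that S(2) by auto
    have "l x = 2 * ln (norm x)"
      using x by (simp add: l_def power2_norm_eq_inner[symmetric] ln_realpow)
    then have e1: "\<alpha> / 2 * l x + 0 = \<alpha> * ln (norm x)"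
      and e2: "- 1 / (2 * real L) * l x + - 1 = - ln (norm x) / real L - 1"
      and e3: "1 / (2 * real L) * l x + 3 = 3 - - ln (norm x) / real L"
      by simp_all
    have "exp (\<alpha> * ln (norm x)) = norm x powr \<alpha>" using x by (simp add: powr_def)
    then show ?thesis unfolding e1 e2 e3 hardy_test_def bump_def by (rule arg_cong)
  qed
  show ?thesis by (rule iffD1[OF Ck_on_cong[OF S(1) eq] smooth])
qed

lemma hardy_test_Cc_infinity:
  fixes \<Omega> :: "(real ^ 'n::finite) set"
  assumes L: "L > 0" and \<Omega>: "open \<Omega>" "cball 0 (exp (- real L)) \<subseteq> \<Omega>"
  shows "hardy_test \<alpha> L \<in> Cc_infinity (\<Omega> - {0})"
proof -
  let ?K = "{x :: real ^ 'n. exp (- 3 * real L) \<le> norm x \<and> norm x \<le> exp (- real L)}"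
  have supp: "{x. hardy_test \<alpha> L x \<noteq> 0} \<subseteq> ?K"
  proof
    fix x :: "real ^ 'n" assume "x \<in> {x. hardy_test \<alpha> L x \<noteq> 0}"
    then have "norm x > 0" "bump (- ln (norm x) / real L) \<noteq> 0" by (auto simp: hardy_test_def)
    then show "x \<in> ?K" using bump_shell[OF L] by blast
  qed
  have cl: "closure {x. hardy_test \<alpha> L x \<noteq> 0} \<subseteq> ?K"
    by (rule closure_minimal[OF supp compact_imp_closed[OF compact_shell]])
  moreover have "?K \<subseteq> \<Omega> - {0}" using \<Omega>(2) by (auto simp: not_le)
  moreover have "compact (closure {x :: real ^ 'n. hardy_test \<alpha> L x \<noteq> 0})"
  proof -
    have "compact (?K \<inter> closure {x :: real ^ 'n. hardy_test \<alpha> L x \<noteq> 0})"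
      by (rule compact_Int_closed[OF compact_shell closed_closure])
    then show ?thesis by (simp only: Int_absorb1[OF cl])
  qed
  moreover have "Ck_on k (\<Omega> - {0}) (hardy_test \<alpha> L)" for k
    by (rule hardy_test_smooth[OF L]) (use \<Omega> in auto)
  ultimately show ?thesis unfolding Cc_infinity_def by blast
qed

lemma gradient_hardy_test:
  fixes x :: "real ^ 'n::finite"
  assumes x: "x \<noteq> 0" and L: "L > 0"
  shows "norm (gradient (hardy_test \<alpha> L) x)
    = norm x powr (\<alpha> - 1) * \<bar>\<alpha> * bump (- ln (norm x) / real L) - 1 / real L * bump_deriv (- ln (norm x) / real L)\<bar>"
proof -
  define \<rho> where "\<rho> = norm x"
  define d where "d = \<rho> powr (\<alpha> - 1) * (\<alpha> * bump (- ln \<rho> / real L) - 1 / real L * bump_deriv (- ln \<rho> / real L))"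
  have \<rho>: "\<rho> > 0" using x by (simp add: \<rho>_def)
  have d1: "((\<lambda>\<rho>. - ln \<rho> / real L) has_real_derivative - (1 / \<rho>) / real L) (at \<rho>)"
    using \<rho> L by (auto intro!: derivative_eq_intros)
  have d2: "((\<lambda>\<rho>. bump (- ln \<rho> / real L)) has_real_derivative
      bump_deriv (- ln \<rho> / real L) * (- (1 / \<rho>) / real L)) (at \<rho>)"
    by (rule DERIV_chain2[OF has_real_derivative_bump d1])
  have "((\<lambda>\<rho>. \<rho> powr \<alpha> * bump (- ln \<rho> / real L)) has_real_derivative d) (at \<rho>)"
    by (rule DERIV_cong[OF DERIV_mult[OF has_real_derivative_powr[OF \<rho>] d2]])
      (use \<rho> in \<open>simp add: d_def powr_diff right_diff_distrib mult_ac\<close>)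
  then have "((\<lambda>\<rho>. \<rho> powr \<alpha> * bump (- ln \<rho> / real L)) has_derivative (*) d) (at (norm x))"
    by (simp add: has_field_derivative_def \<rho>_def)
  from has_derivative_compose[OF has_derivative_norm[OF x] this]
  have "(hardy_test \<alpha> L has_derivative (\<lambda>v. d * (v \<bullet> sgn x))) (at x)"
    by (simp add: hardy_test_def[abs_def])
  also have "(\<lambda>v. d * (v \<bullet> sgn x)) = (\<lambda>v. (d *\<^sub>R sgn x) \<bullet> v)"
    by (simp add: inner_commute)
  finally have "gradient (hardy_test \<alpha> L) x = d *\<^sub>R sgn x" by (rule gradient_eq)
  then show ?thesis using x by (simp add: d_def \<rho>_def norm_sgn abs_mult)
qed

text \<open>
  The measure \<open>|x|\<^bsup>-n\<^esup> dx\<close> is invariant under dilations, so each shell \<open>exp (- j - 1) \<le> |x| \<le> exp (- j)\<close> contributes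
  the same amount. The majorant is a sum of constants on cubes that contain the outer balls of these shells.
\<close>

lemma shell_integral_majorant:
  fixes L :: nat
  obtains h :: "real ^ 'n::finite \<Rightarrow> real" where
    "(h has_integral (3 * real L + 1) * (2 * exp 1) powr real CARD('n)) UNIV"
    "\<And>x. h x \<ge> 0"
    "\<And>x. exp (- 3 * real L) \<le> norm x \<Longrightarrow> norm x \<le> 1 \<Longrightarrow> norm x powr (- real CARD('n)) \<le> h x"
proof -
  define n where "n = real CARD('n)"
  define Q where "Q = (\<lambda>j::nat. cbox (0 - exp (- real j) *\<^sub>R One) (0 + exp (- real j) *\<^sub>R One) :: (real ^ 'n) set)"
  define h where "h = (\<lambda>x. \<Sum>j\<le>3 * L. if x \<in> Q j then exp (n * (real j + 1)) else 0)"
  have "(h has_integral (\<Sum>j\<le>3 * L. (2 * exp 1) powr n)) UNIV"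
    unfolding h_def
  proof (intro has_integral_sum)
    fix j
    have "((\<lambda>x. exp (n * (real j + 1))) has_integral measure lborel (Q j) *\<^sub>R exp (n * (real j + 1))) (Q j)"
      unfolding Q_def by (rule has_integral_const)
    moreover have "measure lborel (Q j) = (2 * exp (- real j)) powr n"
      unfolding Q_def n_def by (rule cube_properties(1)) simp
    moreover have "(2 * exp (- real j)) powr n * exp (n * (real j + 1)) = (2 * exp 1) powr n"
      by (simp add: powr_mult exp_powr_real exp_add[symmetric] algebra_simps)
    ultimately have "((\<lambda>x. exp (n * (real j + 1))) has_integral (2 * exp 1) powr n) (Q j)"
      by simp
    then show "((\<lambda>x. if x \<in> Q j then exp (n * (real j + 1)) else 0) has_integral (2 * exp 1) powr n) UNIV"
      by (simp only: has_integral_restrict_UNIV)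
  qed simp
  then have "(h has_integral (3 * real L + 1) * (2 * exp 1) powr n) UNIV"
    by (simp add: algebra_simps)
  moreover have "h x \<ge> 0" for x unfolding h_def by (intro sum_nonneg) auto
  moreover have "norm x powr (- n) \<le> h x" if x: "exp (- 3 * real L) \<le> norm x" "norm x \<le> 1" for x
  proof -
    define s where "s = - ln (norm x)"
    define j where "j = nat \<lfloor>s\<rfloor>"
    have nx: "norm x > 0" using x(1) by (rule less_le_trans[rotated]) simp
    have s0: "s \<ge> 0" using x nx by (simp add: s_def)
    have "- 3 * real L \<le> ln (norm x)" using x(1) nx by (simp add: ln_ge_iff)
    then have s3: "s \<le> 3 * real L" by (simp add: s_def)
    have nxs: "norm x = exp (- s)" using nx by (simp add: s_def)
    have j: "real j \<le> s" "s < real j + 1" using s0 by (auto simp: j_def)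
    have "real j \<le> real (3 * L)" using j s3 by simp
    then have jL: "j \<le> 3 * L" by (simp only: of_nat_le_iff)
    have xQ: "x \<in> Q j" unfolding Q_def using j nxs by (intro cube_properties(3)) auto
    have "norm x powr (- n) = exp (n * s)" by (simp add: nxs exp_powr_real mult.commute)
    also have "\<dots> \<le> exp (n * (real j + 1))" using j by (simp add: n_def mult_left_mono)
    also have "\<dots> = (if x \<in> Q j then exp (n * (real j + 1)) else 0)" using xQ by simp
    also have "\<dots> \<le> h x" unfolding h_def
      by (rule member_le_sum) (use jL in auto)
    finally show ?thesis .
  qed
  ultimately show thesis using that[of h] by (simp add: n_def)
qed

text \<open>
  The first-order term of the energy density in \<open>1/L\<close> is a divergence: for
  \<open>F = |x|\<^bsup>-n\<^esup> g(- ln |x| / L)\<^sup>p\<close> with radial derivative \<open>D\<close> it is \<open>\<alpha>\<^bsup>p-1\<^esup> (D + n F)\<close>, whose integral vanishes. What is left is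
  \<open>bump_energy_density_bound\<close> with \<open>e = 1/L\<close>, integrated over a shell of logarithmic width \<open>2L\<close>.
\<close>

lemma hardy_test_energy:
  fixes p :: real
  assumes p: "p > real CARD('n::finite)"
  obtains C where "C > 0" and "\<And>(\<Omega> :: (real ^ 'n) set) L. open \<Omega> \<Longrightarrow> L > 0 \<Longrightarrow>
      cball 0 (exp (- real L)) \<subseteq> \<Omega> \<Longrightarrow>
      hardy_difference p \<Omega> (hardy_test (1 - real CARD('n) / p) L) \<le> C / real L"
proof -
  define n where "n = real CARD('n)"
  define \<alpha> where "\<alpha> = 1 - n / p"
  have n1: "n \<ge> 1" by (simp add: n_def Suc_leI)
  have p1: "p > 1" using p n1 unfolding n_def by linarith
  have \<alpha>: "\<alpha> > 0" using p p1 by (simp add: \<alpha>_def n_def)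
  have \<alpha>': "(p - n) / p = \<alpha>" using p1 by (simp add: \<alpha>_def field_simps)
  obtain C0 where C0: "C0 > 0" and dens: "\<And>\<tau> e. 0 < e \<Longrightarrow> e \<le> 1 \<Longrightarrow>
    \<bar>\<alpha> * bump \<tau> - e * bump_deriv \<tau>\<bar> powr p - \<alpha> powr p * bump \<tau> powr p
      + p * \<alpha> powr (p - 1) * e * (bump \<tau> powr (p - 1) * bump_deriv \<tau>) \<le> C0 * e\<^sup>2"
    by (fact bump_energy_density_bound[OF p1 \<alpha>])
  define C where "C = C0 * (4 * (2 * exp 1) powr n)"
  have C: "C > 0" using C0 by (simp add: C_def)
  have "hardy_difference p \<Omega> (hardy_test \<alpha> L) \<le> C / real L"
    if \<Omega>: "open \<Omega>" and L: "L > 0" and ball: "cball 0 (exp (- real L)) \<subseteq> \<Omega>"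
    for \<Omega> :: "(real ^ 'n) set" and L
  proof -
    define u where "u = (hardy_test \<alpha> L :: real ^ 'n \<Rightarrow> real)"
    define K where "K = {x :: real ^ 'n. exp (- 3 * real L) \<le> norm x \<and> norm x \<le> exp (- real L)}"
    define e where "e = 1 / real L"
    define T where "T = (\<lambda>x :: real ^ 'n. - ln (norm x) / real L)"
    have e: "0 < e" "e \<le> 1" using L by (auto simp: e_def)
    have uC: "u \<in> Cc_infinity (\<Omega> - {0})"
      unfolding u_def by (rule hardy_test_Cc_infinity[OF L \<Omega> ball])
    have K0: "0 \<notin> K" by (simp add: K_def not_le)
    have Kcl: "closed K" unfolding K_def by (rule compact_imp_closed[OF compact_shell])
    have S: "open (\<Omega> - {0})" "open (- {0} :: (real ^ 'n) set)" using \<Omega> by auto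
    have outside: "bump (T x) = 0 \<and> bump_deriv (T x) = 0" if "x \<notin> K" "x \<noteq> 0" for x
      using bump_shell[OF L, of "norm x"] that by (auto simp: T_def K_def)
    have p0: "p > 0" "p - 1 > 0" using p1 by simp_all
    define V where "V = (\<lambda>x. norm (gradient u x) powr p)"
    define W where "W = (\<lambda>x. (\<bar>u x\<bar> / norm x) powr p)"
    define F where "F = (\<lambda>x :: real ^ 'n. norm x powr (- n) * bump (T x) powr p)"
    define D where "D = (\<lambda>x :: real ^ 'n. norm x powr (- n) *
      (- n * bump (T x) powr p - p * e * (bump (T x) powr (p - 1) * bump_deriv (T x))))"
    have contT: "continuous_on (- {0}) T"
      unfolding T_def using L by (intro continuous_intros) auto
    have cb: "continuous_on (- {0}) (\<lambda>x. bump (T x))" "continuous_on (- {0}) (\<lambda>x. bump_deriv (T x))"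
      by (rule continuous_on_compose2[OF continuous_on_bump[of UNIV] contT] 
               continuous_on_compose2[OF continuous_on_bump_deriv[of UNIV] contT]; simp)+
    have cbp: "continuous_on (- {0}) (\<lambda>x. bump (T x) powr q)" if "q > 0" for q
      using that by (intro continuous_on_powr' cb continuous_intros) (auto simp: bump_nonneg)
    have cn: "continuous_on (- {0}) (\<lambda>x :: real ^ 'n. norm x powr (- n))"
      by (intro continuous_intros) auto
    have F0: "F x = 0" "D x = 0" if "x \<notin> K" for x
      using outside[OF that] p0 by (cases "x = 0"; simp add: F_def D_def)+
    have contF: "continuous_on UNIV F"
    proof (rule continuous_on_zero_extension[OF S(2) Kcl])
      show "continuous_on (- {0}) F" unfolding F_def by (intro continuous_on_mult cn cbp p0)
    qed (use K0 F0 in auto)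
    have contD: "continuous_on UNIV D"
    proof (rule continuous_on_zero_extension[OF S(2) Kcl])
      show "continuous_on (- {0}) D" unfolding D_def
        by (intro continuous_on_mult continuous_on_diff continuous_on_const cn cb cbp p0)
    qed (use K0 F0 in auto)
    have suppF: "F x = 0" if "norm x > exp (- real L)" for x
      using F0(1)[of x] that by (simp add: K_def)
    have derF: "((\<lambda>s. F (s *\<^sub>R x)) has_real_derivative D x) (at 1)" for x
    proof (cases "x = 0")
      case True
      then show ?thesis by (simp add: F_def D_def)
    next
      case False
      define \<rho> where "\<rho> = norm x"
      have \<rho>: "\<rho> > 0" using False by (simp add: \<rho>_def)
      have t: "T x = - ln \<rho> / real L" by (simp add: T_def \<rho>_def)
      have d1: "((\<lambda>s. - ln (s * \<rho>) / real L) has_real_derivative - e) (at 1)"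
        using \<rho> L by (auto intro!: derivative_eq_intros simp: e_def)
      have "(bump has_real_derivative bump_deriv (T x)) (at (- ln (1 * \<rho>) / real L))"
        using has_real_derivative_bump[of "T x"] by (simp add: t)
      from DERIV_chain2[OF this d1]
      have d2: "((\<lambda>s. bump (- ln (s * \<rho>) / real L)) has_real_derivative bump_deriv (T x) * - e) (at 1)" .
      have "((\<lambda>y. \<bar>y\<bar> powr p) has_real_derivative p * (sgn (bump (T x)) * \<bar>bump (T x)\<bar> powr (p - 1)))
          (at (bump (- ln (1 * \<rho>) / real L)))"
        using has_real_derivative_abs_powr[OF p1, of "bump (T x)"] by (simp add: t)
      from DERIV_chain2[OF this d2]
      have d3: "((\<lambda>s. \<bar>bump (- ln (s * \<rho>) / real L)\<bar> powr p) has_real_derivative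
          p * (sgn (bump (T x)) * \<bar>bump (T x)\<bar> powr (p - 1)) * (bump_deriv (T x) * - e)) (at 1)" .
      have sg: "sgn (bump (T x)) * \<bar>bump (T x)\<bar> powr (p - 1) = bump (T x) powr (p - 1)"
        using bump_nonneg[of "T x"] by (simp add: sgn_if)
      have d4: "((\<lambda>s. (s * \<rho>) powr (- n)) has_real_derivative - n * \<rho> powr (- n)) (at 1)"
        using \<rho> by (auto intro!: derivative_eq_intros simp: powr_diff)
      have "((\<lambda>s. (s * \<rho>) powr (- n) * \<bar>bump (- ln (s * \<rho>) / real L)\<bar> powr p)
          has_real_derivative D x) (at 1)"
        by (rule DERIV_cong[OF DERIV_mult[OF d4 d3[unfolded sg]]])
          (use bump_nonneg[of "T x"] in \<open>simp add: D_def t \<rho>_def algebra_simps\<close>)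
      then show ?thesis
        by (rule has_field_derivative_transform_within_open[where S = "{0<..}"])
          (auto simp: F_def T_def \<rho>_def bump_nonneg)
    qed
    note scaling = integral_scaling_identity[OF contF contD suppF derF]
    have intF: "F integrable_on UNIV"
      by (rule continuous_bounded_support_integrable[OF contF suppF])
    note hd = hardy_difference_eq_integral[OF \<Omega> uC p0(1), folded V_def W_def n_def, unfolded \<alpha>']
    define b where "b = \<alpha> powr (p - 1)"
    define Z where "Z = (\<lambda>x. V x - \<alpha> powr p * W x - b * (D x + n * F x))"
    have i1: "(\<lambda>x. V x - \<alpha> powr p * W x) integrable_on UNIV"
      using hd(3,4) by (intro integrable_diff integrable_on_mult_right)
    have i2: "(\<lambda>x. D x + n * F x) integrable_on UNIV"
      using scaling(1) intF by (intro integrable_add integrable_on_mult_right)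
    have intZ: "Z integrable_on UNIV"
      unfolding Z_def by (rule integrable_diff[OF i1 integrable_on_mult_right[OF i2]])
    have "integral UNIV (\<lambda>x. D x + n * F x) = integral UNIV D + n * integral UNIV F"
      using integral_add[OF scaling(1) integrable_on_mult_right[OF intF, of n]] by simp
    then have zero: "integral UNIV (\<lambda>x. D x + n * F x) = 0"
      using scaling(2) by (simp add: n_def)
    have hdZ: "hardy_difference p \<Omega> u = integral UNIV Z"
    proof -
      have "integral UNIV Z = integral UNIV (\<lambda>x. V x - \<alpha> powr p * W x) - b * integral UNIV (\<lambda>x. D x + n * F x)"
        unfolding Z_def using integral_diff[OF i1 integrable_on_mult_right[OF i2, of b]] by simp
      also have "integral UNIV (\<lambda>x. V x - \<alpha> powr p * W x) = integral UNIV V - \<alpha> powr p * integral UNIV W"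
        using integral_diff[OF hd(3) integrable_on_mult_right[OF hd(4), of "\<alpha> powr p"]] by simp
      finally show ?thesis using hd(5) zero by simp
    qed
    have Zform: "Z x = norm x powr (- n) * (\<bar>\<alpha> * bump (T x) - e * bump_deriv (T x)\<bar> powr p - \<alpha> powr p * bump (T x) powr p
      + p * b * e * (bump (T x) powr (p - 1) * bump_deriv (T x)))" if "x \<noteq> 0" for x
    proof -
      have x: "norm x > 0" using that by simp
      have ap: "(\<alpha> - 1) * p = - n" using p0 by (simp add: \<alpha>_def field_simps)
      have pw: "(norm x powr (\<alpha> - 1)) powr p = norm x powr (- n)" by (simp add: powr_powr ap)
      have V: "V x = norm x powr (- n) * \<bar>\<alpha> * bump (T x) - e * bump_deriv (T x)\<bar> powr p"
        unfolding V_def u_def gradient_hardy_test[OF that L] powr_mult pw by (simp add: T_def e_def)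
      have "\<bar>u x\<bar> / norm x = norm x powr (\<alpha> - 1) * bump (T x)"
        using x bump_nonneg[of "T x"] by (simp add: u_def hardy_test_def T_def abs_mult powr_diff)
      then have W: "W x = norm x powr (- n) * bump (T x) powr p"
        unfolding W_def by (simp only: powr_mult pw)
      show ?thesis unfolding Z_def V W D_def F_def by (simp add: algebra_simps)
    qed
    obtain h :: "real ^ 'n \<Rightarrow> real" where h: "(h has_integral (3 * real L + 1) * (2 * exp 1) powr n) UNIV"
      "\<And>x. h x \<ge> 0"
      "\<And>x. exp (- 3 * real L) \<le> norm x \<Longrightarrow> norm x \<le> 1 \<Longrightarrow> norm x powr (- n) \<le> h x"
      unfolding n_def by (fact shell_integral_majorant)
    have Zh: "Z x \<le> C0 * e\<^sup>2 * h x" for x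
    proof (cases "x \<in> K")
      case True
      then have x0: "x \<noteq> 0" using K0 by auto
      have "norm x \<le> exp (- real L)" using True by (simp add: K_def)
      also have "\<dots> \<le> 1" by simp
      finally have x1: "norm x \<le> 1" .
      have "Z x \<le> norm x powr (- n) * (C0 * e\<^sup>2)"
        unfolding Zform[OF x0] b_def using e by (intro mult_left_mono dens) auto
      also have "\<dots> \<le> h x * (C0 * e\<^sup>2)"
        using C0 True x1 by (intro mult_right_mono h(3)) (auto simp: K_def)
      finally show ?thesis by (simp add: mult.commute)
    next
      case False
      have "Z x = 0"
      proof (cases "x = 0")
        case True
        obtain K' where K': "K' \<subseteq> \<Omega> - {0}" "\<And>x. x \<notin> K' \<Longrightarrow> u x = 0" "\<And>x. x \<notin> K' \<Longrightarrow> gradient u x = 0"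
          using Cc_infinity_props[OF S(1) uC] by metis
        have "0 \<notin> K'" using K'(1) by auto
        then show ?thesis using K' True F0[OF K0] by (simp add: Z_def V_def W_def)
      next
        case nz: False
        then show ?thesis using Zform[OF nz] outside[OF False nz] p0 by simp
      qed
      then show ?thesis using C0 h(2) by simp
    qed
    have "integral UNIV Z \<le> integral UNIV (\<lambda>x. C0 * e\<^sup>2 * h x)"
      using h(1) by (intro integral_le intZ integrable_on_mult_right Zh) auto
    also have "\<dots> = C0 * e\<^sup>2 * ((3 * real L + 1) * (2 * exp 1) powr n)"
      using integral_unique[OF h(1)] by simp
    also have "\<dots> \<le> C0 * e\<^sup>2 * ((4 * real L) * (2 * exp 1) powr n)"
      using C0 L by (intro mult_left_mono mult_right_mono) auto
    also have "\<dots> = C / real L" using L by (simp add: C_def e_def power2_eq_square field_simps)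
    finally show ?thesis using hdZ by (simp add: u_def)
  qed
  then show thesis using that[OF C] by (simp add: \<alpha>_def n_def)
qed

text \<open>
  A test function with \<open>L\<close> large violates the inequality at the pair \<open>x\<close>, \<open>0\<close> with \<open>|x| = exp (- 2L)\<close>, the
  logarithmic centre of its support.
\<close>

lemma log_power_optimal:
  fixes p \<gamma> :: real and \<Omega> :: "(real ^ 'n::finite) set"
  assumes p: "p > real CARD('n)" and \<Omega>: "open \<Omega>" "bounded \<Omega>" "0 \<in> \<Omega>" and \<gamma>: "\<gamma> < 1 / p"
    and B: "B \<ge> 1" and C: "C > 0"
  shows "\<exists>u \<in> Cc_infinity (\<Omega> - {0}).
    \<not> weighted_holder_sup p \<gamma> (B * diameter \<Omega>) \<Omega> u \<le> ereal (C * hardy_difference p \<Omega> u powr (1 / p))"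
proof (rule ccontr)
  assume neg: "\<not> ?thesis"
  define n where "n = real CARD('n)"
  define \<alpha> where "\<alpha> = 1 - n / p"
  define D where "D = B * diameter \<Omega>"
  have n1: "n \<ge> 1" by (simp add: n_def Suc_leI)
  have p1: "p > 1" using p n1 unfolding n_def by linarith
  obtain C' where C': "C' > 0" and energy: "\<And>(\<Omega> :: (real ^ 'n) set) L. open \<Omega> \<Longrightarrow> L > 0 \<Longrightarrow>
      cball 0 (exp (- real L)) \<subseteq> \<Omega> \<Longrightarrow> hardy_difference p \<Omega> (hardy_test \<alpha> L) \<le> C' / real L"
    unfolding \<alpha>_def n_def by (fact hardy_test_energy[OF p])
  obtain r where r: "r > 0" "cball 0 r \<subseteq> \<Omega>" using \<Omega> open_contains_cball by blast
  define y where "y = (axis undefined 1 :: real ^ 'n)"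
  have y: "norm y = 1" by (simp add: y_def)
  have D0: "D > 0"
  proof -
    have "r *\<^sub>R y \<in> \<Omega>" using r y by auto
    from diameter_bounded_bound[OF \<Omega>(2) this \<Omega>(3)] have "diameter \<Omega> > 0" using r y by simp
    then show ?thesis using B by (simp add: D_def)
  qed
  have lower: "exp (- 2) * (1 + 2 * real L + ln D) powr (- \<gamma>) \<le> C * (C' / real L) powr (1 / p)"
    if L: "L > 0" and Lr: "exp (- real L) \<le> r" and pos: "1 + 2 * real L + ln D > 0" for L
  proof -
    define u where "u = (hardy_test \<alpha> L :: real ^ 'n \<Rightarrow> real)"
    define x where "x = exp (- 2 * real L) *\<^sub>R y"
    have ball: "cball 0 (exp (- real L)) \<subseteq> \<Omega>" using Lr r(2) by (auto simp: subset_eq)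
    have u: "u \<in> Cc_infinity (\<Omega> - {0})" unfolding u_def by (rule hardy_test_Cc_infinity[OF L \<Omega>(1) ball])
    have nx: "norm x = exp (- 2 * real L)" by (simp add: x_def y)
    have x0: "x \<noteq> 0" using nx by auto
    have "exp (- 2 * real L) \<le> exp (- real L)" by simp
    then have "x \<in> cball 0 (exp (- real L))" using nx by simp
    then have x\<Omega>: "x \<in> \<Omega>" using ball by auto
    have "bump 2 = exp (- 2)" using bump_log_derivative(2)[of 2] by simp
    then have ux: "u x = norm x powr \<alpha> * exp (- 2)"
      using L by (simp add: u_def hardy_test_def nx)
    have u0: "u 0 = 0" by (simp add: u_def hardy_test_def)
    have XX: "X (norm (x - 0) / D) = inverse (1 + 2 * real L + ln D)"
      using D0 by (simp add: X_def nx ln_div)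
    have "ereal (\<bar>u x - u 0\<bar> / norm (x - 0) powr (1 - real CARD('n) / p) * X (norm (x - 0) / D) powr \<gamma>)
        \<le> weighted_holder_sup p \<gamma> D \<Omega> u"
      unfolding weighted_holder_sup_def
      by (rule SUP_upper2[of "(x, 0)"]) (use x\<Omega> \<Omega> x0 in auto)
    also have "\<dots> \<le> ereal (C * hardy_difference p \<Omega> u powr (1 / p))"
      using neg u unfolding D_def by blast
    finally have "\<bar>u x - u 0\<bar> / norm x powr \<alpha> * X (norm (x - 0) / D) powr \<gamma>
        \<le> C * hardy_difference p \<Omega> u powr (1 / p)"
      by (simp add: \<alpha>_def n_def)
    also have "\<dots> \<le> C * (C' / real L) powr (1 / p)"
      using hardy_difference_nonneg[OF p u \<Omega>] energy[OF \<Omega>(1) L ball] C p1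
      unfolding u_def by (intro mult_left_mono powr_mono2) auto
    also have "\<bar>u x - u 0\<bar> / norm x powr \<alpha> = exp (- 2)"
      using x0 by (simp add: ux u0 abs_mult)
    finally show ?thesis using pos unfolding XX by (simp add: powr_minus inverse_powr)
  qed
  \<comment> \<open>The quotient of the two sides of \<open>lower\<close>, up to a constant factor, after extracting a power
    of \<open>L\<close> from \<open>1 + 2L + ln D\<close>.\<close>
  have "filterlim (\<lambda>L. real L powr (1 / p - \<gamma>) * ((1 + ln D) / real L + 2) powr (- \<gamma>)) at_top sequentially"
  proof (rule filterlim_at_top_mult_tendsto_pos)
    have "((\<lambda>L. (1 + ln D) / real L + 2) \<longlongrightarrow> 0 + 2) sequentially"
      by (intro tendsto_intros real_tendsto_divide_at_top[OF tendsto_const] filterlim_real_sequentially)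
    then show "((\<lambda>L. ((1 + ln D) / real L + 2) powr (- \<gamma>)) \<longlongrightarrow> 2 powr (- \<gamma>)) sequentially"
      by (intro tendsto_intros) auto
    have "filterlim (\<lambda>L. exp ((1 / p - \<gamma>) * ln (real L))) at_top sequentially"
      by (intro filterlim_compose[OF exp_at_top] filterlim_tendsto_pos_mult_at_top[OF tendsto_const]
          filterlim_compose[OF ln_at_top] filterlim_real_sequentially) (use \<gamma> in simp)
    then show "filterlim (\<lambda>L. real L powr (1 / p - \<gamma>)) at_top sequentially"
    proof (rule filterlim_mono_eventually)
      show "\<forall>\<^sub>F L in sequentially. exp ((1 / p - \<gamma>) * ln (real L)) = real L powr (1 / p - \<gamma>)"
        using eventually_gt_at_top[of 0] by eventually_elim (simp add: powr_def)
    qed simp_all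
  qed simp
  then have big: "\<forall>\<^sub>F L in sequentially. exp 2 * C * C' powr (1 / p)
      < real L powr (1 / p - \<gamma>) * ((1 + ln D) / real L + 2) powr (- \<gamma>)"
    by (simp add: filterlim_at_top_dense)
  have "((\<lambda>L. exp (- real L)) \<longlongrightarrow> 0) sequentially"
    by (intro filterlim_compose[OF exp_at_bot] filterlim_compose[OF filterlim_uminus_at_bot_at_top]
        filterlim_real_sequentially)
  then have small: "\<forall>\<^sub>F L in sequentially. exp (- real L) < r"
    using r(1) by (rule order_tendstoD)
  have "filterlim (\<lambda>L. (1 + ln D) + 2 * real L) at_top sequentially"
    by (intro filterlim_tendsto_add_at_top[OF tendsto_const] filterlim_tendsto_pos_mult_at_top[OF tendsto_const]
        filterlim_real_sequentially) auto
  then have ev: "\<forall>\<^sub>F L in sequentially. 0 < (1 + ln D) + 2 * real L"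
    by (simp add: filterlim_at_top_dense)
  have "\<forall>\<^sub>F L in sequentially. False"
    using big small ev eventually_gt_at_top[of 0]
  proof eventually_elim
    case (elim L)
    have L: "real L > 0" using elim by simp
    have "exp (- 2) * (1 + 2 * real L + ln D) powr (- \<gamma>) \<le> C * (C' / real L) powr (1 / p)"
      using elim by (intro lower) (auto simp: algebra_simps)
    also have "1 + 2 * real L + ln D = real L * ((1 + ln D) / real L + 2)"
      using L by (simp add: field_simps)
    also have "C * (C' / real L) powr (1 / p) = C * C' powr (1 / p) * real L powr (- (1 / p))"
      using L C' by (simp add: powr_divide powr_minus_divide)
    finally have "exp (- 2) * (real L powr (- \<gamma>) * ((1 + ln D) / real L + 2) powr (- \<gamma>))
        \<le> C * C' powr (1 / p) * real L powr (- (1 / p))"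
      by (simp only: powr_mult)
    then have "exp 2 * real L powr (1 / p) * (exp (- 2) * (real L powr (- \<gamma>) * ((1 + ln D) / real L + 2) powr (- \<gamma>)))
        \<le> exp 2 * real L powr (1 / p) * (C * C' powr (1 / p) * real L powr (- (1 / p)))"
      by (intro mult_left_mono) auto
    also have "\<dots> = exp 2 * C * C' powr (1 / p) * (real L powr (1 / p) * real L powr (- (1 / p)))"
      by simp
    also have "real L powr (1 / p) * real L powr (- (1 / p)) = 1"
      using L by (simp only: powr_add[symmetric]) simp
    also have "exp 2 * real L powr (1 / p) * (exp (- 2) * (real L powr (- \<gamma>) * ((1 + ln D) / real L + 2) powr (- \<gamma>)))
        = (exp 2 * exp (- 2)) * ((real L powr (1 / p) * real L powr (- \<gamma>)) * ((1 + ln D) / real L + 2) powr (- \<gamma>))"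
      by simp
    also have "exp 2 * exp (- 2) = (1 :: real)" by (simp add: exp_minus)
    also have "real L powr (1 / p) * real L powr (- \<gamma>) = real L powr (1 / p - \<gamma>)"
      by (simp only: powr_add[symmetric]) simp
    finally show False using elim by simp
  qed
  then show False by simp
qed

theorem theoremB:
  fixes p :: real
  assumes "p > real CARD('n::finite)"
  shows
    "(\<exists>B C. B \<ge> 1 \<and> C > 0 \<and>
       (\<forall>\<Omega> :: (real ^ 'n) set. open \<Omega> \<longrightarrow> connected \<Omega> \<longrightarrow> bounded \<Omega> \<longrightarrow> 0 \<in> \<Omega> \<longrightarrow>
         (\<forall>u \<in> Cc_infinity (\<Omega> - {0}).
            weighted_holder_sup p (1 / p) (B * diameter \<Omega>) \<Omega> u
              \<le> ereal (C * hardy_difference p \<Omega> u powr (1 / p)))))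
     \<and>
     (\<forall>\<Omega> :: (real ^ 'n) set. open \<Omega> \<longrightarrow> connected \<Omega> \<longrightarrow> bounded \<Omega> \<longrightarrow> 0 \<in> \<Omega> \<longrightarrow>
       (\<forall>\<gamma> < 1 / p.
          \<not> (\<exists>B C. B \<ge> 1 \<and> C > 0 \<and>
                (\<forall>u \<in> Cc_infinity (\<Omega> - {0}).
                   weighted_holder_sup p \<gamma> (B * diameter \<Omega>) \<Omega> u
                     \<le> ereal (C * hardy_difference p \<Omega> u powr (1 / p))))))"
proof (intro conjI)
  obtain C where "C > 0" and "\<And>(\<Omega> :: (real ^ 'n) set) u. u \<in> Cc_infinity (\<Omega> - {0}) \<Longrightarrow>
    open \<Omega> \<Longrightarrow> bounded \<Omega> \<Longrightarrow> 0 \<in> \<Omega> \<Longrightarrow>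
    weighted_holder_sup p (1 / p) (2 * diameter \<Omega>) \<Omega> u
      \<le> ereal (C * hardy_difference p \<Omega> u powr (1 / p))"
    using hardy_morrey_inequality[OF assms] by metis
  then show "\<exists>B C. B \<ge> 1 \<and> C > 0 \<and>
       (\<forall>\<Omega> :: (real ^ 'n) set. open \<Omega> \<longrightarrow> connected \<Omega> \<longrightarrow> bounded \<Omega> \<longrightarrow> 0 \<in> \<Omega> \<longrightarrow>
         (\<forall>u \<in> Cc_infinity (\<Omega> - {0}).
            weighted_holder_sup p (1 / p) (B * diameter \<Omega>) \<Omega> u
              \<le> ereal (C * hardy_difference p \<Omega> u powr (1 / p))))"
    by (intro exI[of _ 2] exI[of _ C]) auto
next
  show "\<forall>\<Omega> :: (real ^ 'n) set. open \<Omega> \<longrightarrow> connected \<Omega> \<longrightarrow> bounded \<Omega> \<longrightarrow> 0 \<in> \<Omega> \<longrightarrow>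
       (\<forall>\<gamma> < 1 / p.
          \<not> (\<exists>B C. B \<ge> 1 \<and> C > 0 \<and>
                (\<forall>u \<in> Cc_infinity (\<Omega> - {0}).
                   weighted_holder_sup p \<gamma> (B * diameter \<Omega>) \<Omega> u
                     \<le> ereal (C * hardy_difference p \<Omega> u powr (1 / p)))))"
    using log_power_optimal[OF assms] by blast
qed

end
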